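(* Let $(M,g)$ be a transverse Riemann-Lorentz space with tangent radical and singular hypersurface $\Sigma$. (a) Let $\mathcal A,\mathcal B,\mathcal C,\mathcal D\in\mathfrak{X}(M)$, with restrictions $A,B,C,D$ to $\Sigma$. Then $\langle R(\mathcal A^o,\mathcal B^o)\mathcal C^o,\mathcal D^o\rangle\cong0$ if and only if $\Upsilon(A,B,C,D)=0$. (b) Consider the assertions: (1) for all such $A,B,C,D$: if $\det\begin{pmatrix}\nu(A)&\nu(B)\\ \rho(A)&\rho(B)\end{pmatrix}\cdot\det\begin{pmatrix}\nu(C)&\nu(D)\\ \rho(C)&\rho(D)\end{pmatrix}=0$ then $\Upsilon(A,B,C,D)=0$; (2) $\Sigma$ is $II$-flat; (3) for all such $A,B,C,D$: if $\Upsilon(A,B,C,D)=0$ then $\det\begin{pmatrix}\nu(A)&\nu(B)\\ \rho(A)&\rho(B)\end{pmatrix}\cdot\det\begin{pmatrix}\nu(C)&\nu(D)\\ \rho(C)&\rho(D)\end{pmatrix}=0$. Then (1) $\Leftrightarrow$ (2) $\Rightarrow$ (3).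
   Context: $M$ is a connected smooth manifold of dimension $m>2$ with a smooth symmetric $(0,2)$-tensor field $g=\langle\cdot,\cdot\rangle$ which fails to have maximal rank exactly on a nonempty set $\Sigma\subset M$. $(M,g)$ is a transverse singular space if in every local coordinate system $\det(g_{ab})$ has nonzero differential at the points of $\Sigma$; then $\Sigma$ is a smooth hypersurface (the singular hypersurface) and the radical $Rad_p=\{v\in T_pM: g(v,\cdot)=0\}$, $p\in\Sigma$, is one-dimensional. Tangent radical: $Rad_p\subset T_p\Sigma$ for all $p\in\Sigma$. Riemann-Lorentz: the signature of $g$ changes from Riemannian to Lorentzian across $\Sigma$. $\mathfrak{X}_\Sigma$: smooth vector fields along $\Sigma$; $\mathfrak{X}(\Sigma)$: those tangent to $\Sigma$. For $\mathcal A\in\mathfrak{X}(M)$, $\mathcal A^o=\mathcal A|_{M-\Sigma}$; $\mathcal A$ is an extension of $A=\mathcal A|_\Sigma$. Everything is local: $M$ may be replaced by a small neighbourhood of (a point of) $\Sigma$, and vector fields may be only locally defined. Dual connection: $2\square_{\mathcal A}\mathcal B(\mathcal C)=\mathcal A\langle\mathcal B,\mathcal C\rangle+\mathcal B\langle\mathcal C,\mathcal A\rangle-\mathcal C\langle\mathcal A,\mathcal B\rangle+\langle[\mathcal A,\mathcal B],\mathcal C\rangle-\langle[\mathcal B,\mathcal C],\mathcal A\rangle+\langle[\mathcal C,\mathcal A],\mathcal B\rangle$. For a radical vector field $R'$ along $\Sigma$, $II_{R'}(A,B):=\square_AB(R')$ is a well-defined symmetric $C^\infty(\Sigma)$-bilinear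 map on $\mathfrak{X}_\Sigma$. The main normal $N\in\mathfrak{X}_\Sigma$ satisfies $\langle N,T\Sigma\rangle=0$, $II_{R'}(N,N)=0$ for radical $R'$, $\langle N,N\rangle=1$ (unique up to sign). Second fundamental form: the symmetric tensor $\mathcal H(X,Y):=\square_XY(N)=-\square_XN(Y)$ on $\Sigma$. The main radical vector field $R\in\mathfrak{X}(\Sigma)$ is in the radical distribution with $\mathcal H(R,R)=-1$ (unique up to sign, the sign of $N$ being chosen to make this possible). $II:=II_R$. Canonical screen distribution: $S_p:=\{v\in T_p\Sigma:\mathcal H(v,R(p))=0\}$, a complement of $Rad_p$ in $T_p\Sigma$; $\Gamma(S)$ is its module of sections. $\Sigma$ is $II$-flat if $II(V,W)=0$ for all $V,W\in\Gamma(S)$ (equivalently $II(X,Y)=0$ for all $X,Y\in\mathfrak{X}(\Sigma)$). Each $A\in\mathfrak{X}_\Sigma$ decomposes as $A=\nu(A)N+A^S+\rho(A)R$ with $A^S\in\Gamma(S)$, $\nu(A)=\langle A,N\rangle$, $\rho(A)=-\mathcal H(A-\nu(A)N,R)$. Let $\nabla$ be the Levi-Civita connection on $M-\Sigma$, with curvature $R(\mathcal A,\mathcal B)\mathcal C=\nabla_{\mathcal A}\nabla_{\mathcal B}\mathcal C-\nabla_{\mathcal B}\nabla_{\mathcal A}\mathcal C-\nabla_{[\mathcal A,\mathcal B]}\mathcal C$. $N$ has a unique local extension $\mathcal N\in\mathfrak{X}(M)$ which is $\nabla$-geodesic on $M-\Sigma$; the canonical extension of $A\in\mathfrak{X}_\Sigma$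 is the unique extension $\mathcal A$ with $[\mathcal N,\mathcal A]=0$. Let $\mathcal R$ be the canonical extension of $R$ and $\tau:=\langle\mathcal R,\mathcal R\rangle$ (then $\tau=0$ on $\Sigma$ and $d\tau\neq0$ there). $\Upsilon$ is the smooth $(0,4)$-tensor field on $M$ given on $M-\Sigma$ by $\Upsilon(\mathcal A,\mathcal B,\mathcal C,\mathcal D)=\tau\langle R(\mathcal A,\mathcal B)\mathcal C,\mathcal D\rangle$; on $\Sigma$, $\Upsilon(A,B,C,D)=II(A,C)II(B,D)-II(A,D)II(B,C)$. For a smooth function $F$ on $M-\Sigma$, $F\cong0$ means that $F$ extends smoothly to $M$. *)

theory Defs
  imports "HOL-Analysis.Analysis"
begin

section \<open>Smooth manifolds\<close>

text \<open>Meant for open sets \<open>S\<close> of finite-dimensional spaces, where it is the usual notion of being of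
  class \<open>C\<^sup>k\<close>.\<close>

primrec Ck :: "nat \<Rightarrow> 'e::real_normed_vector set \<Rightarrow> ('e \<Rightarrow> 'f::real_normed_vector) \<Rightarrow> bool" where
  "Ck 0 S f \<longleftrightarrow> continuous_on S f"
| "Ck (Suc k) S f \<longleftrightarrow>
     (\<forall>x\<in>S. f differentiable (at x)) \<and> (\<forall>v. Ck k S (\<lambda>x. frechet_derivative f (at x) v))"

definition Cinf :: "'e::real_normed_vector set \<Rightarrow> ('e \<Rightarrow> 'f::real_normed_vector) \<Rightarrow> bool" where
  "Cinf S f \<longleftrightarrow> (\<forall>k. Ck k S f)"

text \<open>A chart is a domain with a coordinate map; only the values of the map on the domain matter.\<close>

type_synonym ('a, 'm) chart = "'a set \<times> ('a \<Rightarrow> real ^ 'm)"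

definition chart_inv :: "('a, 'm::finite) chart \<Rightarrow> real ^ 'm \<Rightarrow> 'a" where
  "chart_inv c = inv_into (fst c) (snd c)"

definition is_chart :: "('a::topological_space, 'm::finite) chart \<Rightarrow> bool" where
  "is_chart c \<longleftrightarrow> open (fst c) \<and> open (snd c ` fst c) \<and>
     homeomorphism (fst c) (snd c ` fst c) (snd c) (chart_inv c)"

definition smooth_transition :: "('a, 'm::finite) chart \<Rightarrow> ('a, 'm) chart \<Rightarrow> bool" where
  "smooth_transition c d \<longleftrightarrow> Cinf (snd c ` (fst c \<inter> fst d)) (snd d \<circ> chart_inv c)"

definition mcarrier :: "('a, 'm::finite) chart set \<Rightarrow> 'a set" where
  "mcarrier \<A> = \<Union> (fst ` \<A>)"

text \<open>A smooth structure is a maximal smooth atlas, so membership in \<open>\<A>\<close> means being a local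
  coordinate system of the manifold \<open>mcarrier \<A>\<close>.\<close>

definition smooth_structure :: "('a::topological_space, 'm::finite) chart set \<Rightarrow> bool" where
  "smooth_structure \<A> \<longleftrightarrow>
     (\<forall>c\<in>\<A>. is_chart c) \<and>
     (\<forall>c\<in>\<A>. \<forall>d\<in>\<A>. smooth_transition c d) \<and>
     (\<forall>c. is_chart c \<and> fst c \<subseteq> mcarrier \<A> \<and>
          (\<forall>d\<in>\<A>. smooth_transition c d \<and> smooth_transition d c) \<longrightarrow> c \<in> \<A>)"

definition smooth_fun :: "('a, 'm::finite) chart set \<Rightarrow> 'a set \<Rightarrow> ('a \<Rightarrow> real) \<Rightarrow> bool" where
  "smooth_fun \<A> U f \<longleftrightarrow> (\<forall>c\<in>\<A>. Cinf (snd c ` (fst c \<inter> U)) (f \<circ> chart_inv c))"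

definition smooth_near ::
  "('a::topological_space, 'm::finite) chart set \<Rightarrow> 'a \<Rightarrow> ('a \<Rightarrow> real) \<Rightarrow> bool" where
  "smooth_near \<A> p f \<longleftrightarrow> (\<exists>U. open U \<and> p \<in> U \<and> smooth_fun \<A> U f)"


section \<open>Tangent vectors and vector fields\<close>

text \<open>Tangent vectors at \<open>p\<close> are the derivations on germs of smooth functions at \<open>p\<close>. They are
  functions on all of \<open>'a \<Rightarrow> real\<close>, set to \<open>0\<close> on functions that are not smooth near \<open>p\<close>, so
  that equality in \<open>T\<^sub>pM\<close> is equality of functions.\<close>

type_synonym 'a tvec = "('a \<Rightarrow> real) \<Rightarrow> real"
type_synonym 'a vfield = "'a \<Rightarrow> 'a tvec"
type_synonym 'a form2 = "'a \<Rightarrow> 'a tvec \<Rightarrow> 'a tvec \<Rightarrow> real"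
type_synonym 'a form4 = "'a \<Rightarrow> 'a tvec \<Rightarrow> 'a tvec \<Rightarrow> 'a tvec \<Rightarrow> 'a tvec \<Rightarrow> real"

definition tspace ::
  "('a::topological_space, 'm::finite) chart set \<Rightarrow> 'a \<Rightarrow> 'a tvec set" where
  "tspace \<A> p = {v.
     (\<forall>f. \<not> smooth_near \<A> p f \<longrightarrow> v f = 0) \<and>
     (\<forall>f h. smooth_near \<A> p f \<and> eventually (\<lambda>q. f q = h q) (nhds p) \<longrightarrow> v f = v h) \<and>
     (\<forall>f h. smooth_near \<A> p f \<and> smooth_near \<A> p h \<longrightarrow> v (\<lambda>q. f q + h q) = v f + v h) \<and>
     (\<forall>a f. smooth_near \<A> p f \<longrightarrow> v (\<lambda>q. a * f q) = a * v f) \<and>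
     (\<forall>f h. smooth_near \<A> p f \<and> smooth_near \<A> p h \<longrightarrow>
        v (\<lambda>q. f q * h q) = f p * v h + h p * v f)}"

definition coord_vec ::
  "('a::topological_space, 'm::finite) chart set \<Rightarrow> ('a, 'm) chart \<Rightarrow> 'm \<Rightarrow> 'a vfield" where
  "coord_vec \<A> c i p f =
     (if smooth_near \<A> p f
      then frechet_derivative (f \<circ> chart_inv c) (at (snd c p)) (axis i 1) else 0)"

definition vfield_on ::
  "('a::topological_space, 'm::finite) chart set \<Rightarrow> 'a set \<Rightarrow> 'a vfield \<Rightarrow> bool" where
  "vfield_on \<A> U X \<longleftrightarrow>
     (\<forall>p\<in>U. X p \<in> tspace \<A> p) \<and>
     (\<forall>V f. open V \<and> V \<subseteq> U \<and> smooth_fun \<A> V f \<longrightarrow> smooth_fun \<A> V (\<lambda>p. X p f))"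

definition vf_add :: "'a vfield \<Rightarrow> 'a vfield \<Rightarrow> 'a vfield" where
  "vf_add X Y = (\<lambda>p f. X p f + Y p f)"

definition vf_scale :: "('a \<Rightarrow> real) \<Rightarrow> 'a vfield \<Rightarrow> 'a vfield" where
  "vf_scale h X = (\<lambda>p f. h p * X p f)"

definition lie ::
  "('a::topological_space, 'm::finite) chart set \<Rightarrow> 'a vfield \<Rightarrow> 'a vfield \<Rightarrow> 'a vfield" where
  "lie \<A> X Y p f =
     (if smooth_near \<A> p f then X p (\<lambda>q. Y q f) - Y p (\<lambda>q. X q f) else 0)"

definition tlinear ::
  "('a::topological_space, 'm::finite) chart set \<Rightarrow> 'a \<Rightarrow> ('a tvec \<Rightarrow> real) \<Rightarrow> bool" where
  "tlinear \<A> p L \<longleftrightarrow>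
     (\<forall>v\<in>tspace \<A> p. \<forall>w\<in>tspace \<A> p. L (\<lambda>f. v f + w f) = L v + L w) \<and>
     (\<forall>a. \<forall>v\<in>tspace \<A> p. L (\<lambda>f. a * v f) = a * L v)"

definition smooth_sym_form2 ::
  "('a::topological_space, 'm::finite) chart set \<Rightarrow> 'a form2 \<Rightarrow> bool" where
  "smooth_sym_form2 \<A> g \<longleftrightarrow>
     (\<forall>p\<in>mcarrier \<A>. \<forall>v\<in>tspace \<A> p. tlinear \<A> p (g p v)) \<and>
     (\<forall>p\<in>mcarrier \<A>. \<forall>v\<in>tspace \<A> p. \<forall>w\<in>tspace \<A> p. g p v w = g p w v) \<and>
     (\<forall>U X Y. open U \<and> U \<subseteq> mcarrier \<A> \<and> vfield_on \<A> U X \<and> vfield_on \<A> U Y \<longrightarrow>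
        smooth_fun \<A> U (\<lambda>p. g p (X p) (Y p)))"

definition smooth_form4_on ::
  "('a::topological_space, 'm::finite) chart set \<Rightarrow> 'a set \<Rightarrow> 'a form4 \<Rightarrow> bool" where
  "smooth_form4_on \<A> W T \<longleftrightarrow>
     (\<forall>p\<in>W. \<forall>u\<in>tspace \<A> p. \<forall>v\<in>tspace \<A> p. \<forall>w\<in>tspace \<A> p.
        tlinear \<A> p (\<lambda>x. T p x u v w) \<and> tlinear \<A> p (\<lambda>x. T p u x v w) \<and>
        tlinear \<A> p (\<lambda>x. T p u v x w) \<and> tlinear \<A> p (\<lambda>x. T p u v w x)) \<and>
     (\<forall>U A B C D. open U \<and> U \<subseteq> W \<and>
        vfield_on \<A> U A \<and> vfield_on \<A> U B \<and> vfield_on \<A> U C \<and> vfield_on \<A> U D \<longrightarrow>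
        smooth_fun \<A> U (\<lambda>p. T p (A p) (B p) (C p) (D p)))"


section \<open>Singular metrics\<close>

definition radical ::
  "('a::topological_space, 'm::finite) chart set \<Rightarrow> 'a form2 \<Rightarrow> 'a \<Rightarrow> 'a tvec set" where
  "radical \<A> g p = {v \<in> tspace \<A> p. \<forall>w\<in>tspace \<A> p. g p v w = 0}"

definition sing ::
  "('a::topological_space, 'm::finite) chart set \<Rightarrow> 'a form2 \<Rightarrow> 'a set" where
  "sing \<A> g = {p \<in> mcarrier \<A>. radical \<A> g p \<noteq> {\<lambda>f. 0}}"

definition gram_det ::
  "('a::topological_space, 'm::finite) chart set \<Rightarrow> 'a form2 \<Rightarrow> ('a, 'm) chart \<Rightarrow> 'a \<Rightarrow> real" where
  "gram_det \<A> g c p = det (\<chi> i j. g p (coord_vec \<A> c i p) (coord_vec \<A> c j p))"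

definition transverse_singular ::
  "('a::topological_space, 'm::finite) chart set \<Rightarrow> 'a form2 \<Rightarrow> bool" where
  "transverse_singular \<A> g \<longleftrightarrow> smooth_sym_form2 \<A> g \<and> sing \<A> g \<noteq> {} \<and>
     (\<forall>c\<in>\<A>. \<forall>p \<in> fst c \<inter> sing \<A> g.
        frechet_derivative (gram_det \<A> g c \<circ> chart_inv c) (at (snd c p)) \<noteq> (\<lambda>v. 0))"

text \<open>\<open>g p\<close> is nondegenerate of index \<open>k\<close>: it has an orthonormal family of \<open>m\<close> vectors
  (necessarily a basis of the \<open>m\<close>-dimensional space \<open>T\<^sub>pM\<close>) with exactly \<open>k\<close> timelike members.\<close>

definition has_index ::
  "('a::topological_space, 'm::finite) chart set \<Rightarrow> 'a form2 \<Rightarrow> 'a \<Rightarrow> nat \<Rightarrow> bool" where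
  "has_index \<A> g p k \<longleftrightarrow> (\<exists>(e :: 'm \<Rightarrow> 'a tvec) I. card I = k \<and> (\<forall>i. e i \<in> tspace \<A> p) \<and>
     (\<forall>i j. g p (e i) (e j) = (if i \<noteq> j then 0 else if i \<in> I then - 1 else 1)))"

definition riemann_lorentz ::
  "('a::topological_space, 'm::finite) chart set \<Rightarrow> 'a form2 \<Rightarrow> bool" where
  "riemann_lorentz \<A> g \<longleftrightarrow>
     (\<forall>q \<in> mcarrier \<A> - sing \<A> g. has_index \<A> g q 0 \<or> has_index \<A> g q 1) \<and>
     (\<forall>p \<in> sing \<A> g. p \<in> closure {q \<in> mcarrier \<A> - sing \<A> g. has_index \<A> g q 0} \<and>
                      p \<in> closure {q \<in> mcarrier \<A> - sing \<A> g. has_index \<A> g q 1})"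

text \<open>\<open>T\<^sub>pS\<close> as a subspace of \<open>T\<^sub>pM\<close>, for an embedded submanifold \<open>S\<close>.\<close>

definition tspace_sub ::
  "('a::topological_space, 'm::finite) chart set \<Rightarrow> 'a set \<Rightarrow> 'a \<Rightarrow> 'a tvec set" where
  "tspace_sub \<A> S p = {v \<in> tspace \<A> p.
     \<forall>f. smooth_near \<A> p f \<and> (\<forall>q\<in>S. f q = 0) \<longrightarrow> v f = 0}"

definition tangent_radical ::
  "('a::topological_space, 'm::finite) chart set \<Rightarrow> 'a form2 \<Rightarrow> bool" where
  "tangent_radical \<A> g \<longleftrightarrow>
     (\<forall>p \<in> sing \<A> g. radical \<A> g p \<subseteq> tspace_sub \<A> (sing \<A> g) p)"


section \<open>Connections and curvature\<close>

definition dual_conn ::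
  "('a::topological_space, 'm::finite) chart set \<Rightarrow> 'a form2 \<Rightarrow>
   'a vfield \<Rightarrow> 'a vfield \<Rightarrow> 'a vfield \<Rightarrow> 'a \<Rightarrow> real" where
  "dual_conn \<A> g A B C p =
     (A p (\<lambda>q. g q (B q) (C q)) + B p (\<lambda>q. g q (C q) (A q)) - C p (\<lambda>q. g q (A q) (B q))
      + g p (lie \<A> A B p) (C p) - g p (lie \<A> B C p) (A p) + g p (lie \<A> C A p) (B p)) / 2"

text \<open>A connection acts on locally defined fields: for fields smooth on an open \<open>U \<subseteq> V\<close>, its
  values on \<open>U\<close> are the ones that matter.\<close>

definition levi_civita ::
  "('a::topological_space, 'm::finite) chart set \<Rightarrow> 'a form2 \<Rightarrow> 'a set \<Rightarrow>
   ('a vfield \<Rightarrow> 'a vfield \<Rightarrow> 'a vfield) \<Rightarrow> bool" where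
  "levi_civita \<A> g V nabla \<longleftrightarrow> (\<forall>U X Y Z h.
     open U \<and> U \<subseteq> V \<and> vfield_on \<A> U X \<and> vfield_on \<A> U Y \<and> vfield_on \<A> U Z \<and> smooth_fun \<A> U h \<longrightarrow>
       vfield_on \<A> U (nabla X Y) \<and>
       (\<forall>p\<in>U.
         nabla (vf_add X Y) Z p = vf_add (nabla X Z) (nabla Y Z) p \<and>
         nabla (vf_scale h X) Z p = vf_scale h (nabla X Z) p \<and>
         nabla X (vf_add Y Z) p = vf_add (nabla X Y) (nabla X Z) p \<and>
         nabla X (vf_scale h Y) p = vf_add (vf_scale (\<lambda>q. X q h) Y) (vf_scale h (nabla X Y)) p \<and>
         (\<forall>f. nabla X Y p f - nabla Y X p f = lie \<A> X Y p f) \<and>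
         X p (\<lambda>q. g q (Y q) (Z q)) = g p (nabla X Y p) (Z p) + g p (Y p) (nabla X Z p)))"

definition curv ::
  "('a::topological_space, 'm::finite) chart set \<Rightarrow> ('a vfield \<Rightarrow> 'a vfield \<Rightarrow> 'a vfield) \<Rightarrow>
   'a vfield \<Rightarrow> 'a vfield \<Rightarrow> 'a vfield \<Rightarrow> 'a vfield" where
  "curv \<A> nabla A B C p f =
     nabla A (nabla B C) p f - nabla B (nabla A C) p f - nabla (lie \<A> A B) C p f"


section \<open>Geometry of the singular hypersurface\<close>

definition extends_on ::
  "('a::topological_space, 'm::finite) chart set \<Rightarrow> 'a set \<Rightarrow> 'a set \<Rightarrow> 'a vfield \<Rightarrow> 'a vfield \<Rightarrow> bool"
  where
  "extends_on \<A> S U X A \<longleftrightarrow> open U \<and> U \<subseteq> mcarrier \<A> \<and> vfield_on \<A> U X \<and> (\<forall>q \<in> U \<inter> S. X q = A q)"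

definition vfield_along ::
  "('a::topological_space, 'm::finite) chart set \<Rightarrow> 'a set \<Rightarrow> 'a vfield \<Rightarrow> bool" where
  "vfield_along \<A> S A \<longleftrightarrow> (\<forall>p\<in>S. \<exists>U X. p \<in> U \<and> extends_on \<A> S U X A)"

definition vfield_tangent ::
  "('a::topological_space, 'm::finite) chart set \<Rightarrow> 'a set \<Rightarrow> 'a vfield \<Rightarrow> bool" where
  "vfield_tangent \<A> S A \<longleftrightarrow> vfield_along \<A> S A \<and> (\<forall>p\<in>S. A p \<in> tspace_sub \<A> S p)"

text \<open>The common value at \<open>p\<close> of the dual connection on all local extensions of the fields \<open>A\<close>, \<open>B\<close>, \<open>C\<close>
  along \<open>\<Sigma>\<close>. It is well defined in the two cases used below: \<open>C\<close> radical, or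
  \<open>A\<close> and \<open>B\<close> tangent to \<open>\<Sigma>\<close>.\<close>

definition dual_conn_along ::
  "('a::topological_space, 'm::finite) chart set \<Rightarrow> 'a form2 \<Rightarrow>
   'a vfield \<Rightarrow> 'a vfield \<Rightarrow> 'a vfield \<Rightarrow> 'a \<Rightarrow> real" where
  "dual_conn_along \<A> g A B C p = (THE r. \<forall>U X Y Z. p \<in> U \<and>
     extends_on \<A> (sing \<A> g) U X A \<and> extends_on \<A> (sing \<A> g) U Y B \<and> extends_on \<A> (sing \<A> g) U Z C
     \<longrightarrow> dual_conn \<A> g X Y Z p = r)"

definition II ::
  "('a::topological_space, 'm::finite) chart set \<Rightarrow> 'a form2 \<Rightarrow>
   'a vfield \<Rightarrow> 'a vfield \<Rightarrow> 'a vfield \<Rightarrow> 'a \<Rightarrow> real" where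
  "II \<A> g R A B = dual_conn_along \<A> g A B R"

definition HH ::
  "('a::topological_space, 'm::finite) chart set \<Rightarrow> 'a form2 \<Rightarrow>
   'a vfield \<Rightarrow> 'a vfield \<Rightarrow> 'a vfield \<Rightarrow> 'a \<Rightarrow> real" where
  "HH \<A> g N X Y = dual_conn_along \<A> g X Y N"

definition radical_field ::
  "('a::topological_space, 'm::finite) chart set \<Rightarrow> 'a form2 \<Rightarrow> 'a vfield \<Rightarrow> bool" where
  "radical_field \<A> g R \<longleftrightarrow> vfield_along \<A> (sing \<A> g) R \<and> (\<forall>p \<in> sing \<A> g. R p \<in> radical \<A> g p)"

definition main_normal ::
  "('a::topological_space, 'm::finite) chart set \<Rightarrow> 'a form2 \<Rightarrow> 'a vfield \<Rightarrow> bool" where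
  "main_normal \<A> g N \<longleftrightarrow> vfield_along \<A> (sing \<A> g) N \<and>
     (\<forall>p \<in> sing \<A> g. \<forall>v \<in> tspace_sub \<A> (sing \<A> g) p. g p (N p) v = 0) \<and>
     (\<forall>R'. radical_field \<A> g R' \<longrightarrow> (\<forall>p \<in> sing \<A> g. II \<A> g R' N N p = 0)) \<and>
     (\<forall>p \<in> sing \<A> g. g p (N p) (N p) = 1)"

definition main_radical ::
  "('a::topological_space, 'm::finite) chart set \<Rightarrow> 'a form2 \<Rightarrow> 'a vfield \<Rightarrow> 'a vfield \<Rightarrow> bool" where
  "main_radical \<A> g N R \<longleftrightarrow> vfield_tangent \<A> (sing \<A> g) R \<and> radical_field \<A> g R \<and>
     (\<forall>p \<in> sing \<A> g. HH \<A> g N R R p = - 1)"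

definition screen_section ::
  "('a::topological_space, 'm::finite) chart set \<Rightarrow> 'a form2 \<Rightarrow> 'a vfield \<Rightarrow> 'a vfield \<Rightarrow>
   'a vfield \<Rightarrow> bool" where
  "screen_section \<A> g N R V \<longleftrightarrow> vfield_tangent \<A> (sing \<A> g) V \<and>
     (\<forall>p \<in> sing \<A> g. HH \<A> g N V R p = 0)"

definition II_flat ::
  "('a::topological_space, 'm::finite) chart set \<Rightarrow> 'a form2 \<Rightarrow> 'a vfield \<Rightarrow> 'a vfield \<Rightarrow> bool" where
  "II_flat \<A> g N R \<longleftrightarrow> (\<forall>V W. screen_section \<A> g N R V \<and> screen_section \<A> g N R W \<longrightarrow>
     (\<forall>p \<in> sing \<A> g. II \<A> g R V W p = 0))"

definition nu :: "'a form2 \<Rightarrow> 'a vfield \<Rightarrow> 'a vfield \<Rightarrow> 'a \<Rightarrow> real" where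
  "nu g N A p = g p (A p) (N p)"

definition rho ::
  "('a::topological_space, 'm::finite) chart set \<Rightarrow> 'a form2 \<Rightarrow> 'a vfield \<Rightarrow> 'a vfield \<Rightarrow>
   'a vfield \<Rightarrow> 'a \<Rightarrow> real" where
  "rho \<A> g N R A p = - HH \<A> g N (vf_add A (vf_scale (\<lambda>q. - nu g N A q) N)) R p"

definition nu_rho_det ::
  "('a::topological_space, 'm::finite) chart set \<Rightarrow> 'a form2 \<Rightarrow> 'a vfield \<Rightarrow> 'a vfield \<Rightarrow>
   'a vfield \<Rightarrow> 'a vfield \<Rightarrow> 'a \<Rightarrow> real" where
  "nu_rho_det \<A> g N R A B p =
     det (vector [vector [nu g N A p, nu g N B p],
                  vector [rho \<A> g N R A p, rho \<A> g N R B p]] :: real ^ 2 ^ 2)"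

text \<open>The extensions of \<open>N\<close> and of \<open>R\<close> need only exist on some open neighbourhood \<open>W\<close> of \<open>\<Sigma>\<close>.\<close>

definition geodesic_extension ::
  "('a::topological_space, 'm::finite) chart set \<Rightarrow> 'a form2 \<Rightarrow>
   ('a vfield \<Rightarrow> 'a vfield \<Rightarrow> 'a vfield) \<Rightarrow> 'a set \<Rightarrow> 'a vfield \<Rightarrow> 'a vfield \<Rightarrow> bool" where
  "geodesic_extension \<A> g nabla W N NN \<longleftrightarrow>
     extends_on \<A> (sing \<A> g) W NN N \<and> (\<forall>p \<in> W - sing \<A> g. nabla NN NN p = (\<lambda>f. 0))"

definition canonical_extension ::
  "('a::topological_space, 'm::finite) chart set \<Rightarrow> 'a form2 \<Rightarrow> 'a set \<Rightarrow>
   'a vfield \<Rightarrow> 'a vfield \<Rightarrow> 'a vfield \<Rightarrow> bool" where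
  "canonical_extension \<A> g W NN A AA \<longleftrightarrow>
     extends_on \<A> (sing \<A> g) W AA A \<and> (\<forall>p\<in>W. lie \<A> NN AA p = (\<lambda>f. 0))"

text \<open>\<open>T\<close> is the smooth tensor field on \<open>W\<close> which off \<open>\<Sigma>\<close> is \<open>\<langle>\<R>,\<R>\<rangle>\<close> times the curvature
  tensor, \<open>\<R>\<close> (here \<open>RR\<close>) being the canonical extension of the main radical field. As \<open>\<Sigma>\<close> has
  empty interior, this determines \<open>T\<close> on \<open>\<Sigma>\<close> as well.\<close>

definition is_upsilon ::
  "('a::topological_space, 'm::finite) chart set \<Rightarrow> 'a form2 \<Rightarrow>
   ('a vfield \<Rightarrow> 'a vfield \<Rightarrow> 'a vfield) \<Rightarrow> 'a set \<Rightarrow> 'a vfield \<Rightarrow> 'a form4 \<Rightarrow> bool" where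
  "is_upsilon \<A> g nabla W RR T \<longleftrightarrow> smooth_form4_on \<A> W T \<and>
     (\<forall>U A B C D. open U \<and> U \<subseteq> W - sing \<A> g \<and>
        vfield_on \<A> U A \<and> vfield_on \<A> U B \<and> vfield_on \<A> U C \<and> vfield_on \<A> U D \<longrightarrow>
        (\<forall>p\<in>U. T p (A p) (B p) (C p) (D p)
                = g p (RR p) (RR p) * g p (curv \<A> nabla A B C p) (D p)))"

text \<open>\<open>F \<cong> 0\<close> for a function \<open>F\<close> on \<open>M - \<Sigma>\<close>.\<close>

definition extends_smoothly ::
  "('a::topological_space, 'm::finite) chart set \<Rightarrow> 'a form2 \<Rightarrow> ('a \<Rightarrow> real) \<Rightarrow> bool" where
  "extends_smoothly \<A> g F \<longleftrightarrow>
     (\<exists>G. smooth_fun \<A> (mcarrier \<A>) G \<and> (\<forall>p \<in> mcarrier \<A> - sing \<A> g. G p = F p))"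

end

theory Submission
  imports Defs
begin

text \<open>Off \<open>\<Sigma>\<close> the metric property of \<open>\<nabla>\<close> writes \<open>\<langle>R(A,B)C,D\<rangle>\<close> as a smooth function plus
  \<open>\<langle>\<nabla>\<^sub>A C, \<nabla>\<^sub>B D\<rangle> - \<langle>\<nabla>\<^sub>B C, \<nabla>\<^sub>A D\<rangle>\<close>. As \<open>\<nabla>\<^sub>X Y\<close> is the \<open>g\<close>-dual of the smooth form \<open>\<box>\<^sub>X Y\<close> and the
  radical is the line spanned by \<open>R\<close>, \<open>\<tau> \<langle>\<nabla>\<^sub>X Y, \<nabla>\<^sub>X' Y'\<rangle>\<close> tends to \<open>II(X,Y) II(X',Y')\<close> along any curve
  crossing \<open>\<Sigma>\<close> transversally; this gives \<open>\<Upsilon>\<close> on \<open>\<Sigma>\<close>. Both \<open>\<tau>\<close> and the Gram determinant of a chart vanish to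
  first order exactly on \<open>\<Sigma>\<close> near \<open>\<Sigma>\<close>, so a smooth function vanishing on \<open>\<Sigma>\<close> is smoothly divisible by \<open>\<tau>\<close>;
  applied to \<open>\<Upsilon>\<close> this is (a). For (b), \<open>II(A,C) = \<nu>(A) \<rho>(C) + \<rho>(A) \<nu>(C) + II(A\<^sup>S,C\<^sup>S)\<close>: if the last term
  vanishes then \<open>\<Upsilon>(A,B,C,D)\<close> is minus the product of the two determinants, and
  \<open>\<Upsilon>(N,V,R,W) = II(V,W)\<close> for \<open>V, W\<close> in the screen, cut off by a bump function.\<close>

section \<open>Smooth functions on open subsets of Euclidean space\<close>

text \<open>The obstacle is that \<open>nabla\<close> blows up at \<Sigma>, where only the one-forms
  given by \<open>dual_conn\<close> survive; every use of \<open>nabla\<close> has to be traded for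
  them. So \<Upsilon> on \<Sigma> is not computed there but forced by continuity along one curve
  with velocity N, which leaves \<Sigma> at once because N \<tau> = 2. This number and the normal
  form of II come from the normalizations: H(R,R) = -1 means II(R,N) = 1, the choice of the main
  normal gives II(N,N) = 0, and d\<tau> = 2 II(.,R) together with \<tau> = 0 on \<Sigma> gives
  II(v,R) = 0 for tangent v. Thus N and R span a hyperbolic plane for II whose II-orthogonal
  complement is the screen; this is the origin of the mixed products of \<nu> and \<rho>, and of the
  minus sign in front of the determinants. That the radical is a line is extracted from
  transversality. Division goes through the Gram determinant because linear algebra identifies its
  zero set in a chart with \<Sigma>; for \<tau> this follows only by comparison with the
  determinant.\<close>

lemma Ck_cong:
  assumes "open S" "\<And>x. x \<in> S \<Longrightarrow> f x = g x"
  shows "Ck k S f \<longleftrightarrow> Ck k S g"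
proof -
  have "Ck k S g" if "Ck k S f" "\<And>x. x \<in> S \<Longrightarrow> f x = g x" for f g :: "'a \<Rightarrow> 'b"
    using that
  proof (induction k arbitrary: f g)
    case 0
    then show ?case
      by (metis Ck.simps(1) continuous_on_eq)
  next
    case (Suc k)
    have df: "f differentiable (at x)" if "x \<in> S" for x
      using Suc.prems(1) that by simp
    have dg: "g differentiable (at x)" if x: "x \<in> S" for x
    proof -
      obtain f' where "(f has_derivative f') (at x)"
        using df[OF x] unfolding differentiable_def by blast
      then have "(g has_derivative f') (at x)"
        by (rule has_derivative_transform_within_open[OF _ assms(1) x]) (use Suc.prems(2) in auto)
      then show ?thesis
        by (auto simp: differentiable_def)
    qed
    have eq: "frechet_derivative f (at x) = frechet_derivative g (at x)" if "x \<in> S" for x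
      by (rule frechet_derivative_transform_within_open[OF df[OF that] assms(1) that])
        (use Suc.prems(2) in auto)
    have "Ck k S (\<lambda>x. frechet_derivative g (at x) v)" for v
      by (rule Suc.IH[of "\<lambda>x. frechet_derivative f (at x) v"]) (use Suc.prems(1) eq in auto)
    then show ?case
      using dg by simp
  qed
  then show ?thesis
    using assms(2) by metis
qed

lemma Ck_subset: "Ck k S f \<Longrightarrow> T \<subseteq> S \<Longrightarrow> Ck k T f"
  by (induction k arbitrary: f) (auto intro: continuous_on_subset)

lemma Ck_imp_continuous_on: "Ck k S f \<Longrightarrow> continuous_on S f"
  by (cases k)
    (auto intro!: continuous_at_imp_continuous_on differentiable_imp_continuous_within)

lemma Ck_Suc_imp: "Ck (Suc k) S f \<Longrightarrow> Ck k S f"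
  by (induction k arbitrary: f) (auto intro: Ck_imp_continuous_on[of "Suc 0"])

lemma Ck_SucI:
  assumes "open S" "\<And>x. x \<in> S \<Longrightarrow> (f has_derivative f' x) (at x)" "\<And>v. Ck k S (\<lambda>x. f' x v)"
  shows "Ck (Suc k) S f"
proof -
  have "frechet_derivative f (at x) = f' x" if "x \<in> S" for x
    using assms(2)[OF that] frechet_derivative_at by metis
  then have "Ck k S (\<lambda>x. frechet_derivative f (at x) v)" for v
    using Ck_cong[OF assms(1), of "\<lambda>x. frechet_derivative f (at x) v" "\<lambda>x. f' x v"] assms(3) by auto
  then show ?thesis
    using assms(2) by (auto simp: differentiable_def)
qed

lemma Ck_SucD:
  assumes "Ck (Suc k) S f" "x \<in> S"
  shows "(f has_derivative frechet_derivative f (at x)) (at x)"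
  using assms by (simp add: frechet_derivative_works)

lemma Ck_const: "open S \<Longrightarrow> Ck k S (\<lambda>x. c)"
proof (induction k arbitrary: c)
  case (Suc k)
  show ?case
    by (rule Ck_SucI[where f' = "\<lambda>_ _. 0"]) (use Suc in auto)
qed auto

lemma Ck_bounded_linear: "bounded_linear f \<Longrightarrow> open S \<Longrightarrow> Ck k S f"
proof (cases k)
  case 0
  then show "bounded_linear f \<Longrightarrow> ?thesis"
    by (simp add: linear_continuous_on)
next
  case (Suc n)
  then show "bounded_linear f \<Longrightarrow> open S \<Longrightarrow> ?thesis"
    using Ck_SucI[where f' = "\<lambda>_. f"] Ck_const bounded_linear_imp_has_derivative by blast
qed

lemma Ck_add: "open S \<Longrightarrow> Ck k S f \<Longrightarrow> Ck k S g \<Longrightarrow> Ck k S (\<lambda>x. f x + g x)"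
proof (induction k arbitrary: f g)
  case (Suc k)
  show ?case
  proof (rule Ck_SucI[where f' = "\<lambda>x v. frechet_derivative f (at x) v + frechet_derivative g (at x) v"])
    show "((\<lambda>x. f x + g x) has_derivative
        (\<lambda>v. frechet_derivative f (at x) v + frechet_derivative g (at x) v)) (at x)" if "x \<in> S" for x
      using Ck_SucD[OF Suc.prems(2) that] Ck_SucD[OF Suc.prems(3) that] by (rule has_derivative_add)
  qed (use Suc in auto)
qed (auto intro: continuous_on_add)

lemma (in bounded_bilinear) Ck_bilinear:
  "open S \<Longrightarrow> Ck k S f \<Longrightarrow> Ck k S g \<Longrightarrow> Ck k S (\<lambda>x. prod (f x) (g x))"
proof (induction k arbitrary: f g)
  case 0
  then show ?case by (auto intro: continuous_on)
next
  case (Suc k)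
  show ?case
  proof (rule Ck_SucI[where f' = "\<lambda>x v. prod (f x) (frechet_derivative g (at x) v)
        + prod (frechet_derivative f (at x) v) (g x)"])
    show "((\<lambda>x. prod (f x) (g x)) has_derivative (\<lambda>v. prod (f x) (frechet_derivative g (at x) v)
        + prod (frechet_derivative f (at x) v) (g x))) (at x)" if "x \<in> S" for x
      using Ck_SucD[OF Suc.prems(2) that] Ck_SucD[OF Suc.prems(3) that] by (rule FDERIV)
    show "Ck k S (\<lambda>x. prod (f x) (frechet_derivative g (at x) v)
        + prod (frechet_derivative f (at x) v) (g x))" for v
      using Suc.prems by (intro Ck_add Suc.IH Ck_Suc_imp[of k S f] Ck_Suc_imp[of k S g]) auto
  qed (use Suc in auto)
qed

lemmas Ck_scaleR = bounded_bilinear.Ck_bilinear[OF bounded_bilinear_scaleR]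
lemmas Ck_mult = bounded_bilinear.Ck_bilinear[OF bounded_bilinear_mult]

lemma Ck_sum: "open S \<Longrightarrow> (\<And>i. i \<in> I \<Longrightarrow> Ck k S (f i)) \<Longrightarrow> Ck k S (\<lambda>x. \<Sum>i\<in>I. f i x)"
  by (induction I rule: infinite_finite_induct) (auto intro: Ck_add Ck_const)

lemma Ck_compose:
  fixes f :: "'a::real_normed_vector \<Rightarrow> 'b::euclidean_space" and g :: "'b \<Rightarrow> 'c::real_normed_vector"
  assumes "open S" "open T"
  shows "Ck k S f \<Longrightarrow> Ck k T g \<Longrightarrow> f ` S \<subseteq> T \<Longrightarrow> Ck k S (\<lambda>x. g (f x))"
proof (induction k arbitrary: g)
  case 0
  then show ?case
    by (auto intro: continuous_on_compose2)
next
  case (Suc k)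
  \<comment> \<open>\<open>Ck\<close> speaks of derivatives in fixed directions, whereas the chain
    rule applies the derivative of g to a direction that varies with x. Expanding that direction
    over \<open>Basis\<close> leaves scalar functions times derivatives of g in fixed directions,
    which the induction covers.\<close>
  let ?f' = "\<lambda>x v. \<Sum>b\<in>Basis. (frechet_derivative f (at x) v \<bullet> b) *\<^sub>R frechet_derivative g (at (f x)) b"
  show ?case
  proof (rule Ck_SucI[where f' = ?f'])
    fix x assume x: "x \<in> S"
    then have fx: "f x \<in> T"
      using Suc.prems(3) by auto
    have dg: "(g has_derivative frechet_derivative g (at (f x))) (at (f x))"
      using Ck_SucD[OF Suc.prems(2) fx] .
    have lin: "linear (frechet_derivative g (at (f x)))"
      using dg has_derivative_linear by blast
    have "frechet_derivative g (at (f x)) w = (\<Sum>b\<in>Basis. (w \<bullet> b) *\<^sub>R frechet_derivative g (at (f x)) b)" for w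
    proof -
      have "frechet_derivative g (at (f x)) w = frechet_derivative g (at (f x)) (\<Sum>b\<in>Basis. (w \<bullet> b) *\<^sub>R b)"
        by (simp only: euclidean_representation)
      also have "\<dots> = (\<Sum>b\<in>Basis. (w \<bullet> b) *\<^sub>R frechet_derivative g (at (f x)) b)"
        by (simp only: linear_sum[OF lin] linear_scale[OF lin])
      finally show ?thesis .
    qed
    then have "(\<lambda>v. frechet_derivative g (at (f x)) (frechet_derivative f (at x) v)) = ?f' x"
      by (rule ext)
    then show "((\<lambda>x. g (f x)) has_derivative ?f' x) (at x)"
      using has_derivative_compose[OF Ck_SucD[OF Suc.prems(1) x] dg] by (simp only:)
  next
    fix v
    have "Ck k S (\<lambda>x. (frechet_derivative f (at x) v \<bullet> b))" for b
      by (rule bounded_bilinear.Ck_bilinear[OF bounded_bilinear_inner assms(1) _ Ck_const[OF assms(1)]])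
        (use Suc.prems(1) in auto)
    moreover have "Ck k S (\<lambda>x. frechet_derivative g (at (f x)) b)" for b
      using Suc.prems by (intro Suc.IH[of "\<lambda>y. frechet_derivative g (at y) b"]) (auto intro: Ck_Suc_imp)
    ultimately show "Ck k S (\<lambda>x. ?f' x v)"
      by (intro Ck_sum Ck_scaleR assms)
  qed (fact assms)
qed

lemma Ck_local:
  "(\<And>x. x \<in> S \<Longrightarrow> \<exists>T. open T \<and> x \<in> T \<and> Ck k T f) \<Longrightarrow> Ck k S f"
proof (induction k arbitrary: f)
  case 0
  show ?case
    unfolding Ck.simps
    by (rule continuous_at_imp_continuous_on)
      (use 0 in \<open>fastforce simp: continuous_on_eq_continuous_at\<close>)
next
  case (Suc k)
  then show ?case
    by fastforce
qed

lemma Ck_inverse: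
  fixes f :: "'a::real_normed_vector \<Rightarrow> real"
  assumes "open S"
  shows "Ck k S f \<Longrightarrow> (\<And>x. x \<in> S \<Longrightarrow> f x \<noteq> 0) \<Longrightarrow> Ck k S (\<lambda>x. inverse (f x))"
proof (induction k)
  case 0
  then show ?case by (auto intro: continuous_on_inverse)
next
  case (Suc k)
  have f: "Ck k S (\<lambda>x. inverse (f x))"
    using Suc Ck_Suc_imp by blast
  show ?case
  proof (rule Ck_SucI[where f' = "\<lambda>x v. (- 1) * (inverse (f x) * frechet_derivative f (at x) v * inverse (f x))"])
    show "((\<lambda>x. inverse (f x)) has_derivative
        (\<lambda>v. (- 1) * (inverse (f x) * frechet_derivative f (at x) v * inverse (f x)))) (at x)" if "x \<in> S" for x
      using Deriv.has_derivative_inverse[OF Suc.prems(2)[OF that] Ck_SucD[OF Suc.prems(1) that]] by simp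
    show "Ck k S (\<lambda>x. (- 1) * (inverse (f x) * frechet_derivative f (at x) v * inverse (f x)))" for v
      using Suc.prems f by (intro Ck_mult Ck_const assms) auto
  qed (fact assms)
qed

text \<open>Differentiation under the integral sign: the derivative of the integrand in a direction
  (v, 0) is of class \<open>Ck k\<close> again, so the induction repeats. The open set S around the
  compact segments makes two-sided derivatives available at the ends of the t-interval.\<close>

lemma Ck_integral:
  fixes G :: "'e::euclidean_space \<times> real \<Rightarrow> real"
  assumes "open S" "open U" "U \<times> {0..1} \<subseteq> S"
  shows "Ck k S G \<Longrightarrow> Ck k U (\<lambda>x. integral {0..1} (\<lambda>t. G (x, t)))"
proof (induction k arbitrary: G)
  case 0
  have "continuous_on (U \<times> cbox 0 1) (\<lambda>(x, t). G (x, t))"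
    using 0 assms(3) by (auto intro: continuous_on_subset)
  from integral_continuous_on_param[OF this] show ?case
    by simp
next
  case (Suc k)
  let ?d = "\<lambda>z. frechet_derivative G (at z)"
  have dgram: "((\<lambda>x. G (x, t)) has_derivative (\<lambda>v. ?d (x, t) (v, 0))) (at x)" if "(x, t) \<in> S" for x t
  proof -
    have *: "((\<lambda>x. (x, t)) has_derivative (\<lambda>v. (v, 0))) (at x)"
      by (auto intro!: derivative_eq_intros)
    show ?thesis
      by (rule has_derivative_compose[OF * Ck_SucD[OF Suc.prems that]])
  qed
  have bl: "bounded_linear (\<lambda>v. ?d (x, t) (v, 0))" if "(x, t) \<in> S" for x t
    using dgram[OF that] by (rule has_derivative_bounded_linear)
  show ?case
  proof (rule Ck_SucI[where f' = "\<lambda>x v. integral {0..1} (\<lambda>t. ?d (x, t) (v, 0))"])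
    show "Ck k U (\<lambda>x. integral {0..1} (\<lambda>t. ?d (x, t) (v, 0)))" for v
      using Suc.IH[of "\<lambda>z. ?d z (v, 0)"] Suc.prems by simp
    fix x0 assume "x0 \<in> U"
    then obtain r where r: "r > 0" "ball x0 r \<subseteq> U"
      using assms(2) open_contains_ball by blast
    \<comment> \<open>The Leibniz rule asks for continuity of the derivative as a bounded linear
      map. In finite dimension this can be tested on basis vectors, where it is continuity of a
      directional derivative.\<close>
    define fx where "fx = (\<lambda>x t. Blinfun (\<lambda>v. ?d (x, t) (v, 0)))"
    have S: "(x, t) \<in> S" if "x \<in> ball x0 r" "t \<in> {0..1}" for x t
      using that r assms(3) by blast
    have fx: "blinfun_apply (fx x t) v = ?d (x, t) (v, 0)" if "x \<in> ball x0 r" "t \<in> {0..1}" for x t v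
      unfolding fx_def using bl[OF S[OF that]] by (simp add: bounded_linear_Blinfun_apply)
    have dcont: "continuous_on S (\<lambda>z. ?d z w)" for w
      using Suc.prems Ck_imp_continuous_on[of k S "\<lambda>z. ?d z w"] unfolding Ck.simps by blast
    have cont: "continuous_on (ball x0 r \<times> cbox 0 1) (\<lambda>(x, t). fx x t)"
    proof (rule continuous_on_blinfun_componentwise)
      fix i :: 'e
      have "continuous_on (ball x0 r \<times> cbox 0 1) (\<lambda>z. ?d z (i, 0))"
        by (rule continuous_on_subset[OF dcont]) (use S in auto)
      then show "continuous_on (ball x0 r \<times> cbox 0 1) (\<lambda>z. blinfun_apply (case z of (x, t) \<Rightarrow> fx x t) i)"
        by (rule continuous_on_eq) (use fx in auto)
    qed
    have "((\<lambda>x. integral (cbox 0 1) (\<lambda>t. G (x, t))) has_derivative integral (cbox 0 1) (fx x0))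
        (at x0 within ball x0 r)"
    proof (rule leibniz_rule[OF _ _ cont])
      show "((\<lambda>x. G (x, t)) has_derivative blinfun_apply (fx x t)) (at x within ball x0 r)"
        if "x \<in> ball x0 r" "t \<in> cbox 0 1" for x t
      proof -
        have "blinfun_apply (fx x t) = (\<lambda>v. ?d (x, t) (v, 0))"
          using fx[of x t] that by auto
        then show ?thesis
          using dgram[OF S[of x t]] that by (auto intro: has_derivative_at_withinI)
      qed
      show "(\<lambda>t. G (x, t)) integrable_on cbox 0 1" if "x \<in> ball x0 r" for x
      proof (rule integrable_continuous)
        have "continuous_on S G"
          using Suc.prems by (rule Ck_imp_continuous_on)
        then show "continuous_on (cbox 0 1) (\<lambda>t. G (x, t))"
          by (rule continuous_on_compose2) (use S that in \<open>auto intro!: continuous_intros\<close>)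
      qed
    qed (use r in auto)
    then have "((\<lambda>x. integral {0..1} (\<lambda>t. G (x, t))) has_derivative integral {0..1} (fx x0)) (at x0)"
      using r by (simp add: at_within_open[of x0 "ball x0 r"])
    moreover have "blinfun_apply (integral {0..1} (fx x0)) v = integral {0..1} (\<lambda>t. ?d (x0, t) (v, 0))" for v
    proof -
      have im: "(\<lambda>t. (x0, t)) ` {0..1::real} \<subseteq> ball x0 r \<times> cbox 0 1"
        using r by auto
      have "continuous_on {0..1} (\<lambda>t. case (x0, t) of (x, t) \<Rightarrow> fx x t)"
        by (rule continuous_on_compose2[OF cont _ im]) (auto intro!: continuous_intros)
      then have "continuous_on (cbox 0 1) (fx x0)"
        by simp
      then have "(fx x0) integrable_on cbox 0 1"
        by (rule integrable_continuous)
      then have "blinfun_apply (integral {0..1} (fx x0)) v = integral {0..1} (\<lambda>t. blinfun_apply (fx x0 t) v)"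
        by (simp add: blinfun_apply_integral)
      also have "\<dots> = integral {0..1} (\<lambda>t. ?d (x0, t) (v, 0))"
        using r fx by (intro integral_cong) auto
      finally show ?thesis .
    qed
    then have "blinfun_apply (integral {0..1} (fx x0))
        = (\<lambda>v. integral {0..1} (\<lambda>t. ?d (x0, t) (v, 0)))"
      by (rule ext)
    ultimately show "((\<lambda>x. integral {0..1} (\<lambda>t. G (x, t))) has_derivative
        (\<lambda>v. integral {0..1} (\<lambda>t. ?d (x0, t) (v, 0)))) (at x0)"
      by (simp only:)
  qed (fact assms)
qed


section \<open>Closure properties of smooth functions\<close>

lemma Cinf_cong: "open S \<Longrightarrow> (\<And>x. x \<in> S \<Longrightarrow> f x = g x) \<Longrightarrow> Cinf S f \<longleftrightarrow> Cinf S g"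
  unfolding Cinf_def using Ck_cong by blast

lemma Cinf_subset: "Cinf S f \<Longrightarrow> T \<subseteq> S \<Longrightarrow> Cinf T f"
  unfolding Cinf_def using Ck_subset by blast

lemma Cinf_local: "(\<And>x. x \<in> S \<Longrightarrow> \<exists>T. open T \<and> x \<in> T \<and> Cinf T f) \<Longrightarrow> Cinf S f"
  unfolding Cinf_def by (intro allI Ck_local) blast

lemma Cinf_imp_continuous_on: "Cinf S f \<Longrightarrow> continuous_on S f"
  unfolding Cinf_def using Ck.simps(1) by metis

lemma Cinf_has_derivative:
  "Cinf S f \<Longrightarrow> x \<in> S \<Longrightarrow> (f has_derivative frechet_derivative f (at x)) (at x)"
  unfolding Cinf_def using Ck_SucD by metis

lemma Cinf_frechet_derivative: "Cinf S f \<Longrightarrow> Cinf S (\<lambda>x. frechet_derivative f (at x) v)"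
  unfolding Cinf_def using Ck.simps(2) by metis

lemma Cinf_const: "open S \<Longrightarrow> Cinf S (\<lambda>x. c)"
  unfolding Cinf_def using Ck_const by blast

lemma Cinf_bounded_linear: "bounded_linear f \<Longrightarrow> open S \<Longrightarrow> Cinf S f"
  unfolding Cinf_def using Ck_bounded_linear by blast

lemma Cinf_add: "open S \<Longrightarrow> Cinf S f \<Longrightarrow> Cinf S g \<Longrightarrow> Cinf S (\<lambda>x. f x + g x)"
  unfolding Cinf_def using Ck_add by blast

lemma Cinf_scaleR: "open S \<Longrightarrow> Cinf S f \<Longrightarrow> Cinf S g \<Longrightarrow> Cinf S (\<lambda>x. f x *\<^sub>R g x)"
  unfolding Cinf_def using Ck_scaleR by blast

lemma Cinf_mult:
  "open S \<Longrightarrow> Cinf S f \<Longrightarrow> Cinf S g \<Longrightarrow> Cinf S (\<lambda>x. f x * g x :: 'a::real_normed_algebra)"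
  unfolding Cinf_def using Ck_mult by blast

lemma Cinf_inner: "open S \<Longrightarrow> Cinf S f \<Longrightarrow> Cinf S g \<Longrightarrow> Cinf S (\<lambda>x. f x \<bullet> g x)"
  unfolding Cinf_def using bounded_bilinear.Ck_bilinear[OF bounded_bilinear_inner] by blast

lemma Cinf_diff: "open S \<Longrightarrow> Cinf S f \<Longrightarrow> Cinf S g \<Longrightarrow> Cinf S (\<lambda>x. f x - g x)"
  using Cinf_add[of S f "\<lambda>x. (- 1) *\<^sub>R g x"] Cinf_scaleR[OF _ Cinf_const, of S g "- 1"] by simp

lemma Cinf_sum: "open S \<Longrightarrow> (\<And>i. i \<in> I \<Longrightarrow> Cinf S (f i)) \<Longrightarrow> Cinf S (\<lambda>x. \<Sum>i\<in>I. f i x)"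
  unfolding Cinf_def by (blast intro: Ck_sum)

lemma Cinf_inverse:
  "open S \<Longrightarrow> Cinf S f \<Longrightarrow> (\<And>x. x \<in> S \<Longrightarrow> f x \<noteq> 0) \<Longrightarrow> Cinf S (\<lambda>x. inverse (f x :: real))"
  unfolding Cinf_def using Ck_inverse by blast

lemma Cinf_compose:
  fixes f :: "'a::real_normed_vector \<Rightarrow> 'b::euclidean_space"
  shows "open S \<Longrightarrow> open T \<Longrightarrow> Cinf S f \<Longrightarrow> Cinf T g \<Longrightarrow> f ` S \<subseteq> T \<Longrightarrow> Cinf S (\<lambda>x. g (f x))"
  unfolding Cinf_def by (blast intro: Ck_compose)

lemmas Cinf_id = Cinf_bounded_linear[OF bounded_linear_ident]
lemmas Cinf_fst = Cinf_bounded_linear[OF bounded_linear_fst]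
lemmas Cinf_snd = Cinf_bounded_linear[OF bounded_linear_snd]

section \<open>Parameter integrals and factorization of smooth functions\<close>

text \<open>The map P is left general so that one statement serves both the segments towards a point
  and the segments towards a hyperplane.\<close>

lemma Cinf_integral:
  fixes F :: "'b::euclidean_space \<Rightarrow> real" and P :: "'e::euclidean_space \<times> real \<Rightarrow> 'b"
  assumes "open S" "Cinf S F" "open U" "Cinf UNIV P"
    and P: "\<And>x t. x \<in> U \<Longrightarrow> t \<in> {0..1} \<Longrightarrow> P (x, t) \<in> S"
  shows "Cinf U (\<lambda>x. integral {0..1} (\<lambda>t. F (P (x, t))))"
proof -
  have o: "open (P -` S)"
    using assms(1,4) Cinf_imp_continuous_on open_vimage by blast
  have "Cinf (P -` S) (\<lambda>z. F (P z))"
    by (rule Cinf_compose[OF o assms(1) Cinf_subset[OF assms(4)] assms(2)]) auto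
  moreover have "U \<times> {0..1} \<subseteq> P -` S"
    using P by auto
  ultimately show ?thesis
    unfolding Cinf_def using Ck_integral[OF o assms(3)] by blast
qed

lemma Cinf_increment_integral:
  fixes f :: "'e::euclidean_space \<Rightarrow> real"
  assumes "Cinf S f" "\<And>t. t \<in> {0..1} \<Longrightarrow> y + t *\<^sub>R w \<in> S"
  shows "((\<lambda>t. frechet_derivative f (at (y + t *\<^sub>R w)) w) has_integral (f (y + w) - f y)) {0..1}"
proof -
  have "((\<lambda>t. frechet_derivative f (at (y + t *\<^sub>R w)) w) has_integral
      (f (y + 1 *\<^sub>R w) - f (y + 0 *\<^sub>R w))) {0..1}"
  proof (rule fundamental_theorem_of_calculus)
    fix t :: real assume t: "t \<in> {0..1}"
    have "((\<lambda>t. y + t *\<^sub>R w) has_derivative (\<lambda>s. s *\<^sub>R w)) (at t)"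
      by (auto intro!: derivative_eq_intros)
    from has_derivative_compose[OF this Cinf_has_derivative[OF assms(1) assms(2)[OF t]]]
    have "((\<lambda>t. f (y + t *\<^sub>R w)) has_derivative
        (\<lambda>s. frechet_derivative f (at (y + t *\<^sub>R w)) (s *\<^sub>R w))) (at t)" .
    moreover have "frechet_derivative f (at (y + t *\<^sub>R w)) (s *\<^sub>R w)
        = s *\<^sub>R frechet_derivative f (at (y + t *\<^sub>R w)) w" for s
      using Cinf_has_derivative[OF assms(1) assms(2)[OF t]] has_derivative_linear linear_scale by blast
    ultimately show "((\<lambda>t. f (y + t *\<^sub>R w)) has_vector_derivative
        frechet_derivative f (at (y + t *\<^sub>R w)) w) (at t within {0..1})"
      unfolding has_vector_derivative_def by (simp add: has_derivative_at_withinI)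
  qed simp
  then show ?thesis
    by simp
qed

text \<open>Integrate the derivative of f along the segment from p to x; h b is the mean of the
  partial derivative in direction b. This factorization is what determines a derivation at p by its
  values on coordinates.\<close>

lemma Cinf_hadamard:
  fixes f :: "'e::euclidean_space \<Rightarrow> real"
  assumes S: "open S" "convex S" "p \<in> S" and f: "Cinf S f"
  obtains h where "\<And>b. Cinf S (h b)"
    "\<And>x. x \<in> S \<Longrightarrow> f x = f p + (\<Sum>b\<in>Basis. ((x - p) \<bullet> b) * h b x)"
proof
  let ?d = "\<lambda>b x t. frechet_derivative f (at (p + t *\<^sub>R (x - p))) b"
  define h where "h = (\<lambda>b x. integral {0..1} (?d b x))"
  have inS: "p + t *\<^sub>R (x - p) \<in> S" if "x \<in> S" "t \<in> {0..1}" for x t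
  proof -
    have "(1 - t) *\<^sub>R p + t *\<^sub>R x \<in> S"
      using S that by (intro convexD) auto
    then show ?thesis
      by (simp add: algebra_simps)
  qed
  have P: "Cinf UNIV (\<lambda>z. p + snd z *\<^sub>R (fst z - p))"
    by (intro Cinf_add Cinf_scaleR Cinf_diff Cinf_const Cinf_fst Cinf_snd open_UNIV)
  show "Cinf S (h b)" for b
    unfolding h_def
    using Cinf_integral[OF S(1) Cinf_frechet_derivative[OF f] S(1) P] inS by simp
  show "f x = f p + (\<Sum>b\<in>Basis. ((x - p) \<bullet> b) * h b x)" if x: "x \<in> S" for x
  proof -
    have d: "?d (x - p) x t = (\<Sum>b\<in>Basis. ((x - p) \<bullet> b) * ?d b x t)" if t: "t \<in> {0..1}" for t
    proof -
      have lin: "linear (frechet_derivative f (at (p + t *\<^sub>R (x - p))))"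
        using Cinf_has_derivative[OF f inS[OF x t]] has_derivative_linear by blast
      have "?d (x - p) x t = frechet_derivative f (at (p + t *\<^sub>R (x - p))) (\<Sum>b\<in>Basis. ((x - p) \<bullet> b) *\<^sub>R b)"
        by (simp only: euclidean_representation)
      also have "\<dots> = (\<Sum>b\<in>Basis. ((x - p) \<bullet> b) * ?d b x t)"
        by (simp only: linear_sum[OF lin] linear_scale[OF lin] real_scaleR_def)
      finally show ?thesis .
    qed
    have int: "?d b x integrable_on {0..1}" for b
    proof (rule integrable_continuous_real)
      have "continuous_on S (\<lambda>y. frechet_derivative f (at y) b)"
        by (rule Cinf_imp_continuous_on[OF Cinf_frechet_derivative[OF f]])
      then show "continuous_on {0..1} (?d b x)"
        by (rule continuous_on_compose2) (use inS[OF x] in \<open>auto intro!: continuous_intros\<close>)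
    qed
    have "f (p + (x - p)) - f p = integral {0..1} (?d (x - p) x)"
      using Cinf_increment_integral[OF f, of p "x - p"] inS[OF x] integral_unique by metis
    also have "\<dots> = integral {0..1} (\<lambda>t. \<Sum>b\<in>Basis. ((x - p) \<bullet> b) * ?d b x t)"
      by (rule integral_cong) (use d in auto)
    also have "\<dots> = (\<Sum>b\<in>Basis. ((x - p) \<bullet> b) * h b x)"
      unfolding h_def by (subst integral_sum) (auto intro!: integrable_on_mult_right int)
    finally show ?thesis
      by simp
  qed
qed

text \<open>Integrate along e from the projection y - L y e, where f vanishes, to y. The increment
  is L y e, so L y factors out and h is the mean of the derivative in direction e.\<close>

lemma Cinf_divide_linear:
  fixes f :: "'e::euclidean_space \<Rightarrow> real"
  assumes S: "open S" "convex S" and f: "Cinf S f" and L: "bounded_linear L" and e: "L e = 1"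
    and zero: "\<And>z. z \<in> S \<Longrightarrow> L z = 0 \<Longrightarrow> f z = 0"
    and U: "open U" "\<And>y. y \<in> U \<Longrightarrow> y \<in> S \<and> y - L y *\<^sub>R e \<in> S"
  obtains h where "Cinf U h" "\<And>y. y \<in> U \<Longrightarrow> f y = L y * h y"
proof
  interpret L: bounded_linear L by fact
  let ?P = "\<lambda>z. (fst z - L (fst z) *\<^sub>R e) + snd z *\<^sub>R (L (fst z) *\<^sub>R e)"
  define h where "h = (\<lambda>y. integral {0..1} (\<lambda>t. frechet_derivative f (at (?P (y, t))) e))"
  have inS: "?P (y, t) \<in> S" if "y \<in> U" "t \<in> {0..1}" for y t
  proof -
    have "(1 - t) *\<^sub>R (y - L y *\<^sub>R e) + t *\<^sub>R y \<in> S"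
      using S U(2) that by (intro convexD) auto
    then show ?thesis
      by (simp add: algebra_simps)
  qed
  have P: "Cinf UNIV ?P"
    by (intro Cinf_add Cinf_diff Cinf_scaleR Cinf_const Cinf_fst Cinf_snd
        Cinf_bounded_linear[OF bounded_linear_compose[OF L bounded_linear_fst]] open_UNIV)
  show "Cinf U h"
    unfolding h_def
    by (rule Cinf_integral[OF S(1) Cinf_frechet_derivative[OF f] U(1) P]) (use inS in auto)
  show "f y = L y * h y" if y: "y \<in> U" for y
  proof -
    let ?z = "y - L y *\<^sub>R e"
    have *: "((\<lambda>t. frechet_derivative f (at (?z + t *\<^sub>R (L y *\<^sub>R e))) (L y *\<^sub>R e))
        has_integral (f (?z + L y *\<^sub>R e) - f ?z)) {0..1}"
      by (rule Cinf_increment_integral[OF f]) (use inS[OF y] in simp)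
    have "f ?z = 0"
      using zero U(2)[OF y] by (simp add: L.diff L.scaleR e)
    then have "f y = integral {0..1} (\<lambda>t. frechet_derivative f (at (?z + t *\<^sub>R (L y *\<^sub>R e))) (L y *\<^sub>R e))"
      using integral_unique[OF *] by simp
    also have "\<dots> = integral {0..1} (\<lambda>t. L y * frechet_derivative f (at (?P (y, t))) e)"
    proof (rule integral_cong)
      fix t :: real assume "t \<in> {0..1}"
      then have "(f has_derivative frechet_derivative f (at (?P (y, t)))) (at (?P (y, t)))"
        using Cinf_has_derivative[OF f inS[OF y]] by simp
      from linear_scale[OF has_derivative_linear[OF this], of "L y" e]
      show "frechet_derivative f (at (?z + t *\<^sub>R (L y *\<^sub>R e))) (L y *\<^sub>R e)
          = L y * frechet_derivative f (at (?P (y, t))) e"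
        by simp
    qed
    also have "\<dots> = L y * h y"
      unfolding h_def by (rule integral_mult_right)
    finally show ?thesis .
  qed
qed

text \<open>The map \<open>x \<mapsto> x + (\<tau> x - L x) e\<close> with \<open>L = d\<tau>\<^sub>p\<close> and \<open>L e = 1\<close> has derivative the identity at \<open>p\<close>
  and turns \<open>\<tau>\<close> into the linear function \<open>L\<close>.\<close>

lemma Cinf_straighten:
  fixes \<tau> :: "'e::euclidean_space \<Rightarrow> real"
  assumes S: "open S" "p \<in> S" and \<tau>: "Cinf S \<tau>"
    and L_def: "L = frechet_derivative \<tau> (at p)" and e: "L e = 1"
  defines "\<psi> \<equiv> \<lambda>x. x + (\<tau> x - L x) *\<^sub>R e"
  obtains U V \<phi> where "open U" "U \<subseteq> S" "p \<in> U" "open V" "homeomorphism U V \<psi> \<phi>"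
    "Cinf U \<psi>" "Cinf V \<phi>"
proof -
  let ?D = "\<lambda>x. frechet_derivative \<tau> (at x)"
  have bL: "bounded_linear L"
    unfolding L_def using Cinf_has_derivative[OF \<tau> S(2)] has_derivative_bounded_linear by blast
  interpret L: bounded_linear L by (fact bL)
  have bD: "bounded_linear (?D x)" if "x \<in> S" for x
    using Cinf_has_derivative[OF \<tau> that] has_derivative_bounded_linear by blast
  define d\<psi> where "d\<psi> = (\<lambda>x. Blinfun (\<lambda>v. v + (?D x v - L v) *\<^sub>R e))"
  have d\<psi>: "blinfun_apply (d\<psi> x) = (\<lambda>v. v + (?D x v - L v) *\<^sub>R e)" if "x \<in> S" for x
    unfolding d\<psi>_def
    by (rule bounded_linear_Blinfun_apply)
      (intro bounded_linear_add bounded_linear_ident bounded_linear_scaleR_left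
        bounded_linear_compose[OF bounded_linear_scaleR_left] bounded_linear_sub bD that bL)
  have der: "(\<psi> has_derivative blinfun_apply (d\<psi> x)) (at x)" if x: "x \<in> S" for x
    unfolding d\<psi>[OF x] \<psi>_def
    by (auto intro!: derivative_eq_intros Cinf_has_derivative[OF \<tau> x] L.has_derivative)
  have cont: "continuous_on S d\<psi>"
  proof (rule continuous_on_blinfun_componentwise)
    fix i :: 'e
    have "continuous_on S (\<lambda>x. i + (?D x i - L i) *\<^sub>R e)"
      using Cinf_imp_continuous_on[OF Cinf_frechet_derivative[OF \<tau>]] by (auto intro!: continuous_intros)
    then show "continuous_on S (\<lambda>x. blinfun_apply (d\<psi> x) i)"
      by (rule continuous_on_eq) (simp add: d\<psi>)
  qed
  have id: "id_blinfun o\<^sub>L d\<psi> p = id_blinfun"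
    by (rule blinfun_eqI) (simp add: d\<psi>[OF S(2)] L_def)
  obtain U V \<phi> \<phi>' where UV: "open U" "U \<subseteq> S" "p \<in> U" "open V" "homeomorphism U V \<psi> \<phi>"
    and \<phi>': "\<And>y. y \<in> V \<Longrightarrow> (\<phi> has_derivative \<phi>' y) (at y)"
      "\<And>y. y \<in> V \<Longrightarrow> \<phi>' y = inv (blinfun_apply (d\<psi> (\<phi> y)))"
      "\<And>y. y \<in> V \<Longrightarrow> bij (blinfun_apply (d\<psi> (\<phi> y)))"
    using inverse_function_theorem[OF S(1) der cont S(2) id] by metis
  have \<phi>U: "\<phi> y \<in> U" if "y \<in> V" for y
    using UV(5) that unfolding homeomorphism_def by blast
  \<comment> \<open>The derivative of \<psi> is the identity plus a rank-one map with image in the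
    line of e, so its inverse is explicit, with denominator d\<tau>(e). It is nonzero: otherwise the
    injective derivative of \<psi> would send e to e - L e e = 0.\<close>
  let ?\<phi>' = "\<lambda>y u. u + ((L u - ?D (\<phi> y) u) * inverse (?D (\<phi> y) e)) *\<^sub>R e"
  have nz: "?D (\<phi> y) e \<noteq> 0" if y: "y \<in> V" for y
  proof
    assume 0: "?D (\<phi> y) e = 0"
    have \<phi>S: "\<phi> y \<in> S" using \<phi>U[OF y] UV(2) by blast
    interpret D: bounded_linear "?D (\<phi> y)" using bD[OF \<phi>S] .
    have "blinfun_apply (d\<psi> (\<phi> y)) e = blinfun_apply (d\<psi> (\<phi> y)) 0"
      unfolding d\<psi>[OF \<phi>S] by (simp add: 0 e D.zero L.zero)
    then have "e = 0"
      using \<phi>'(3)[OF y] bij_is_inj injD by metis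
    then show False
      using e L.zero by simp
  qed
  have der\<phi>: "(\<phi> has_derivative ?\<phi>' y) (at y)" if y: "y \<in> V" for y
  proof -
    have \<phi>S: "\<phi> y \<in> S" using \<phi>U[OF y] UV(2) by blast
    interpret D: bounded_linear "?D (\<phi> y)" using bD[OF \<phi>S] .
    have "blinfun_apply (d\<psi> (\<phi> y)) (?\<phi>' y u) = u" for u
      unfolding d\<psi>[OF \<phi>S] using nz[OF y]
      by (simp add: D.add D.scaleR L.add L.scaleR e algebra_simps flip: scaleR_add_left scaleR_diff_left)
    then have "?\<phi>' y = inv (blinfun_apply (d\<psi> (\<phi> y)))"
      using \<phi>'(3)[OF y] by (metis (no_types, lifting) bij_is_inj ext inv_f_f)
    then show ?thesis
      using \<phi>'(1,2)[OF y] by simp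
  qed
  \<comment> \<open>The explicit derivative of \<phi> contains \<phi> only through derivatives of
    \<tau> evaluated at \<phi>. Hence \<phi> of class k makes its derivative of class k, and \<phi>
    itself of class k + 1.\<close>
  have "Ck k V \<phi>" for k
  proof (induction k)
    case 0
    then show ?case
      using UV(5) unfolding homeomorphism_def by simp
  next
    case (Suc k)
    have D: "Ck k V (\<lambda>y. ?D (\<phi> y) u)" for u
      by (rule Ck_compose[OF UV(4) S(1) Suc, of "\<lambda>x. ?D x u"])
        (use \<phi>U UV(2) Cinf_frechet_derivative[OF \<tau>] in \<open>auto simp: Cinf_def\<close>)
    have "Ck k V (\<lambda>y. L u + (- 1) * ?D (\<phi> y) u)" for u
      by (intro Ck_add Ck_mult Ck_const D UV(4))
    then have "Ck k V (\<lambda>y. L u - ?D (\<phi> y) u)" for u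
      by simp
    then have "Ck k V (\<lambda>y. ?\<phi>' y u)" for u
      using UV(4) D nz by (intro Ck_add Ck_const Ck_scaleR Ck_mult Ck_inverse) auto
    then show ?case
      using der\<phi> by (intro Ck_SucI[OF UV(4)]) auto
  qed
  moreover have "Cinf U \<psi>"
    unfolding \<psi>_def using UV(1,2) Cinf_subset[OF \<tau>]
    by (intro Cinf_add Cinf_scaleR Cinf_diff Cinf_const Cinf_id Cinf_bounded_linear[OF bL]) auto
  ultimately show thesis
    using UV that unfolding Cinf_def by blast
qed

text \<open>After straightening, \<tau> is the linear function L, so division by a linear function
  applies to f in the new coordinates; the quotient is pulled back along \<psi>.\<close>

lemma Cinf_divide:
  fixes f \<tau> :: "'e::euclidean_space \<Rightarrow> real"
  assumes S: "open S" "p \<in> S" and f: "Cinf S f" and \<tau>: "Cinf S \<tau>"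
    and p: "\<tau> p = 0" and d: "frechet_derivative \<tau> (at p) \<noteq> (\<lambda>v. 0)"
    and zero: "\<And>x. x \<in> S \<Longrightarrow> \<tau> x = 0 \<Longrightarrow> f x = 0"
  obtains W h where "open W" "p \<in> W" "W \<subseteq> S" "Cinf W h" "\<And>x. x \<in> W \<Longrightarrow> f x = \<tau> x * h x"
proof -
  define L where "L = frechet_derivative \<tau> (at p)"
  have bL: "bounded_linear L"
    unfolding L_def using Cinf_has_derivative[OF \<tau> S(2)] has_derivative_bounded_linear by blast
  interpret L: bounded_linear L by (fact bL)
  obtain e0 where "L e0 \<noteq> 0"
    using d unfolding L_def by blast
  define e where "e = inverse (L e0) *\<^sub>R e0"
  have e: "L e = 1"
    using \<open>L e0 \<noteq> 0\<close> by (simp add: e_def L.scaleR)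
  define \<psi> where "\<psi> = (\<lambda>x. x + (\<tau> x - L x) *\<^sub>R e)"
  have L\<psi>: "L (\<psi> x) = \<tau> x" for x
    by (simp add: \<psi>_def L.add L.scaleR e)
  obtain U V \<phi> where UV: "open U" "U \<subseteq> S" "p \<in> U" "open V" "homeomorphism U V \<psi> \<phi>"
    "Cinf U \<psi>" "Cinf V \<phi>"
    using Cinf_straighten[OF S \<tau> L_def e] unfolding \<psi>_def by blast
  have \<phi>: "\<phi> y \<in> U" "\<psi> (\<phi> y) = y" if "y \<in> V" for y
    using UV(5) that unfolding homeomorphism_def by auto
  have \<psi>: "\<psi> x \<in> V" "\<phi> (\<psi> x) = x" if "x \<in> U" for x
    using UV(5) that unfolding homeomorphism_def by auto
  obtain r where r: "r > 0" "ball (\<psi> p) r \<subseteq> V"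
    using UV(4) \<psi>(1)[OF UV(3)] open_contains_ball by blast
  define B where "B = ball (\<psi> p) r"
  \<comment> \<open>Points of the ball whose projection along e to the kernel of L stays in the
    ball, so that the whole segment of integration lies there by convexity.\<close>
  define B' where "B' = B \<inter> (\<lambda>y. y - L y *\<^sub>R e) -` B"
  have B': "open B'"
    unfolding B'_def B_def by (intro open_Int open_vimage continuous_intros L.continuous_on) auto
  have F: "Cinf B (\<lambda>y. f (\<phi> y))"
    by (rule Cinf_compose[OF _ S(1) Cinf_subset[OF UV(7)] f])
      (use r UV(2) \<phi> in \<open>auto simp: B_def\<close>)
  have zF: "f (\<phi> z) = 0" if "z \<in> B" "L z = 0" for z
  proof -
    have "z \<in> V"
      using that r by (auto simp: B_def)
    then show ?thesis
      using zero[of "\<phi> z"] L\<psi>[of "\<phi> z"] \<phi>[of z] UV(2) that by auto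
  qed
  have B: "open B" "convex B"
    by (auto simp: B_def)
  obtain h where h: "Cinf B' h" "\<And>y. y \<in> B' \<Longrightarrow> f (\<phi> y) = L y * h y"
    by (rule Cinf_divide_linear[OF B F bL e zF B']) (auto simp: B'_def)
  show thesis
  proof
    let ?W = "U \<inter> \<psi> -` B'"
    show W: "open ?W"
      by (rule continuous_open_preimage[OF Cinf_imp_continuous_on[OF UV(6)] UV(1) B'])
    have "L (\<psi> p) = 0"
      using L\<psi> p by simp
    then show "p \<in> ?W"
      using UV(3) r by (simp add: B'_def B_def)
    show "?W \<subseteq> S"
      using UV(2) by auto
    show "Cinf ?W (\<lambda>x. h (\<psi> x))"
      by (rule Cinf_compose[OF W B' Cinf_subset[OF UV(6)] h(1)]) auto
    show "f x = \<tau> x * h (\<psi> x)" if "x \<in> ?W" for x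
      using h(2)[of "\<psi> x"] \<psi>[of x] that L\<psi> by auto
  qed
qed

text \<open>The derivatives of \<open>exp (- 1 / x)\<close>, extended by \<open>0\<close>, are combinations of the functions below.\<close>

definition flat_exp :: "nat \<Rightarrow> real \<Rightarrow> real" where
  "flat_exp n x = (if x > 0 then inverse x ^ n * exp (- inverse x) else 0)"

text \<open>Raise y/k <= exp (y/k) to the power k = n + 2, with y = 1/x. The two surplus powers of y
  become the factor x^2, which forces the difference quotients at 0 to tend to 0.\<close>

lemma flat_exp_le:
  "\<bar>flat_exp n x\<bar> \<le> real (n + 2) ^ (n + 2) * x\<^sup>2"
proof (cases "x > 0")
  case True
  let ?y = "inverse x" and ?k = "n + 2"
  have y: "?y > 0"
    using True by simp
  have "?y / ?k \<le> exp (?y / ?k)"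
    using exp_ge_add_one_self[of "?y / ?k"] by linarith
  then have "(?y / ?k) ^ ?k \<le> exp (?y / ?k) ^ ?k"
    using y by (intro power_mono) auto
  also have "\<dots> = exp ?y"
    by (simp only: exp_of_nat_mult[symmetric]) simp
  finally have "?y ^ ?k / real ?k ^ ?k \<le> exp ?y"
    by (simp only: power_divide)
  moreover have "real ?k ^ ?k > 0"
    by (intro zero_less_power) simp
  ultimately have "?y ^ ?k \<le> exp ?y * real ?k ^ ?k"
    by (simp only: pos_divide_le_eq)
  then have "?y ^ ?k * exp (- ?y) \<le> (exp ?y * real ?k ^ ?k) * exp (- ?y)"
    by (rule mult_right_mono) simp
  also have "\<dots> = real ?k ^ ?k"
    by (simp only: exp_minus) simp
  finally have "?y ^ ?k * exp (- ?y) \<le> real ?k ^ ?k" .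
  then have "?y ^ ?k * exp (- ?y) * x\<^sup>2 \<le> real ?k ^ ?k * x\<^sup>2"
    by (rule mult_right_mono) simp
  moreover have "?y ^ ?k * exp (- ?y) * x\<^sup>2 = ?y ^ n * exp (- ?y)"
    using True by (simp add: power_add power2_eq_square field_simps)
  ultimately have "?y ^ n * exp (- ?y) \<le> real ?k ^ ?k * x\<^sup>2"
    by (simp only:)
  moreover have "\<bar>flat_exp n x\<bar> = ?y ^ n * exp (- ?y)"
    using True by (simp add: flat_exp_def abs_mult)
  ultimately show ?thesis
    by (simp only:)
qed (simp add: flat_exp_def)

lemma flat_exp_deriv:
  "(flat_exp n has_real_derivative flat_exp (n + 2) x - real n * flat_exp (n + 1) x) (at x)"
proof -
  consider "x > 0" | "x < 0" | "x = 0" by linarith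
  then show ?thesis
  proof cases
    case 1
    have inv: "(inverse has_real_derivative - ((inverse x)\<^sup>2)) (at x)"
      using 1 by (auto intro!: derivative_eq_intros simp: power2_eq_square)
    have "((\<lambda>x. inverse x ^ n * exp (- inverse x)) has_real_derivative
        (real n * (- ((inverse x)\<^sup>2) * inverse x ^ (n - Suc 0))) * exp (- inverse x)
        + (exp (- inverse x) * (- (- ((inverse x)\<^sup>2)))) * inverse x ^ n) (at x)"
      by (intro DERIV_mult DERIV_power DERIV_fun_exp DERIV_minus inv)
    also have "(real n * (- ((inverse x)\<^sup>2) * inverse x ^ (n - Suc 0))) * exp (- inverse x)
        + (exp (- inverse x) * (- (- ((inverse x)\<^sup>2)))) * inverse x ^ n
        = flat_exp (n + 2) x - real n * flat_exp (n + 1) x"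
      using 1 by (cases n) (simp_all add: flat_exp_def power2_eq_square algebra_simps)
    finally have "((\<lambda>x. inverse x ^ n * exp (- inverse x)) has_real_derivative
        flat_exp (n + 2) x - real n * flat_exp (n + 1) x) (at x)" .
    then show ?thesis
      by (rule has_field_derivative_transform_within_open[where S = "{0<..}"]) (use 1 in \<open>auto simp: flat_exp_def\<close>)
  next
    case 2
    have "((\<lambda>x. 0) has_real_derivative 0) (at x)"
      by simp
    then have "(flat_exp n has_real_derivative 0) (at x)"
      by (rule has_field_derivative_transform_within_open[where S = "{..<0}"]) (use 2 in \<open>auto simp: flat_exp_def\<close>)
    then show ?thesis
      using 2 by (simp add: flat_exp_def)
  next
    case 3
    let ?C = "real (n + 2) ^ (n + 2)"
    have "((\<lambda>h. (flat_exp n (0 + h) - flat_exp n 0) / h) \<longlongrightarrow> 0) (at 0)"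
    proof (rule Lim_null_comparison)
      show "\<forall>\<^sub>F h in at 0. norm ((flat_exp n (0 + h) - flat_exp n 0) / h) \<le> ?C * \<bar>h\<bar>"
      proof (rule always_eventually, rule allI)
        fix h :: real
        have "flat_exp n 0 = 0"
          by (simp add: flat_exp_def)
        then show "norm ((flat_exp n (0 + h) - flat_exp n 0) / h) \<le> ?C * \<bar>h\<bar>"
          using flat_exp_le[of n h]
          by (cases "h = 0") (auto simp: divide_simps power2_eq_square abs_mult mult.assoc)
      qed
      show "((\<lambda>h. ?C * \<bar>h\<bar>) \<longlongrightarrow> 0) (at 0)"
        by (auto intro!: tendsto_eq_intros)
    qed
    then show ?thesis
      using 3 by (simp add: DERIV_def flat_exp_def)
  qed
qed

lemma Cinf_flat_exp: "Cinf UNIV (flat_exp n)"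
proof -
  have "Ck k UNIV (flat_exp n)" for k
  proof (induction k arbitrary: n)
    case 0
    show ?case
      unfolding Ck.simps using flat_exp_deriv DERIV_isCont continuous_at_imp_continuous_on by blast
  next
    case (Suc k)
    show ?case
    proof (rule Ck_SucI[where f' = "\<lambda>x v. (flat_exp (n + 2) x + (- real n) * flat_exp (n + 1) x) * v"])
      show "(flat_exp n has_derivative (\<lambda>v. (flat_exp (n + 2) x + (- real n) * flat_exp (n + 1) x) * v)) (at x)"
        for x
        using flat_exp_deriv[of n x] by (simp add: has_field_derivative_def)
      show "Ck k UNIV (\<lambda>x. (flat_exp (n + 2) x + (- real n) * flat_exp (n + 1) x) * v)" for v
        by (intro Ck_mult Ck_add Ck_const Suc) auto
    qed auto
  qed
  then show ?thesis
    by (simp add: Cinf_def)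
qed

lemma Cinf_bump:
  fixes a :: "'e::euclidean_space"
  assumes "r > 0"
  obtains \<phi> :: "'e \<Rightarrow> real" where "Cinf UNIV \<phi>" "\<phi> a = 1" "\<And>x. x \<notin> cball a r \<Longrightarrow> \<phi> x = 0"
proof
  \<comment> \<open>The squared distance is used because it is smooth at a as well; its defect from
    r^2 is negative outside the ball, where \<open>flat_exp\<close> vanishes.\<close>
  let ?u = "\<lambda>x. r\<^sup>2 - (x - a) \<bullet> (x - a)"
  let ?\<phi> = "\<lambda>x. inverse (flat_exp 0 (r\<^sup>2)) * flat_exp 0 (?u x)"
  have "Cinf UNIV ?u"
    by (intro Cinf_diff Cinf_inner Cinf_const Cinf_id open_UNIV)
  then show "Cinf UNIV ?\<phi>"
    by (intro Cinf_mult Cinf_const Cinf_compose[OF _ _ _ Cinf_flat_exp]) auto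
  show "?\<phi> a = 1"
    using assms by (simp add: flat_exp_def)
  show "?\<phi> x = 0" if "x \<notin> cball a r" for x
  proof -
    have "r\<^sup>2 < (dist x a)\<^sup>2"
      using that assms by (intro power_strict_mono) (auto simp: dist_commute)
    then have "?u x < 0"
      by (simp add: dist_norm power2_norm_eq_inner)
    then show ?thesis
      by (simp add: flat_exp_def)
  qed
qed

section \<open>Functions, tangent vectors and vector fields on manifolds\<close>

locale smooth_mfd =
  fixes \<A> :: "('a::t2_space, 'm::finite) chart set"
  assumes smooth_structure: "smooth_structure \<A>"
begin

abbreviation "M \<equiv> mcarrier \<A>"
abbreviation "coord c i \<equiv> \<lambda>q. snd c q $ i"

context
  fixes c :: "('a, 'm) chart"
  assumes c: "c \<in> \<A>"
begin

lemma is_chart: "is_chart c"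
  using smooth_structure c by (simp add: smooth_structure_def)

lemma chart_open: "open (fst c)" "open (snd c ` fst c)"
  using is_chart by (simp_all add: is_chart_def)

lemma chart_inv_left: "p \<in> fst c \<Longrightarrow> chart_inv c (snd c p) = p"
  and chart_inv_right: "y \<in> snd c ` fst c \<Longrightarrow> snd c (chart_inv c y) = y"
  and chart_inv_in: "y \<in> snd c ` fst c \<Longrightarrow> chart_inv c y \<in> fst c"
  and chart_continuous: "continuous_on (fst c) (snd c)"
  and chart_inv_continuous: "continuous_on (snd c ` fst c) (chart_inv c)"
  using is_chart unfolding is_chart_def homeomorphism_def by auto

lemma chart_subset: "fst c \<subseteq> M"
  using c by (auto simp: mcarrier_def)

lemma chart_image: "snd c ` (fst c \<inter> U) = {y \<in> snd c ` fst c. chart_inv c y \<in> U}"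
  using chart_inv_left chart_inv_right by (force simp: image_iff)

lemma chart_image_open: "open U \<Longrightarrow> open (snd c ` (fst c \<inter> U))"
  unfolding chart_image using continuous_open_preimage[OF chart_inv_continuous chart_open(2), of U]
  by (simp add: vimage_def Int_def)

lemma chart_vimage_open: "open B \<Longrightarrow> open (fst c \<inter> snd c -` B)"
  by (rule continuous_open_preimage[OF chart_continuous chart_open(1)])

end

lemma in_chart: "p \<in> M \<Longrightarrow> \<exists>c\<in>\<A>. p \<in> fst c"
  by (auto simp: mcarrier_def)

lemma smooth_fun_imp_Cinf: "c \<in> \<A> \<Longrightarrow> smooth_fun \<A> U f \<Longrightarrow> Cinf (snd c ` (fst c \<inter> U)) (f \<circ> chart_inv c)"
  by (simp add: smooth_fun_def)

text \<open>The manifold may be smaller than its ambient type, and smoothness on U only looks at the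
  points of U in M; hence agreement is asked only there.\<close>

lemma smooth_fun_cong:
  assumes "open U" "\<And>p. p \<in> U \<Longrightarrow> p \<in> M \<Longrightarrow> f p = h p"
  shows "smooth_fun \<A> U f \<longleftrightarrow> smooth_fun \<A> U h"
proof -
  have "Cinf (snd c ` (fst c \<inter> U)) (f \<circ> chart_inv c) \<longleftrightarrow> Cinf (snd c ` (fst c \<inter> U)) (h \<circ> chart_inv c)"
    if c: "c \<in> \<A>" for c
    by (rule Cinf_cong[OF chart_image_open[OF c assms(1)]])
      (use assms(2) chart_inv_in[OF c] chart_subset[OF c] in \<open>auto simp: chart_image[OF c]\<close>)
  then show ?thesis
    by (simp add: smooth_fun_def)
qed

lemma smooth_fun_subset: "smooth_fun \<A> U f \<Longrightarrow> V \<subseteq> U \<Longrightarrow> smooth_fun \<A> V f"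
  unfolding smooth_fun_def by (meson Cinf_subset Int_mono image_mono order_refl)

lemma smooth_fun_local:
  assumes "\<And>p. p \<in> U \<Longrightarrow> p \<in> M \<Longrightarrow> \<exists>V. open V \<and> p \<in> V \<and> smooth_fun \<A> V f"
  shows "smooth_fun \<A> U f"
  unfolding smooth_fun_def
proof (intro ballI Cinf_local)
  fix c x assume c: "c \<in> \<A>" and x: "x \<in> snd c ` (fst c \<inter> U)"
  then obtain p where p: "p \<in> fst c" "p \<in> U" "x = snd c p"
    by auto
  then obtain V where V: "open V" "p \<in> V" "smooth_fun \<A> V f"
    using assms chart_subset[OF c] by blast
  show "\<exists>T. open T \<and> x \<in> T \<and> Cinf T (f \<circ> chart_inv c)"
    by (rule exI[of _ "snd c ` (fst c \<inter> V)"]) (use V p c chart_image_open in \<open>auto simp: smooth_fun_def\<close>)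
qed

lemma smooth_fun_const: "open U \<Longrightarrow> smooth_fun \<A> U (\<lambda>p. a)"
  by (auto simp: smooth_fun_def o_def intro!: Cinf_const chart_image_open)

lemma smooth_fun_add: "open U \<Longrightarrow> smooth_fun \<A> U f \<Longrightarrow> smooth_fun \<A> U h \<Longrightarrow> smooth_fun \<A> U (\<lambda>p. f p + h p)"
  by (auto simp: smooth_fun_def o_def intro!: Cinf_add chart_image_open)

lemma smooth_fun_diff: "open U \<Longrightarrow> smooth_fun \<A> U f \<Longrightarrow> smooth_fun \<A> U h \<Longrightarrow> smooth_fun \<A> U (\<lambda>p. f p - h p)"
  by (auto simp: smooth_fun_def o_def intro!: Cinf_diff chart_image_open)

lemma smooth_fun_mult: "open U \<Longrightarrow> smooth_fun \<A> U f \<Longrightarrow> smooth_fun \<A> U h \<Longrightarrow> smooth_fun \<A> U (\<lambda>p. f p * h p)"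
  by (auto simp: smooth_fun_def o_def intro!: Cinf_mult chart_image_open)

lemma smooth_fun_sum:
  "open U \<Longrightarrow> (\<And>i. i \<in> I \<Longrightarrow> smooth_fun \<A> U (f i)) \<Longrightarrow> smooth_fun \<A> U (\<lambda>p. \<Sum>i\<in>I. f i p)"
  by (auto simp: smooth_fun_def o_def intro!: Cinf_sum chart_image_open)

lemma smooth_fun_prod:
  "open U \<Longrightarrow> (\<And>i. i \<in> I \<Longrightarrow> smooth_fun \<A> U (f i)) \<Longrightarrow> smooth_fun \<A> U (\<lambda>p. \<Prod>i\<in>I. f i p)"
  by (induction I rule: infinite_finite_induct) (auto intro: smooth_fun_mult smooth_fun_const)

lemma smooth_fun_inverse:
  assumes "open U" "smooth_fun \<A> U f" "\<And>p. p \<in> U \<Longrightarrow> f p \<noteq> 0"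
  shows "smooth_fun \<A> U (\<lambda>p. inverse (f p))"
  unfolding smooth_fun_def
proof
  fix c assume c: "c \<in> \<A>"
  have "Cinf (snd c ` (fst c \<inter> U)) (\<lambda>y. inverse ((f \<circ> chart_inv c) y))"
    by (rule Cinf_inverse[OF chart_image_open[OF c assms(1)] smooth_fun_imp_Cinf[OF c assms(2)]])
      (use assms(3) chart_image[OF c] in auto)
  then show "Cinf (snd c ` (fst c \<inter> U)) ((\<lambda>p. inverse (f p)) \<circ> chart_inv c)"
    by (simp add: o_def)
qed

lemma smooth_fun_chart:
  assumes c: "c \<in> \<A>" and U: "open U" "U \<subseteq> fst c" and F: "open T" "Cinf T F" "snd c ` U \<subseteq> T"
  shows "smooth_fun \<A> U (\<lambda>p. F (snd c p))"
  unfolding smooth_fun_def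
proof
  fix d assume d: "d \<in> \<A>"
  have "smooth_transition d c"
    using smooth_structure c d by (simp add: smooth_structure_def)
  then have "Cinf (snd d ` (fst d \<inter> U)) (snd c \<circ> chart_inv d)"
    unfolding smooth_transition_def by (rule Cinf_subset) (use U in auto)
  then have "Cinf (snd d ` (fst d \<inter> U)) (\<lambda>y. F ((snd c \<circ> chart_inv d) y))"
    by (rule Cinf_compose[OF chart_image_open[OF d U(1)] F(1) _ F(2)])
      (use F(3) chart_inv_left[OF d] in auto)
  then show "Cinf (snd d ` (fst d \<inter> U)) ((\<lambda>p. F (snd c p)) \<circ> chart_inv d)"
    by (simp add: o_def)
qed

lemma smooth_fun_coord: "c \<in> \<A> \<Longrightarrow> smooth_fun \<A> (fst c) (coord c i)"
  by (rule smooth_fun_chart[where F = "\<lambda>y. y $ i", OF _ _ _ open_UNIV])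
    (auto intro!: chart_open Cinf_bounded_linear bounded_linear_vec_nth)

lemma smooth_fun_isCont:
  assumes "open U" "p \<in> U" "p \<in> M" "smooth_fun \<A> U f"
  shows "isCont f p"
proof -
  obtain c where c: "c \<in> \<A>" "p \<in> fst c"
    using in_chart assms(3) by blast
  let ?V = "fst c \<inter> U"
  have "continuous_on ?V (\<lambda>q. (f \<circ> chart_inv c) (snd c q))"
    by (rule continuous_on_compose2[OF Cinf_imp_continuous_on[OF smooth_fun_imp_Cinf[OF c(1) assms(4)]]
          continuous_on_subset[OF chart_continuous[OF c(1)]]]) auto
  then have "continuous_on ?V f"
    by (rule continuous_on_eq) (simp add: chart_inv_left[OF c(1)])
  then show ?thesis
    using assms(1,2) c chart_open[OF c(1)] by (simp add: continuous_on_eq_continuous_at open_Int)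
qed

lemma smooth_nearI: "open U \<Longrightarrow> p \<in> U \<Longrightarrow> smooth_fun \<A> U f \<Longrightarrow> smooth_near \<A> p f"
  by (auto simp: smooth_near_def)

lemma smooth_near_const: "smooth_near \<A> p (\<lambda>q. a)"
  by (rule smooth_nearI[OF open_UNIV]) (auto intro: smooth_fun_const)

lemma smooth_near_binop:
  assumes "smooth_near \<A> p f" "smooth_near \<A> p h"
    and "\<And>U. open U \<Longrightarrow> smooth_fun \<A> U f \<Longrightarrow> smooth_fun \<A> U h \<Longrightarrow> smooth_fun \<A> U k"
  shows "smooth_near \<A> p k"
proof -
  obtain U V where "open U" "p \<in> U" "smooth_fun \<A> U f" "open V" "p \<in> V" "smooth_fun \<A> V h"
    using assms(1,2) by (auto simp: smooth_near_def)
  then have "smooth_fun \<A> (U \<inter> V) k"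
    using assms(3)[of "U \<inter> V"] smooth_fun_subset by blast
  then show ?thesis
    using \<open>open U\<close> \<open>open V\<close> \<open>p \<in> U\<close> \<open>p \<in> V\<close> smooth_nearI[of "U \<inter> V"] by auto
qed

lemma smooth_near_add: "smooth_near \<A> p f \<Longrightarrow> smooth_near \<A> p h \<Longrightarrow> smooth_near \<A> p (\<lambda>q. f q + h q)"
  by (erule (1) smooth_near_binop) (rule smooth_fun_add)

lemma smooth_near_diff: "smooth_near \<A> p f \<Longrightarrow> smooth_near \<A> p h \<Longrightarrow> smooth_near \<A> p (\<lambda>q. f q - h q)"
  by (erule (1) smooth_near_binop) (rule smooth_fun_diff)

lemma smooth_near_mult: "smooth_near \<A> p f \<Longrightarrow> smooth_near \<A> p h \<Longrightarrow> smooth_near \<A> p (\<lambda>q. f q * h q)"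
  by (erule (1) smooth_near_binop) (rule smooth_fun_mult)

lemma smooth_near_sum:
  "(\<And>i. i \<in> I \<Longrightarrow> smooth_near \<A> p (f i)) \<Longrightarrow> smooth_near \<A> p (\<lambda>q. \<Sum>i\<in>I. f i q)"
  by (induction I rule: infinite_finite_induct) (auto intro: smooth_near_const smooth_near_add)

lemma smooth_near_coord: "c \<in> \<A> \<Longrightarrow> p \<in> fst c \<Longrightarrow> smooth_near \<A> p (coord c i)"
  by (rule smooth_nearI[OF chart_open(1) _ smooth_fun_coord])

lemma smooth_near_eq:
  assumes "smooth_near \<A> p f" "open U" "p \<in> U" "\<And>q. q \<in> U \<Longrightarrow> q \<in> M \<Longrightarrow> f q = h q"
  shows "smooth_near \<A> p h"
proof -
  obtain V where V: "open V" "p \<in> V" "smooth_fun \<A> V f"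
    using assms(1) by (auto simp: smooth_near_def)
  have "smooth_fun \<A> (V \<inter> U) f"
    using V(3) smooth_fun_subset by blast
  then have "smooth_fun \<A> (V \<inter> U) h"
    using smooth_fun_cong[of "V \<inter> U" f h] V assms by auto
  then show ?thesis
    using V assms smooth_nearI[of "V \<inter> U"] by auto
qed

lemma smooth_near_differentiable:
  assumes "c \<in> \<A>" "p \<in> fst c" "smooth_near \<A> p f"
  shows "((f \<circ> chart_inv c) has_derivative frechet_derivative (f \<circ> chart_inv c) (at (snd c p))) (at (snd c p))"
proof -
  obtain U where "open U" "p \<in> U" "smooth_fun \<A> U f"
    using assms(3) by (auto simp: smooth_near_def)
  then show ?thesis
    by (intro Cinf_has_derivative[OF smooth_fun_imp_Cinf[OF assms(1)]]) (use assms in auto)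
qed

section \<open>Tangent vectors as derivations and their components in a chart\<close>

lemma tspace_not_smooth: "v \<in> tspace \<A> p \<Longrightarrow> \<not> smooth_near \<A> p f \<Longrightarrow> v f = 0"
  by (simp add: tspace_def)

text \<open>For functions smooth near p this is the germ condition in \<open>tspace\<close>.
  Otherwise neither function is smooth near p and both values are the default 0, so later uses need
  no smoothness check.\<close>

lemma tspace_local:
  assumes "v \<in> tspace \<A> p" "open U" "p \<in> U" "p \<in> M" "\<And>q. q \<in> U \<Longrightarrow> q \<in> M \<Longrightarrow> f q = h q"
  shows "v f = v h"
proof -
  obtain c where c: "c \<in> \<A>" "p \<in> fst c"
    using in_chart assms(4) by blast
  have ev: "eventually (\<lambda>q. f q = h q) (nhds p)"
    unfolding eventually_nhds
    by (rule exI[of _ "U \<inter> fst c"]) (use assms c chart_open[OF c(1)] chart_subset[OF c(1)] in auto)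
  show ?thesis
  proof (cases "smooth_near \<A> p f")
    case True
    then show ?thesis
      using assms(1) ev by (simp add: tspace_def)
  next
    case False
    moreover have "\<not> smooth_near \<A> p h"
      using False smooth_near_eq[of p h U f] assms by auto
    ultimately show ?thesis
      using assms(1) tspace_not_smooth by metis
  qed
qed

lemma tspace_add:
  "v \<in> tspace \<A> p \<Longrightarrow> smooth_near \<A> p f \<Longrightarrow> smooth_near \<A> p h \<Longrightarrow> v (\<lambda>q. f q + h q) = v f + v h"
  by (simp add: tspace_def)

lemma tspace_cmult: "v \<in> tspace \<A> p \<Longrightarrow> smooth_near \<A> p f \<Longrightarrow> v (\<lambda>q. a * f q) = a * v f"
  by (simp add: tspace_def)

lemma tspace_mult:
  "v \<in> tspace \<A> p \<Longrightarrow> smooth_near \<A> p f \<Longrightarrow> smooth_near \<A> p h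
    \<Longrightarrow> v (\<lambda>q. f q * h q) = f p * v h + h p * v f"
  by (simp add: tspace_def)

lemma tspace_const:
  assumes "v \<in> tspace \<A> p"
  shows "v (\<lambda>q. a) = 0"
proof -
  have "v (\<lambda>q. 1 * 1) = 1 * v (\<lambda>q. 1) + 1 * v (\<lambda>q. 1)"
    by (rule tspace_mult[OF assms smooth_near_const smooth_near_const])
  then have "v (\<lambda>q. 1) = 0"
    by simp
  then show ?thesis
    using tspace_cmult[OF assms smooth_near_const, of a 1] by simp
qed

lemma tspace_diff:
  assumes "v \<in> tspace \<A> p" "smooth_near \<A> p f" "smooth_near \<A> p h"
  shows "v (\<lambda>q. f q - h q) = v f - v h"
proof -
  have "smooth_near \<A> p (\<lambda>q. (- 1) * h q)"
    using smooth_near_mult[OF smooth_near_const assms(3)] .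
  from tspace_add[OF assms(1,2) this] show ?thesis
    using tspace_cmult[OF assms(1,3), of "- 1"] by simp
qed

lemma tspace_sum:
  assumes "v \<in> tspace \<A> p"
  shows "(\<And>i. i \<in> I \<Longrightarrow> smooth_near \<A> p (f i)) \<Longrightarrow> v (\<lambda>q. \<Sum>i\<in>I. f i q) = (\<Sum>i\<in>I. v (f i))"
  by (induction I rule: infinite_finite_induct)
    (auto simp: tspace_const[OF assms] tspace_add[OF assms] smooth_near_sum)

lemma tspace_combination:
  assumes "v \<in> tspace \<A> p" "w \<in> tspace \<A> p"
  shows "(\<lambda>f. a * v f + b * w f) \<in> tspace \<A> p"
  using assms unfolding tspace_def by (auto simp: algebra_simps)

lemma tspace_plus: "v \<in> tspace \<A> p \<Longrightarrow> w \<in> tspace \<A> p \<Longrightarrow> (\<lambda>f. v f + w f) \<in> tspace \<A> p"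
  using tspace_combination[of v p w 1 1] by simp

lemma tspace_minus: "v \<in> tspace \<A> p \<Longrightarrow> w \<in> tspace \<A> p \<Longrightarrow> (\<lambda>f. v f - w f) \<in> tspace \<A> p"
  using tspace_combination[of v p w 1 "- 1"] by simp

lemma tspace_scale: "v \<in> tspace \<A> p \<Longrightarrow> (\<lambda>f. a * v f) \<in> tspace \<A> p"
  using tspace_combination[of v p v a 0] by simp

lemma tspace_zero: "(\<lambda>f. 0) \<in> tspace \<A> p"
  by (simp add: tspace_def)

lemma tspace_sum_closed:
  "(\<And>i. i \<in> I \<Longrightarrow> e i \<in> tspace \<A> p) \<Longrightarrow> (\<lambda>f. \<Sum>i\<in>I. a i * e i f) \<in> tspace \<A> p"
proof (induction I rule: infinite_finite_induct)
  case (insert x F)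
  then have "(\<lambda>f. a x * e x f + (\<Sum>i\<in>F. a i * e i f)) \<in> tspace \<A> p"
    by (intro tspace_plus tspace_scale) auto
  then show ?case
    using insert by simp
qed (auto intro: tspace_zero)

lemma coord_vec_in_tspace:
  assumes c: "c \<in> \<A>" "p \<in> fst c"
  shows "coord_vec \<A> c i p \<in> tspace \<A> p"
proof -
  let ?D = "\<lambda>f. frechet_derivative (f \<circ> chart_inv c) (at (snd c p))"
  note D = smooth_near_differentiable[OF c]
  have local: "coord_vec \<A> c i p f = coord_vec \<A> c i p h"
    if f: "smooth_near \<A> p f" and ev: "eventually (\<lambda>q. f q = h q) (nhds p)" for f h
  proof -
    obtain U where U: "open U" "p \<in> U" "\<And>q. q \<in> U \<Longrightarrow> f q = h q"
      using ev unfolding eventually_nhds by blast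
    have "?D f = ?D h"
      by (rule frechet_derivative_transform_within_open[OF _ chart_image_open[OF c(1) U(1)]])
        (use D[OF f] U c in \<open>auto simp: differentiable_def chart_image[OF c(1)] chart_inv_left[OF c(1)]\<close>)
    then show ?thesis
      using smooth_near_eq[OF f U(1,2)] U(3) f by (simp add: coord_vec_def)
  qed
  have add: "?D (\<lambda>q. f q + h q) = (\<lambda>v. ?D f v + ?D h v)"
    if "smooth_near \<A> p f" "smooth_near \<A> p h" for f h
    using frechet_derivative_at[OF has_derivative_add[OF D[OF that(1)] D[OF that(2)]]] by (simp add: o_def)
  have mult: "?D (\<lambda>q. f q * h q) = (\<lambda>v. f p * ?D h v + ?D f v * h p)"
    if "smooth_near \<A> p f" "smooth_near \<A> p h" for f h
    using frechet_derivative_at[OF has_derivative_mult[OF D[OF that(1)] D[OF that(2)]]]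
    by (simp add: o_def chart_inv_left[OF c(1) c(2)])
  have const: "?D (\<lambda>q. a) = (\<lambda>v. 0)" for a :: real
    by (simp add: o_def)
  show ?thesis
    unfolding tspace_def
  proof (intro CollectI conjI allI impI)
    fix f h assume "smooth_near \<A> p f \<and> smooth_near \<A> p h"
    then show "coord_vec \<A> c i p (\<lambda>q. f q + h q) = coord_vec \<A> c i p f + coord_vec \<A> c i p h"
      and "coord_vec \<A> c i p (\<lambda>q. f q * h q) = f p * coord_vec \<A> c i p h + h p * coord_vec \<A> c i p f"
      by (simp_all add: coord_vec_def add mult smooth_near_add smooth_near_mult)
  next
    fix a f assume f: "smooth_near \<A> p f"
    then show "coord_vec \<A> c i p (\<lambda>q. a * f q) = a * coord_vec \<A> c i p f"
      using mult[OF smooth_near_const f, of a] const[of a] smooth_near_mult[OF smooth_near_const f, of a]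
      by (simp add: coord_vec_def)
  next
    fix f h assume "smooth_near \<A> p f \<and> (\<forall>\<^sub>F q in nhds p. f q = h q)"
    then show "coord_vec \<A> c i p f = coord_vec \<A> c i p h"
      using local by blast
  qed (simp add: coord_vec_def)
qed

lemma coord_vec_coord:
  assumes c: "c \<in> \<A>" "p \<in> fst c"
  shows "coord_vec \<A> c i p (coord c j) = (if i = j then 1 else 0)"
proof -
  have "frechet_derivative (coord c j \<circ> chart_inv c) (at (snd c p)) = frechet_derivative (\<lambda>y. y $ j) (at (snd c p))"
    by (rule frechet_derivative_transform_within_open[OF _ chart_open(2)[OF c(1)]])
      (use smooth_near_differentiable[OF c smooth_near_coord[OF c]] c chart_inv_right[OF c(1)]
        in \<open>auto simp: differentiable_def\<close>)
  also have "\<dots> = (\<lambda>y. y $ j)"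
    by (rule frechet_derivative_at[symmetric]) (rule bounded_linear_imp_has_derivative[OF bounded_linear_vec_nth])
  finally show ?thesis
    using smooth_near_coord[OF c] by (auto simp: coord_vec_def axis_def)
qed

lemma Basis_real_vec: "(Basis :: (real ^ 'm) set) = range (\<lambda>i. axis i 1)"
  by (auto simp: Basis_vec_def)

lemma inj_axis: "inj (\<lambda>i. axis i (1::real) :: real ^ 'm)"
  by (auto simp: inj_on_def axis_eq_axis)

text \<open>By the Hadamard factorization, f - f p is near p a sum of products of x_i - x_i(p) with
  smooth H_i. A derivation kills the constants and sees only H_i(p); applied to
  \<open>coord_vec\<close> itself, this identifies H_i(p) as the i-th partial derivative. For f not
  smooth near p both sides are 0.\<close>

lemma tspace_decomp:
  assumes c: "c \<in> \<A>" "p \<in> fst c" and v: "v \<in> tspace \<A> p"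
  shows "v f = (\<Sum>i\<in>UNIV. v (coord c i) * coord_vec \<A> c i p f)"
proof (cases "smooth_near \<A> p f")
  case False
  then show ?thesis
    using v tspace_not_smooth by (simp add: coord_vec_def)
next
  case True
  then obtain U where U: "open U" "p \<in> U" "smooth_fun \<A> U f"
    by (auto simp: smooth_near_def)
  let ?x = "snd c p"
  have "?x \<in> snd c ` (fst c \<inter> U)"
    using c U by auto
  then obtain r where r: "r > 0" "ball ?x r \<subseteq> snd c ` (fst c \<inter> U)"
    using chart_image_open[OF c(1) U(1)] open_contains_ball by blast
  let ?B = "ball ?x r"
  have x: "?x \<in> ?B"
    using r(1) by simp
  have F: "Cinf ?B (f \<circ> chart_inv c)"
    using smooth_fun_imp_Cinf[OF c(1) U(3)] r(2) Cinf_subset by blast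
  obtain h where h: "\<And>b. Cinf ?B (h b)" and
    fh: "\<And>x. x \<in> ?B \<Longrightarrow> (f \<circ> chart_inv c) x = (f \<circ> chart_inv c) ?x + (\<Sum>b\<in>Basis. ((x - ?x) \<bullet> b) * h b x)"
    by (rule Cinf_hadamard[OF open_ball convex_ball x F]) blast
  define H where "H = (\<lambda>i q. h (axis i 1) (snd c q))"
  define V where "V = fst c \<inter> snd c -` ?B"
  have V: "open V" "p \<in> V"
    using chart_vimage_open[OF c(1)] r c by (auto simp: V_def)
  have HV: "smooth_near \<A> p (H i)" for i
    unfolding H_def
    by (rule smooth_nearI[OF V]) (rule smooth_fun_chart[OF c(1) V(1) _ open_ball h], auto simp: V_def)
  have feq: "f q = f p + (\<Sum>i\<in>UNIV. (coord c i q - coord c i p) * H i q)" if "q \<in> V" for q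
  proof -
    have "f q = f p + (\<Sum>b\<in>Basis. ((snd c q - ?x) \<bullet> b) * h b (snd c q))"
      using fh[of "snd c q"] that c chart_inv_left[OF c(1)] by (auto simp: V_def)
    also have "(\<Sum>b\<in>Basis. ((snd c q - ?x) \<bullet> b) * h b (snd c q))
        = (\<Sum>i\<in>UNIV. (coord c i q - coord c i p) * H i q)"
      unfolding Basis_real_vec
      by (subst sum.reindex[OF inj_axis]) (simp add: H_def inner_axis)
    finally show ?thesis .
  qed
  have wf: "w f = (\<Sum>i\<in>UNIV. H i p * w (coord c i))" if w: "w \<in> tspace \<A> p" for w
  proof -
    have sm: "smooth_near \<A> p (\<lambda>q. coord c i q - coord c i p)" for i
      using smooth_near_diff[OF smooth_near_coord[OF c] smooth_near_const] .
    have "w f = w (\<lambda>q. f p + (\<Sum>i\<in>UNIV. (coord c i q - coord c i p) * H i q))"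
      by (rule tspace_local[OF w V]) (use feq c chart_subset[OF c(1)] in auto)
    also have "\<dots> = w (\<lambda>q. \<Sum>i\<in>UNIV. (coord c i q - coord c i p) * H i q)"
      by (subst tspace_add[OF w])
        (auto simp: tspace_const[OF w] intro!: smooth_near_const smooth_near_sum smooth_near_mult sm HV)
    also have "\<dots> = (\<Sum>i\<in>UNIV. w (\<lambda>q. (coord c i q - coord c i p) * H i q))"
      by (rule tspace_sum[OF w]) (intro smooth_near_mult sm HV)
    also have "\<dots> = (\<Sum>i\<in>UNIV. H i p * w (\<lambda>q. coord c i q - coord c i p))"
      by (simp add: tspace_mult[OF w sm HV])
    also have "\<dots> = (\<Sum>i\<in>UNIV. H i p * w (coord c i))"
      by (simp add: tspace_diff[OF w smooth_near_coord[OF c] smooth_near_const] tspace_const[OF w])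
    finally show ?thesis .
  qed
  have "coord_vec \<A> c i p f = H i p" for i
    unfolding wf[OF coord_vec_in_tspace[OF c]]
    by (simp add: coord_vec_coord[OF c] if_distrib[of "(*) _"] cong: if_cong)
  then show ?thesis
    by (simp only: wf[OF v] mult.commute)
qed

lemma tspace_eq:
  assumes "c \<in> \<A>" "p \<in> fst c" "v \<in> tspace \<A> p" "w \<in> tspace \<A> p"
    and "\<And>i. v (coord c i) = w (coord c i)"
  shows "v = w"
proof
  show "v f = w f" for f
    unfolding tspace_decomp[OF assms(1-3), of f] tspace_decomp[OF assms(1,2,4), of f] assms(5) ..
qed

definition coord_comb :: "('a, 'm) chart \<Rightarrow> 'a \<Rightarrow> real ^ 'm \<Rightarrow> 'a tvec" where
  "coord_comb c p a f = (\<Sum>i\<in>UNIV. a $ i * coord_vec \<A> c i p f)"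

lemma coord_comb_in_tspace: "c \<in> \<A> \<Longrightarrow> p \<in> fst c \<Longrightarrow> coord_comb c p a \<in> tspace \<A> p"
  unfolding coord_comb_def[abs_def] by (rule tspace_sum_closed) (rule coord_vec_in_tspace)

lemma coord_comb_coord: "c \<in> \<A> \<Longrightarrow> p \<in> fst c \<Longrightarrow> coord_comb c p a (coord c j) = a $ j"
  by (simp add: coord_comb_def coord_vec_coord if_distrib[of "(*) _"] cong: if_cong)

lemma coord_comb_frechet:
  assumes "c \<in> \<A>" "p \<in> fst c" "smooth_near \<A> p f"
  shows "coord_comb c p a f = frechet_derivative (f \<circ> chart_inv c) (at (snd c p)) a"
proof -
  let ?D = "frechet_derivative (f \<circ> chart_inv c) (at (snd c p))"
  have lin: "linear ?D"
    using smooth_near_differentiable[OF assms] has_derivative_linear by blast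
  have "?D a = ?D (\<Sum>i\<in>UNIV. (a $ i) *\<^sub>R axis i 1)"
    using basis_expansion[of a] by (simp add: scalar_mult_eq_scaleR)
  also have "\<dots> = (\<Sum>i\<in>UNIV. a $ i * ?D (axis i 1))"
    by (simp only: linear_sum[OF lin] linear_scale[OF lin] real_scaleR_def)
  finally show ?thesis
    using assms(3) by (simp add: coord_comb_def coord_vec_def)
qed

section \<open>Vector fields and the Lie bracket\<close>

lemma vfield_in_tspace: "vfield_on \<A> U X \<Longrightarrow> p \<in> U \<Longrightarrow> X p \<in> tspace \<A> p"
  by (simp add: vfield_on_def)

lemma vfield_smooth:
  "vfield_on \<A> U X \<Longrightarrow> open V \<Longrightarrow> V \<subseteq> U \<Longrightarrow> smooth_fun \<A> V f \<Longrightarrow> smooth_fun \<A> V (\<lambda>p. X p f)"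
  by (simp add: vfield_on_def)

lemma vfield_smooth_near:
  assumes "vfield_on \<A> U X" "open U" "p \<in> U" "smooth_near \<A> p f"
  shows "smooth_near \<A> p (\<lambda>q. X q f)"
proof -
  obtain V where V: "open V" "p \<in> V" "smooth_fun \<A> V f"
    using assms(4) by (auto simp: smooth_near_def)
  then have "smooth_fun \<A> (U \<inter> V) (\<lambda>q. X q f)"
    using vfield_smooth[OF assms(1) _ Int_lower1 smooth_fun_subset[OF V(3) Int_lower2]] assms(2) by auto
  then show ?thesis
    using smooth_nearI[of "U \<inter> V"] V assms by auto
qed

lemma vfield_subset: "vfield_on \<A> U X \<Longrightarrow> V \<subseteq> U \<Longrightarrow> vfield_on \<A> V X"
  unfolding vfield_on_def by (meson subset_trans subsetD)

lemma vfield_cong: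
  assumes "vfield_on \<A> U X" "\<And>p. p \<in> U \<Longrightarrow> X p = Y p"
  shows "vfield_on \<A> U Y"
  unfolding vfield_on_def
proof (intro conjI allI impI ballI)
  show "Y p \<in> tspace \<A> p" if "p \<in> U" for p
    using vfield_in_tspace[OF assms(1) that] assms(2)[OF that] by simp
  fix V f assume V: "open V \<and> V \<subseteq> U \<and> smooth_fun \<A> V f"
  then have "smooth_fun \<A> V (\<lambda>p. X p f)"
    using vfield_smooth[OF assms(1)] by blast
  moreover have "X p f = Y p f" if "p \<in> V" for p
    using assms(2)[of p] V that by auto
  ultimately show "smooth_fun \<A> V (\<lambda>p. Y p f)"
    using smooth_fun_cong[of V "\<lambda>p. X p f" "\<lambda>p. Y p f"] V by simp
qed

lemma vfield_local:
  assumes "\<And>p. p \<in> U \<Longrightarrow> \<exists>V. open V \<and> p \<in> V \<and> vfield_on \<A> V X"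
  shows "vfield_on \<A> U X"
  unfolding vfield_on_def
proof (intro conjI allI impI ballI)
  show "X p \<in> tspace \<A> p" if "p \<in> U" for p
    using assms[OF that] vfield_in_tspace by blast
  fix V f assume V: "open V \<and> V \<subseteq> U \<and> smooth_fun \<A> V f"
  show "smooth_fun \<A> V (\<lambda>p. X p f)"
  proof (rule smooth_fun_local)
    fix p assume "p \<in> V"
    then obtain T where T: "open T" "p \<in> T" "vfield_on \<A> T X"
      using assms V by blast
    have "smooth_fun \<A> (T \<inter> V) (\<lambda>p. X p f)"
      by (rule vfield_smooth[OF T(3)]) (use T V smooth_fun_subset in auto)
    then show "\<exists>W. open W \<and> p \<in> W \<and> smooth_fun \<A> W (\<lambda>p. X p f)"
      using T V \<open>p \<in> V\<close> by (intro exI[of _ "T \<inter> V"]) auto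
  qed
qed

lemma vfield_add:
  assumes "vfield_on \<A> U X" "vfield_on \<A> U Y"
  shows "vfield_on \<A> U (vf_add X Y)"
  using assms unfolding vfield_on_def vf_add_def by (auto intro: tspace_plus smooth_fun_add)

lemma vfield_scale:
  assumes "vfield_on \<A> U X" "smooth_fun \<A> U h"
  shows "vfield_on \<A> U (vf_scale h X)"
  using assms smooth_fun_subset[OF assms(2)]
  unfolding vfield_on_def vf_scale_def by (auto intro: tspace_scale smooth_fun_mult)

lemma vfield_zero: "vfield_on \<A> U (\<lambda>p f. 0)"
  unfolding vfield_on_def by (auto intro: tspace_zero smooth_fun_const)

lemma lie_eq: "smooth_near \<A> p f \<Longrightarrow> lie \<A> X Y p f = X p (\<lambda>q. Y q f) - Y p (\<lambda>q. X q f)"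
  by (simp add: lie_def)

lemma lie_anti: "lie \<A> Y X p f = - lie \<A> X Y p f"
  by (simp add: lie_def)

text \<open>The terms with one derivative on each factor are symmetric in X and Y and cancel in the
  Leibniz rule, so the bracket is a derivation.\<close>

lemma vfield_lie:
  assumes U: "open U" "U \<subseteq> M" and X: "vfield_on \<A> U X" and Y: "vfield_on \<A> U Y"
  shows "vfield_on \<A> U (lie \<A> X Y)"
  unfolding vfield_on_def
proof (intro conjI allI impI ballI)
  fix p assume p: "p \<in> U"
  have pM: "p \<in> M"
    using U p by blast
  note Xp = vfield_in_tspace[OF X p] and Yp = vfield_in_tspace[OF Y p]
  note sX = vfield_smooth_near[OF X U(1) p] and sY = vfield_smooth_near[OF Y U(1) p]
  \<comment> \<open>Before X p is applied, the rules for Y must be used at all points q near p; this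
    needs smoothness of f near each such q.\<close>
  have sn: "\<exists>V. open V \<and> p \<in> V \<and> V \<subseteq> U \<and> (\<forall>q\<in>V. smooth_near \<A> q f)" if "smooth_near \<A> p f" for f
  proof -
    obtain V where "open V" "p \<in> V" "smooth_fun \<A> V f"
      using \<open>smooth_near \<A> p f\<close> by (auto simp: smooth_near_def)
    then show ?thesis
      using U p by (intro exI[of _ "V \<inter> U"]) (auto intro: smooth_nearI)
  qed
  have add: "lie \<A> X Y p (\<lambda>q. f q + h q) = lie \<A> X Y p f + lie \<A> X Y p h"
    if f: "smooth_near \<A> p f" and h: "smooth_near \<A> p h" for f h
  proof -
    obtain V V' where V: "open V" "p \<in> V" "V \<subseteq> U" "\<forall>q\<in>V. smooth_near \<A> q f"
      and V': "open V'" "p \<in> V'" "V' \<subseteq> U" "\<forall>q\<in>V'. smooth_near \<A> q h"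
      using sn[OF f] sn[OF h] by blast
    have "X p (\<lambda>q. Y q (\<lambda>q. f q + h q)) = X p (\<lambda>q. Y q f + Y q h)"
      by (rule tspace_local[OF Xp, of "V \<inter> V'"])
        (use V V' pM in \<open>auto intro!: tspace_add vfield_in_tspace[OF Y]\<close>)
    moreover have "Y p (\<lambda>q. X q (\<lambda>q. f q + h q)) = Y p (\<lambda>q. X q f + X q h)"
      by (rule tspace_local[OF Yp, of "V \<inter> V'"])
        (use V V' pM in \<open>auto intro!: tspace_add vfield_in_tspace[OF X]\<close>)
    ultimately show ?thesis
      using f h by (simp add: lie_eq smooth_near_add tspace_add[OF Xp sY sY] tspace_add[OF Yp sX sX])
  qed
  have mult: "lie \<A> X Y p (\<lambda>q. f q * h q) = f p * lie \<A> X Y p h + h p * lie \<A> X Y p f"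
    if f: "smooth_near \<A> p f" and h: "smooth_near \<A> p h" for f h
  proof -
    obtain V V' where V: "open V" "p \<in> V" "V \<subseteq> U" "\<forall>q\<in>V. smooth_near \<A> q f"
      and V': "open V'" "p \<in> V'" "V' \<subseteq> U" "\<forall>q\<in>V'. smooth_near \<A> q h"
      using sn[OF f] sn[OF h] by blast
    have "X p (\<lambda>q. Y q (\<lambda>q. f q * h q)) = X p (\<lambda>q. f q * Y q h + h q * Y q f)"
      by (rule tspace_local[OF Xp, of "V \<inter> V'"])
        (use V V' pM in \<open>auto intro!: tspace_mult vfield_in_tspace[OF Y]\<close>)
    moreover have "Y p (\<lambda>q. X q (\<lambda>q. f q * h q)) = Y p (\<lambda>q. f q * X q h + h q * X q f)"
      by (rule tspace_local[OF Yp, of "V \<inter> V'"])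
        (use V V' pM in \<open>auto intro!: tspace_mult vfield_in_tspace[OF X]\<close>)
    ultimately show ?thesis
      using f h
      by (simp add: lie_eq smooth_near_mult tspace_add[OF Xp] tspace_add[OF Yp] sX sY
          tspace_mult[OF Xp] tspace_mult[OF Yp] algebra_simps)
  qed
  have const: "lie \<A> X Y p (\<lambda>q. a) = 0" for a
  proof -
    have "X p (\<lambda>q. Y q (\<lambda>q. a)) = X p (\<lambda>q. 0)"
      by (rule tspace_local[OF Xp U(1) p pM]) (use tspace_const vfield_in_tspace[OF Y] in auto)
    moreover have "Y p (\<lambda>q. X q (\<lambda>q. a)) = Y p (\<lambda>q. 0)"
      by (rule tspace_local[OF Yp U(1) p pM]) (use tspace_const vfield_in_tspace[OF X] in auto)
    ultimately show ?thesis
      by (simp add: lie_def tspace_const[OF Xp] tspace_const[OF Yp])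
  qed
  have local: "lie \<A> X Y p f = lie \<A> X Y p h"
    if f: "smooth_near \<A> p f" and ev: "eventually (\<lambda>q. f q = h q) (nhds p)" for f h
  proof -
    obtain T where T: "open T" "p \<in> T" "\<And>q. q \<in> T \<Longrightarrow> f q = h q"
      using ev unfolding eventually_nhds by blast
    have v: "v f = v h" if "q \<in> T \<inter> U" "v \<in> tspace \<A> q" for q v
      by (rule tspace_local[OF that(2) T(1)]) (use that T U in auto)
    have "X p (\<lambda>q. Y q f) = X p (\<lambda>q. Y q h)"
      by (rule tspace_local[OF Xp open_Int[OF T(1) U(1)]])
        (use T U p v vfield_in_tspace[OF Y] in auto)
    moreover have "Y p (\<lambda>q. X q f) = Y p (\<lambda>q. X q h)"
      by (rule tspace_local[OF Yp open_Int[OF T(1) U(1)]])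
        (use T U p v vfield_in_tspace[OF X] in auto)
    ultimately show ?thesis
      using f smooth_near_eq[OF f T(1,2), of h] T(3) by (simp add: lie_eq)
  qed
  show "lie \<A> X Y p \<in> tspace \<A> p"
    unfolding tspace_def
  proof (intro CollectI conjI allI impI)
    fix a f assume f: "smooth_near \<A> p f"
    then show "lie \<A> X Y p (\<lambda>q. a * f q) = a * lie \<A> X Y p f"
      using mult[OF smooth_near_const f] const by simp
  qed (use add mult local in \<open>auto simp: lie_def\<close>)
next
  fix V f assume V: "open V \<and> V \<subseteq> U \<and> smooth_fun \<A> V f"
  then have "smooth_fun \<A> V (\<lambda>p. X p (\<lambda>q. Y q f) - Y p (\<lambda>q. X q f))"
    using X Y by (intro smooth_fun_diff) (auto simp: vfield_on_def)
  moreover have "smooth_near \<A> q f" if "q \<in> V" for q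
    using V that smooth_nearI by blast
  ultimately show "smooth_fun \<A> V (\<lambda>p. lie \<A> X Y p f)"
    using smooth_fun_cong[of V "\<lambda>p. X p (\<lambda>q. Y q f) - Y p (\<lambda>q. X q f)" "\<lambda>p. lie \<A> X Y p f"] V
    by (simp add: lie_eq)
qed

lemma vfield_coord_vec:
  assumes c: "c \<in> \<A>"
  shows "vfield_on \<A> (fst c) (coord_vec \<A> c i)"
  unfolding vfield_on_def
proof (intro conjI allI impI ballI)
  show "coord_vec \<A> c i p \<in> tspace \<A> p" if "p \<in> fst c" for p
    using coord_vec_in_tspace[OF c that] .
  fix V f assume "open V \<and> V \<subseteq> fst c \<and> smooth_fun \<A> V f"
  then have V: "open V" "V \<subseteq> fst c" "smooth_fun \<A> V f"
    by auto
  have "Cinf (snd c ` (fst c \<inter> V)) (\<lambda>y. frechet_derivative (f \<circ> chart_inv c) (at y) (axis i 1))"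
    by (rule Cinf_frechet_derivative[OF smooth_fun_imp_Cinf[OF c V(3)]])
  then have "smooth_fun \<A> V (\<lambda>p. frechet_derivative (f \<circ> chart_inv c) (at (snd c p)) (axis i 1))"
    by (rule smooth_fun_chart[OF c V(1,2) chart_image_open[OF c V(1)]]) (use V in auto)
  moreover have "smooth_near \<A> q f" if "q \<in> V" for q
    using V that smooth_nearI by blast
  ultimately show "smooth_fun \<A> V (\<lambda>p. coord_vec \<A> c i p f)"
    using smooth_fun_cong[OF V(1), of "\<lambda>p. coord_vec \<A> c i p f"
        "\<lambda>p. frechet_derivative (f \<circ> chart_inv c) (at (snd c p)) (axis i 1)"]
    by (simp add: coord_vec_def)
qed

section \<open>Division and cut-off on the manifold\<close>

lemma smooth_divide:
  assumes c: "c \<in> \<A>" "p \<in> fst c" and U: "open U" "p \<in> U"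
    and f: "smooth_fun \<A> U f" and \<delta>: "smooth_fun \<A> U \<delta>" and "\<delta> p = 0"
    and d: "frechet_derivative (\<delta> \<circ> chart_inv c) (at (snd c p)) \<noteq> (\<lambda>v. 0)"
    and zero: "\<And>q. q \<in> U \<inter> fst c \<Longrightarrow> \<delta> q = 0 \<Longrightarrow> f q = 0"
  obtains V h where "open V" "p \<in> V" "V \<subseteq> U \<inter> fst c" "smooth_fun \<A> V h"
    "\<And>q. q \<in> V \<Longrightarrow> f q = \<delta> q * h q"
proof -
  let ?S = "snd c ` (fst c \<inter> U)"
  have p: "snd c p \<in> ?S" "(\<delta> \<circ> chart_inv c) (snd c p) = 0"
    using c U \<open>\<delta> p = 0\<close> chart_inv_left[OF c(1)] by auto
  have z: "(f \<circ> chart_inv c) x = 0" if "x \<in> ?S" "(\<delta> \<circ> chart_inv c) x = 0" for x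
    using zero[of "chart_inv c x"] that chart_inv_left[OF c(1)] by auto
  obtain W h where W: "open W" "snd c p \<in> W" "W \<subseteq> ?S" "Cinf W h"
    and h: "\<And>x. x \<in> W \<Longrightarrow> (f \<circ> chart_inv c) x = (\<delta> \<circ> chart_inv c) x * h x"
    by (rule Cinf_divide[OF chart_image_open[OF c(1) U(1)] p(1) smooth_fun_imp_Cinf[OF c(1) f]
        smooth_fun_imp_Cinf[OF c(1) \<delta>] p(2) d z]) blast+
  let ?V = "fst c \<inter> snd c -` W"
  have V: "open ?V"
    using chart_vimage_open[OF c(1) W(1)] .
  show thesis
  proof (rule that[OF V])
    show "p \<in> ?V" "smooth_fun \<A> ?V (\<lambda>q. h (snd c q))"
      using c W smooth_fun_chart[OF c(1) V _ W(1,4)] by auto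
    show "?V \<subseteq> U \<inter> fst c"
    proof
      fix q assume q: "q \<in> ?V"
      then have "snd c q \<in> {y \<in> snd c ` fst c. chart_inv c y \<in> U}"
        using W(3) unfolding chart_image[OF c(1)] by blast
      then show "q \<in> U \<inter> fst c"
        using q chart_inv_left[OF c(1)] by auto
    qed
    show "f q = \<delta> q * h (snd c q)" if "q \<in> ?V" for q
      using h[of "snd c q"] that chart_inv_left[OF c(1)] by auto
  qed
qed

text \<open>The support is the image of a compact ball, hence compact, and closed because the space
  is Hausdorff. Extension by 0 is therefore smooth: the chart domain and the complement of K form an
  open cover.\<close>

lemma smooth_bump:
  assumes "open U" "p \<in> U" "p \<in> M"
  obtains \<phi> K where "smooth_fun \<A> UNIV \<phi>" "\<phi> p = 1" "closed K" "K \<subseteq> U" "\<And>q. q \<notin> K \<Longrightarrow> \<phi> q = 0"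
proof -
  obtain c where c: "c \<in> \<A>" "p \<in> fst c"
    using in_chart assms(3) by blast
  have "snd c p \<in> snd c ` (fst c \<inter> U)"
    using c assms by auto
  then obtain r where r: "r > 0" "cball (snd c p) r \<subseteq> snd c ` (fst c \<inter> U)"
    using chart_image_open[OF c(1) assms(1)] open_contains_cball by blast
  obtain \<psi> where \<psi>: "Cinf UNIV \<psi>" "\<psi> (snd c p) = 1" "\<And>x. x \<notin> cball (snd c p) r \<Longrightarrow> \<psi> x = (0::real)"
    by (rule Cinf_bump[OF r(1)]) blast
  define K where "K = chart_inv c ` cball (snd c p) r"
  have "compact K"
    unfolding K_def
    by (rule compact_continuous_image[OF continuous_on_subset[OF chart_inv_continuous[OF c(1)]]])
      (use r in auto)
  then have K: "closed K"
    by (rule compact_imp_closed)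
  have KU: "K \<subseteq> fst c \<inter> U"
    using r(2) chart_inv_left[OF c(1)] unfolding K_def by fastforce
  define \<phi> where "\<phi> = (\<lambda>q. if q \<in> fst c then \<psi> (snd c q) else 0)"
  have \<phi>0: "\<phi> q = 0" if "q \<notin> K" for q
    using that \<psi>(3)[of "snd c q"] chart_inv_left[OF c(1)] by (force simp: \<phi>_def K_def)
  have "smooth_fun \<A> UNIV \<phi>"
  proof (rule smooth_fun_local)
    fix q assume "q \<in> UNIV" "q \<in> M"
    show "\<exists>V. open V \<and> q \<in> V \<and> smooth_fun \<A> V \<phi>"
    proof (cases "q \<in> fst c")
      case True
      have "smooth_fun \<A> (fst c) (\<lambda>q. \<psi> (snd c q))"
        by (rule smooth_fun_chart[OF c(1) chart_open(1)[OF c(1)] _ open_UNIV \<psi>(1)]) auto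
      then have "smooth_fun \<A> (fst c) \<phi>"
        using smooth_fun_cong[OF chart_open(1)[OF c(1)], of \<phi> "\<lambda>q. \<psi> (snd c q)"] by (simp add: \<phi>_def)
      then show ?thesis
        using True chart_open[OF c(1)] by blast
    next
      case False
      have "smooth_fun \<A> (- K) \<phi>"
        using smooth_fun_cong[of "- K" \<phi> "\<lambda>q. 0"] K smooth_fun_const[of "- K" 0] \<phi>0 by auto
      then show ?thesis
        using K False KU by (intro exI[of _ "- K"]) auto
    qed
  qed
  then show thesis
    using that[of \<phi> K] K KU \<phi>0 \<psi>(2) c by (auto simp: \<phi>_def)
qed

text \<open>The explicit shape of A, a multiple of X on U and zero elsewhere, is kept because linear
  conditions on X at every point of U, not only at p, must pass to A.\<close>

lemma vfield_bump:
  assumes "open U" "p \<in> U" "U \<subseteq> M" "vfield_on \<A> U X"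
  obtains A \<phi> where "vfield_on \<A> M A" "A p = X p"
    "\<And>q. q \<in> U \<Longrightarrow> A q = (\<lambda>f. \<phi> q * X q f)" "\<And>q. q \<notin> U \<Longrightarrow> A q = (\<lambda>f. 0)"
proof -
  obtain \<phi> K where \<phi>: "smooth_fun \<A> UNIV \<phi>" "\<phi> p = 1" and K: "closed K" "K \<subseteq> U"
    and 0: "\<And>q. q \<notin> K \<Longrightarrow> \<phi> q = 0"
    using smooth_bump[OF assms(1,2)] assms(2,3) by blast
  define A where "A = (\<lambda>q f. if q \<in> U then \<phi> q * X q f else 0)"
  have "vfield_on \<A> M A"
  proof (rule vfield_local)
    fix q assume "q \<in> M"
    show "\<exists>V. open V \<and> q \<in> V \<and> vfield_on \<A> V A"
    proof (cases "q \<in> U")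
      case True
      have "vfield_on \<A> U (vf_scale \<phi> X)"
        using vfield_scale[OF assms(4)] smooth_fun_subset[OF \<phi>(1)] by auto
      then have "vfield_on \<A> U A"
        by (rule vfield_cong) (auto simp: A_def vf_scale_def)
      then show ?thesis
        using True assms(1) by blast
    next
      case False
      have "vfield_on \<A> (- K) A"
        using vfield_zero by (rule vfield_cong) (use 0 in \<open>auto simp: A_def\<close>)
      then show ?thesis
        using False K by (intro exI[of _ "- K"]) auto
    qed
  qed
  then show thesis
    using that[of A \<phi>] assms(2) \<phi>(2) by (auto simp: A_def)
qed

lemma tlinear_sum:
  assumes L: "tlinear \<A> p L" and e: "\<And>i. i \<in> I \<Longrightarrow> e i \<in> tspace \<A> p"
  shows "L (\<lambda>f. \<Sum>i\<in>I. a i * e i f) = (\<Sum>i\<in>I. a i * L (e i))"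
proof -
  have add: "L (\<lambda>f. v f + w f) = L v + L w" if "v \<in> tspace \<A> p" "w \<in> tspace \<A> p" for v w
    using L that unfolding tlinear_def by metis
  have scale: "L (\<lambda>f. a * v f) = a * L v" if "v \<in> tspace \<A> p" for a v
    using L that unfolding tlinear_def by metis
  have zero: "L (\<lambda>f. 0) = 0"
    using scale[OF tspace_zero, of 0] by simp
  show ?thesis
    using e
  proof (induction I rule: infinite_finite_induct)
    case (insert x F)
    have "L (\<lambda>f. a x * e x f + (\<Sum>i\<in>F. a i * e i f)) = L (\<lambda>f. a x * e x f) + L (\<lambda>f. \<Sum>i\<in>F. a i * e i f)"
      using insert.prems by (intro add tspace_scale tspace_sum_closed) auto
    then show ?case
      using insert scale by simp
  qed (simp_all add: zero)
qed

end

section \<open>The dual connection in coordinates\<close>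

lemma sum3_rotate:
  "(\<Sum>a\<in>A. \<Sum>b\<in>B. \<Sum>c\<in>C. F a b c) = (\<Sum>b\<in>B. \<Sum>c\<in>C. \<Sum>a\<in>A. F a b c)"
  by (subst sum.swap) (intro sum.cong refl sum.swap)

locale metric_mfd = smooth_mfd \<A> for \<A> :: "('a::t2_space, 'm::finite) chart set" +
  fixes g :: "'a form2"
  assumes smooth_form: "smooth_sym_form2 \<A> g"
begin

lemma g_sym: "p \<in> M \<Longrightarrow> v \<in> tspace \<A> p \<Longrightarrow> w \<in> tspace \<A> p \<Longrightarrow> g p v w = g p w v"
  using smooth_form unfolding smooth_sym_form2_def by metis

lemma g_tlinear: "p \<in> M \<Longrightarrow> v \<in> tspace \<A> p \<Longrightarrow> tlinear \<A> p (g p v)"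
  using smooth_form unfolding smooth_sym_form2_def by metis

lemma g_smooth:
  "open U \<Longrightarrow> U \<subseteq> M \<Longrightarrow> vfield_on \<A> U X \<Longrightarrow> vfield_on \<A> U Y \<Longrightarrow> smooth_fun \<A> U (\<lambda>p. g p (X p) (Y p))"
  using smooth_form unfolding smooth_sym_form2_def by metis

lemma g_scale_right: "p \<in> M \<Longrightarrow> u \<in> tspace \<A> p \<Longrightarrow> v \<in> tspace \<A> p \<Longrightarrow> g p u (\<lambda>f. a * v f) = a * g p u v"
  using g_tlinear[of p u] unfolding tlinear_def by metis

lemma g_add_right:
  "p \<in> M \<Longrightarrow> u \<in> tspace \<A> p \<Longrightarrow> v \<in> tspace \<A> p \<Longrightarrow> w \<in> tspace \<A> p
    \<Longrightarrow> g p u (\<lambda>f. v f + w f) = g p u v + g p u w"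
  using g_tlinear[of p u] unfolding tlinear_def by metis

lemma g_diff_right:
  assumes "p \<in> M" "u \<in> tspace \<A> p" "v \<in> tspace \<A> p" "w \<in> tspace \<A> p"
  shows "g p u (\<lambda>f. v f - w f) = g p u v - g p u w"
  using g_add_right[OF assms(1-3) tspace_scale[OF assms(4)], of "- 1"] g_scale_right[OF assms(1,2,4), of "- 1"]
  by simp

lemma g_scale_left: "p \<in> M \<Longrightarrow> u \<in> tspace \<A> p \<Longrightarrow> v \<in> tspace \<A> p \<Longrightarrow> g p (\<lambda>f. a * v f) u = a * g p v u"
  by (simp add: g_sym[of p _ u] g_scale_right tspace_scale)

lemma g_diff_left:
  "p \<in> M \<Longrightarrow> u \<in> tspace \<A> p \<Longrightarrow> v \<in> tspace \<A> p \<Longrightarrow> w \<in> tspace \<A> p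
    \<Longrightarrow> g p (\<lambda>f. v f - w f) u = g p v u - g p w u"
  by (simp add: g_sym[of p _ u] g_diff_right tspace_minus)

lemma g_zero_left: "p \<in> M \<Longrightarrow> u \<in> tspace \<A> p \<Longrightarrow> g p (\<lambda>f. 0) u = 0"
  using g_scale_left[of p u u 0] by simp

definition gram :: "('a, 'm) chart \<Rightarrow> 'a \<Rightarrow> 'm \<Rightarrow> 'm \<Rightarrow> real" where
  "gram c p j k = g p (coord_vec \<A> c j p) (coord_vec \<A> c k p)"

definition dgram :: "('a, 'm) chart \<Rightarrow> 'a \<Rightarrow> 'm \<Rightarrow> 'm \<Rightarrow> 'm \<Rightarrow> real" where
  "dgram c p i j k = coord_vec \<A> c i p (\<lambda>q. gram c q j k)"

text \<open>The symbols of the first kind: they involve no inverse Gram matrix and therefore make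
  sense on \<Sigma>.\<close>

definition christoffel :: "('a, 'm) chart \<Rightarrow> 'a \<Rightarrow> 'm \<Rightarrow> 'm \<Rightarrow> 'm \<Rightarrow> real" where
  "christoffel c p i j k = (dgram c p i j k + dgram c p j k i - dgram c p k i j) / 2"

text \<open>It takes tuples of components because it is also applied to the tuples X(Y^j), which
  depend on the chart and are not tangent vectors given in advance.\<close>

definition gram_form :: "('a, 'm) chart \<Rightarrow> 'a \<Rightarrow> ('m \<Rightarrow> real) \<Rightarrow> ('m \<Rightarrow> real) \<Rightarrow> real" where
  "gram_form c p u w = (\<Sum>j\<in>UNIV. \<Sum>k\<in>UNIV. u j * w k * gram c p j k)"

context
  fixes c :: "('a, 'm) chart" and p :: 'a
  assumes c: "c \<in> \<A>" "p \<in> fst c"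
begin

lemma pM: "p \<in> M"
  using chart_subset[OF c(1)] c(2) by blast

lemma gram_sym: "gram c p j k = gram c p k j"
  unfolding gram_def by (rule g_sym[OF pM]) (rule coord_vec_in_tspace[OF c])+

lemma gram_form_sym: "gram_form c p u w = gram_form c p w u"
  unfolding gram_form_def by (subst sum.swap) (simp add: gram_sym mult.commute)

lemma gram_form_diff_left: "gram_form c p (\<lambda>j. u j - v j) w = gram_form c p u w - gram_form c p v w"
  by (simp add: gram_form_def algebra_simps sum_subtractf)

lemma g_coord:
  assumes v: "v \<in> tspace \<A> p" and w: "w \<in> tspace \<A> p"
  shows "g p v w = gram_form c p (\<lambda>j. v (coord c j)) (\<lambda>k. w (coord c k))"
proof -
  note e = coord_vec_in_tspace[OF c]
  have dec: "u = (\<lambda>f. \<Sum>i\<in>UNIV. u (coord c i) * coord_vec \<A> c i p f)" if "u \<in> tspace \<A> p" for u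
    using tspace_decomp[OF c that] by (rule ext)
  have 1: "g p u w = (\<Sum>k\<in>UNIV. w (coord c k) * g p u (coord_vec \<A> c k p))" if "u \<in> tspace \<A> p" for u
    by (subst dec[OF w]) (rule tlinear_sum[OF g_tlinear[OF pM that] e])
  have 2: "g p u v = (\<Sum>k\<in>UNIV. v (coord c k) * g p u (coord_vec \<A> c k p))" if "u \<in> tspace \<A> p" for u
    by (subst dec[OF v]) (rule tlinear_sum[OF g_tlinear[OF pM that] e])
  have "g p v w = (\<Sum>k\<in>UNIV. w (coord c k) * g p (coord_vec \<A> c k p) v)"
    unfolding 1[OF v] by (intro sum.cong refl arg_cong2[where f = "(*)"] g_sym[OF pM v e])
  also have "\<dots> = (\<Sum>k\<in>UNIV. \<Sum>j\<in>UNIV. v (coord c j) * w (coord c k) * gram c p j k)"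
    unfolding 2[OF e] gram_def[symmetric] sum_distrib_left
    by (intro sum.cong refl) (simp add: gram_sym[of _ k for k] mult.assoc mult.left_commute)
  also have "\<dots> = gram_form c p (\<lambda>j. v (coord c j)) (\<lambda>k. w (coord c k))"
    unfolding gram_form_def by (rule sum.swap)
  finally show ?thesis .
qed

lemma g_coord_vec:
  assumes "v \<in> tspace \<A> p"
  shows "g p (coord_vec \<A> c k p) v = (\<Sum>l\<in>UNIV. gram c p k l * v (coord c l))"
proof -
  have "g p (coord_vec \<A> c k p) v = (\<Sum>l\<in>UNIV. v (coord c l) * gram c p k l)"
    unfolding g_coord[OF coord_vec_in_tspace[OF c] assms] gram_form_def coord_vec_coord[OF c]
    by (subst sum.swap) (simp add: if_distrib[of "\<lambda>x. x * _"] cong: if_cong)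
  then show ?thesis
    by (simp add: mult.commute)
qed

lemma gram_form_radical:
  assumes "v \<in> radical \<A> g p"
  shows "gram_form c p u (\<lambda>k. v (coord c k)) = 0"
proof -
  have v: "v \<in> tspace \<A> p"
    using assms by (simp add: radical_def)
  have "gram_form c p u (\<lambda>k. v (coord c k)) = g p (coord_comb c p (\<chi> i. u i)) v"
    by (simp add: g_coord[OF coord_comb_in_tspace[OF c] v] coord_comb_coord[OF c])
  also have "\<dots> = g p v (coord_comb c p (\<chi> i. u i))"
    by (rule g_sym[OF pM coord_comb_in_tspace[OF c] v])
  finally show ?thesis
    using assms coord_comb_in_tspace[OF c] by (simp add: radical_def)
qed

end

lemma g_expand:
  assumes c: "c \<in> \<A>" "p \<in> fst c" and v: "v \<in> tspace \<A> p" and w: "w \<in> tspace \<A> p"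
  shows "g p v w = (\<Sum>j\<in>UNIV. v (coord c j) * g p (coord_vec \<A> c j p) w)"
  unfolding g_coord[OF c v w] g_coord_vec[OF c w] gram_form_def sum_distrib_left
  by (intro sum.cong refl) simp

lemma gram_smooth:
  assumes "c \<in> \<A>"
  shows "smooth_fun \<A> (fst c) (\<lambda>q. gram c q j k)"
  unfolding gram_def
  by (rule g_smooth[OF chart_open(1)[OF assms] chart_subset[OF assms]]) (rule vfield_coord_vec[OF assms])+

lemma tspace_g:
  assumes c: "c \<in> \<A>" "p \<in> fst c" and v: "v \<in> tspace \<A> p" and U: "open U" "p \<in> U"
    and Y: "vfield_on \<A> U Y" and Z: "vfield_on \<A> U Z"
  shows "v (\<lambda>q. g q (Y q) (Z q)) =
    gram_form c p (\<lambda>j. v (\<lambda>q. Y q (coord c j))) (\<lambda>k. Z p (coord c k))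
    + gram_form c p (\<lambda>j. Y p (coord c j)) (\<lambda>k. v (\<lambda>q. Z q (coord c k)))
    + (\<Sum>i\<in>UNIV. \<Sum>j\<in>UNIV. \<Sum>k\<in>UNIV. v (coord c i) * Y p (coord c j) * Z p (coord c k) * dgram c p i j k)"
proof -
  let ?y = "\<lambda>j q. Y q (coord c j)" and ?z = "\<lambda>k q. Z q (coord c k)" and ?G = "\<lambda>j k q. gram c q j k"
  have y: "smooth_near \<A> p (?y j)" for j
    by (rule vfield_smooth_near[OF Y U smooth_near_coord[OF c]])
  have z: "smooth_near \<A> p (?z j)" for j
    by (rule vfield_smooth_near[OF Z U smooth_near_coord[OF c]])
  have G: "smooth_near \<A> p (?G j k)" for j k
    by (rule smooth_nearI[OF chart_open(1)[OF c(1)] c(2) gram_smooth[OF c(1)]])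
  have vG: "v (?G j k) = (\<Sum>i\<in>UNIV. v (coord c i) * dgram c p i j k)" for j k
    unfolding dgram_def by (rule tspace_decomp[OF c v])
  have "v (\<lambda>q. g q (Y q) (Z q)) = v (\<lambda>q. \<Sum>j\<in>UNIV. \<Sum>k\<in>UNIV. ?y j q * ?z k q * ?G j k q)"
  proof (rule tspace_local[OF v, of "U \<inter> fst c"])
    fix q assume q: "q \<in> U \<inter> fst c"
    show "g q (Y q) (Z q) = (\<Sum>j\<in>UNIV. \<Sum>k\<in>UNIV. ?y j q * ?z k q * ?G j k q)"
      using g_coord[OF c(1), of q "Y q" "Z q"] q vfield_in_tspace[OF Y] vfield_in_tspace[OF Z]
      by (simp add: gram_form_def)
  qed (use U c chart_open[OF c(1)] pM[OF c] in auto)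
  also have "\<dots> = (\<Sum>j\<in>UNIV. \<Sum>k\<in>UNIV. v (\<lambda>q. ?y j q * ?z k q * ?G j k q))"
    by (subst tspace_sum[OF v], intro smooth_near_sum smooth_near_mult y z G)
      (intro sum.cong refl tspace_sum[OF v] smooth_near_mult y z G)
  also have "\<dots> = (\<Sum>j\<in>UNIV. \<Sum>k\<in>UNIV. v (?y j) * ?z k p * ?G j k p + ?y j p * v (?z k) * ?G j k p
      + (\<Sum>i\<in>UNIV. v (coord c i) * ?y j p * ?z k p * dgram c p i j k))"
    by (intro sum.cong refl)
      (simp add: tspace_mult[OF v] smooth_near_mult y z G vG sum_distrib_left algebra_simps)
  also have "\<dots> = gram_form c p (\<lambda>j. v (?y j)) (\<lambda>k. ?z k p) + gram_form c p (\<lambda>j. ?y j p) (\<lambda>k. v (?z k))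
      + (\<Sum>j\<in>UNIV. \<Sum>k\<in>UNIV. \<Sum>i\<in>UNIV. v (coord c i) * ?y j p * ?z k p * dgram c p i j k)"
    by (simp add: gram_form_def sum.distrib)
  finally show ?thesis
    by (simp add: sum3_rotate[of "\<lambda>i j k. v (coord c i) * ?y j p * ?z k p * dgram c p i j k"])
qed

text \<open>The brackets cancel all derivatives of components except X(Y^j). So X and Z enter
  through their values at p alone, and Y through its value and the numbers X(Y^j), which are paired
  with Z by g; this is the source of all independence of extensions.\<close>

lemma dual_conn_coord:
  assumes c: "c \<in> \<A>" "p \<in> fst c" and U: "open U" "p \<in> U" "U \<subseteq> M"
    and X: "vfield_on \<A> U X" and Y: "vfield_on \<A> U Y" and Z: "vfield_on \<A> U Z"
  shows "dual_conn \<A> g X Y Z p =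
    gram_form c p (\<lambda>j. X p (\<lambda>q. Y q (coord c j))) (\<lambda>k. Z p (coord c k))
    + (\<Sum>k\<in>UNIV. Z p (coord c k) * (\<Sum>i\<in>UNIV. \<Sum>j\<in>UNIV. X p (coord c i) * Y p (coord c j) * christoffel c p i j k))"
proof -
  note T = vfield_in_tspace[OF _ U(2)]
  have d: "A p (\<lambda>q. g q (B q) (C q)) =
    gram_form c p (\<lambda>j. A p (\<lambda>q. B q (coord c j))) (\<lambda>k. C p (coord c k))
    + gram_form c p (\<lambda>j. B p (coord c j)) (\<lambda>k. A p (\<lambda>q. C q (coord c k)))
    + (\<Sum>i\<in>UNIV. \<Sum>j\<in>UNIV. \<Sum>k\<in>UNIV. A p (coord c i) * B p (coord c j) * C p (coord c k) * dgram c p i j k)"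
    if "vfield_on \<A> U A" "vfield_on \<A> U B" "vfield_on \<A> U C" for A B C
    by (rule tspace_g[OF c T[OF that(1)] U(1,2) that(2,3)])
  have l: "g p (lie \<A> A B p) (C p) = gram_form c p (\<lambda>j. A p (\<lambda>q. B q (coord c j))) (\<lambda>k. C p (coord c k))
      - gram_form c p (\<lambda>j. B p (\<lambda>q. A q (coord c j))) (\<lambda>k. C p (coord c k))"
    if "vfield_on \<A> U A" "vfield_on \<A> U B" "vfield_on \<A> U C" for A B C
    using g_coord[OF c T[OF vfield_lie[OF U(1,3) that(1,2)]] T[OF that(3)]]
    by (simp add: lie_eq[OF smooth_near_coord[OF c]] gram_form_diff_left[OF c])
  let ?x = "\<lambda>i. X p (coord c i)" and ?y = "\<lambda>i. Y p (coord c i)" and ?z = "\<lambda>i. Z p (coord c i)"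
  let ?S = "\<lambda>D. \<Sum>k\<in>UNIV. \<Sum>i\<in>UNIV. \<Sum>j\<in>UNIV. ?x i * ?y j * ?z k * D i j k"
  have 1: "(\<Sum>i\<in>UNIV. \<Sum>j\<in>UNIV. \<Sum>k\<in>UNIV. ?x i * ?y j * ?z k * dgram c p i j k) = ?S (dgram c p)"
    by (subst sum3_rotate, subst sum3_rotate) (rule refl)
  have 2: "(\<Sum>j\<in>UNIV. \<Sum>k\<in>UNIV. \<Sum>i\<in>UNIV. ?y j * ?z k * ?x i * dgram c p j k i) = ?S (\<lambda>i j k. dgram c p j k i)"
    by (subst sum3_rotate) (simp add: mult.commute mult.left_commute)
  have 3: "(\<Sum>k\<in>UNIV. \<Sum>i\<in>UNIV. \<Sum>j\<in>UNIV. ?z k * ?x i * ?y j * dgram c p k i j) = ?S (\<lambda>i j k. dgram c p k i j)"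
    by (simp add: mult.commute mult.left_commute)
  have 4: "(\<Sum>k\<in>UNIV. ?z k * (\<Sum>i\<in>UNIV. \<Sum>j\<in>UNIV. ?x i * ?y j * christoffel c p i j k))
      = (?S (dgram c p) + ?S (\<lambda>i j k. dgram c p j k i) - ?S (\<lambda>i j k. dgram c p k i j)) / 2"
    unfolding christoffel_def sum.distrib[symmetric] sum_subtractf[symmetric] sum_divide_distrib sum_distrib_left
    by (intro sum.cong refl) (simp add: algebra_simps diff_divide_distrib add_divide_distrib)
  show ?thesis
    unfolding dual_conn_def d[OF X Y Z] d[OF Y Z X] d[OF Z X Y] l[OF X Y Z] l[OF Y Z X] l[OF Z X Y] 1 2 3 4
    by (simp add: gram_form_sym[OF c, of "\<lambda>j. Y p (coord c j)"] gram_form_sym[OF c, of "\<lambda>j. Z p (coord c j)"]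
        gram_form_sym[OF c, of "\<lambda>j. X p (coord c j)"] field_simps)
qed

lemma dual_conn_smooth:
  assumes U: "open U" "U \<subseteq> M"
    and X: "vfield_on \<A> U X" and Y: "vfield_on \<A> U Y" and Z: "vfield_on \<A> U Z"
  shows "smooth_fun \<A> U (\<lambda>p. dual_conn \<A> g X Y Z p)"
proof -
  have d: "smooth_fun \<A> U (\<lambda>p. A p (\<lambda>q. g q (B q) (C q)))"
    if "vfield_on \<A> U A" "vfield_on \<A> U B" "vfield_on \<A> U C" for A B C
    by (rule vfield_smooth[OF that(1) U(1) order_refl g_smooth[OF U that(2,3)]])
  have l: "smooth_fun \<A> U (\<lambda>p. g p (lie \<A> A B p) (C p))"
    if "vfield_on \<A> U A" "vfield_on \<A> U B" "vfield_on \<A> U C" for A B C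
    by (rule g_smooth[OF U vfield_lie[OF U that(1,2)] that(3)])
  have "smooth_fun \<A> U (\<lambda>p. (X p (\<lambda>q. g q (Y q) (Z q)) + Y p (\<lambda>q. g q (Z q) (X q)) - Z p (\<lambda>q. g q (X q) (Y q))
      + g p (lie \<A> X Y p) (Z p) - g p (lie \<A> Y Z p) (X p) + g p (lie \<A> Z X p) (Y p)) * (1 / 2))"
    by (intro smooth_fun_mult smooth_fun_add smooth_fun_diff smooth_fun_const U d l X Y Z)
  then show ?thesis
    by (simp add: dual_conn_def)
qed

text \<open>All terms of the Koszul expression except the first are antisymmetric in Y and
  Z.\<close>

lemma dual_conn_metric:
  assumes U: "open U" "p \<in> U" "U \<subseteq> M"
    and X: "vfield_on \<A> U X" and Y: "vfield_on \<A> U Y" and Z: "vfield_on \<A> U Z"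
  shows "dual_conn \<A> g X Y Z p + dual_conn \<A> g X Z Y p = X p (\<lambda>q. g q (Y q) (Z q))"
proof -
  have p: "p \<in> M" using U by blast
  note T = vfield_in_tspace[OF _ U(2)]
  have s: "A p (\<lambda>q. g q (B q) (C q)) = A p (\<lambda>q. g q (C q) (B q))"
    if "vfield_on \<A> U A" "vfield_on \<A> U B" "vfield_on \<A> U C" for A B C
    by (rule tspace_local[OF T[OF that(1)] U(1,2) p])
      (intro g_sym vfield_in_tspace[OF that(2)] vfield_in_tspace[OF that(3)])
  have l: "g p (lie \<A> B A p) (C p) = - g p (lie \<A> A B p) (C p)"
    if "vfield_on \<A> U A" "vfield_on \<A> U B" "vfield_on \<A> U C" for A B C
  proof -
    have "lie \<A> B A p = (\<lambda>f. - 1 * lie \<A> A B p f)"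
      by (rule ext) (simp add: lie_anti[of B A])
    then show ?thesis
      using g_scale_left[OF p T[OF that(3)] T[OF vfield_lie[OF U(1,3) that(1,2)]], of "- 1"] by simp
  qed
  show ?thesis
    unfolding dual_conn_def
    using s[OF X Y Z] s[OF Y Z X] s[OF Z X Y] l[OF X Y Z] l[OF Y Z X] l[OF Z X Y] by (simp add: field_simps)
qed

section \<open>The Gram determinant and the singular set\<close>

lemma gram_det_eq: "gram_det \<A> g c p = det (\<chi> i j. gram c p i j)"
  by (simp add: gram_det_def gram_def)

lemma gram_det_smooth:
  assumes "c \<in> \<A>"
  shows "smooth_fun \<A> (fst c) (gram_det \<A> g c)"
  unfolding gram_det_eq[abs_def] det_def
  by (auto intro!: smooth_fun_sum smooth_fun_mult smooth_fun_const smooth_fun_prod gram_smooth chart_open assms)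

abbreviation "\<Sigma> \<equiv> sing \<A> g"

text \<open>In components the radical is the kernel of the Gram matrix. This makes the determinant a
  defining function of \<Sigma> on the whole chart domain.\<close>

lemma sing_iff:
  assumes c: "c \<in> \<A>" "p \<in> fst c"
  shows "p \<in> \<Sigma> \<longleftrightarrow> gram_det \<A> g c p = 0"
proof -
  let ?G = "(\<chi> i j. gram c p i j) :: real ^ 'm ^ 'm"
  have rad: "v \<in> radical \<A> g p \<longleftrightarrow> ?G *v (\<chi> i. v (coord c i)) = 0" if v: "v \<in> tspace \<A> p" for v
  proof
    assume "v \<in> radical \<A> g p"
    then have "g p (coord_vec \<A> c k p) v = 0" for k
      using g_sym[OF pM[OF c] coord_vec_in_tspace[OF c] v] coord_vec_in_tspace[OF c] by (simp add: radical_def)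
    then show "?G *v (\<chi> i. v (coord c i)) = 0"
      by (simp add: vec_eq_iff matrix_vector_mult_def g_coord_vec[OF c v])
  next
    assume "?G *v (\<chi> i. v (coord c i)) = 0"
    then have 0: "(\<Sum>l\<in>UNIV. gram c p k l * v (coord c l)) = 0" for k
      by (simp add: vec_eq_iff matrix_vector_mult_def)
    have "g p v w = 0" if w: "w \<in> tspace \<A> p" for w
    proof -
      have "g p v w = g p w v"
        by (rule g_sym[OF pM[OF c] v w])
      also have "\<dots> = (\<Sum>j\<in>UNIV. w (coord c j) * (\<Sum>l\<in>UNIV. gram c p j l * v (coord c l)))"
        unfolding g_coord[OF c w v] gram_form_def sum_distrib_left by (intro sum.cong refl) simp
      finally show ?thesis
        by (simp add: 0)
    qed
    then show "v \<in> radical \<A> g p"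
      using v by (simp add: radical_def)
  qed
  have zero: "(\<lambda>f. 0) \<in> radical \<A> g p"
    using rad[OF tspace_zero] by (simp add: vec_eq_iff matrix_vector_mult_def)
  have "p \<in> \<Sigma> \<longleftrightarrow> (\<exists>v. v \<in> radical \<A> g p \<and> v \<noteq> (\<lambda>f. 0))"
    using pM[OF c] zero by (auto simp: sing_def)
  also have "\<dots> \<longleftrightarrow> (\<exists>a. ?G *v a = 0 \<and> a \<noteq> 0)"
  proof
    assume "\<exists>v. v \<in> radical \<A> g p \<and> v \<noteq> (\<lambda>f. 0)"
    then obtain v where v: "v \<in> radical \<A> g p" "v \<noteq> (\<lambda>f. 0)" "v \<in> tspace \<A> p"
      by (auto simp: radical_def)
    have "(\<chi> i. v (coord c i)) \<noteq> 0"
    proof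
      assume "(\<chi> i. v (coord c i)) = 0"
      then have "v = (\<lambda>f. 0)"
        by (intro tspace_eq[OF c v(3) tspace_zero]) (simp add: vec_eq_iff)
      then show False
        using v(2) by simp
    qed
    then show "\<exists>a. ?G *v a = 0 \<and> a \<noteq> 0"
      using rad[OF v(3)] v(1) by blast
  next
    assume "\<exists>a. ?G *v a = 0 \<and> a \<noteq> 0"
    then obtain a where a: "?G *v a = 0" "a \<noteq> 0"
      by blast
    have comp: "(\<chi> i. coord_comb c p a (coord c i)) = a"
      by (simp add: vec_eq_iff coord_comb_coord[OF c])
    then have "coord_comb c p a \<in> radical \<A> g p"
      using rad[OF coord_comb_in_tspace[OF c]] a by simp
    moreover have "coord_comb c p a \<noteq> (\<lambda>f. 0)"
    proof
      assume "coord_comb c p a = (\<lambda>f. 0)"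
      then have "a = 0"
        using comp by (simp add: vec_eq_iff)
      then show False
        using a(2) by simp
    qed
    ultimately show "\<exists>v. v \<in> radical \<A> g p \<and> v \<noteq> (\<lambda>f. 0)"
      by blast
  qed
  also have "\<dots> \<longleftrightarrow> \<not> invertible ?G"
    unfolding invertible_left_inverse matrix_left_invertible_ker by blast
  also have "\<dots> \<longleftrightarrow> det ?G = 0"
    by (simp add: invertible_det_nz)
  finally show ?thesis
    by (simp add: gram_det_eq)
qed

lemma open_minus_sing: "open (M - \<Sigma>)"
proof -
  have "M - \<Sigma> = (\<Union>c\<in>\<A>. fst c \<inter> gram_det \<A> g c -` (- {0}))"
    using sing_iff by (auto simp: mcarrier_def) 
  moreover have "open (fst c \<inter> gram_det \<A> g c -` (- {0}))" if c: "c \<in> \<A>" for c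
  proof (rule continuous_open_preimage[OF _ chart_open(1)[OF c]])
    show "continuous_on (fst c) (gram_det \<A> g c)"
      by (intro continuous_at_imp_continuous_on ballI smooth_fun_isCont[OF chart_open(1)[OF c] _ _ gram_det_smooth[OF c]])
        (use chart_subset[OF c] in auto)
  qed auto
  ultimately show ?thesis
    by auto
qed

lemma tspace_sub_in: "v \<in> tspace_sub \<A> S p \<Longrightarrow> v \<in> tspace \<A> p"
  by (simp add: tspace_sub_def)

text \<open>Tangency is tested on functions vanishing on all of S. Replacing f by 0 outside U makes
  it such a function without changing its germ at p.\<close>

lemma tspace_sub_zero:
  assumes v: "v \<in> tspace_sub \<A> S p" and U: "open U" "p \<in> U" "p \<in> M" and f: "\<And>q. q \<in> U \<inter> S \<Longrightarrow> f q = 0"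
  shows "v f = 0"
proof (cases "smooth_near \<A> p f")
  case True
  let ?f = "\<lambda>q. if q \<in> U then f q else 0"
  have "v f = v ?f"
    by (rule tspace_local[OF tspace_sub_in[OF v] U]) simp
  moreover have "smooth_near \<A> p ?f"
    by (rule smooth_near_eq[OF True U(1,2)]) simp
  ultimately show ?thesis
    using v f by (auto simp: tspace_sub_def)
next
  case False
  then show ?thesis
    using tspace_not_smooth[OF tspace_sub_in[OF v]] by blast
qed

text \<open>By the coordinate formula two choices of extensions differ only in the numbers X(Y^j),
  paired with Z. The pairing vanishes if Z is radical at p; if X is tangent at p, the numbers agree,
  since two extensions of B differ by components vanishing on \<Sigma>. So the definite description
  denotes.\<close>

lemma dual_conn_along_eq:
  assumes p: "p \<in> \<Sigma>" and U: "p \<in> U"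
    and X: "extends_on \<A> \<Sigma> U X A" and Y: "extends_on \<A> \<Sigma> U Y B" and Z: "extends_on \<A> \<Sigma> U Z C"
    and well: "C p \<in> radical \<A> g p \<or> A p \<in> tspace_sub \<A> \<Sigma> p"
  shows "dual_conn_along \<A> g A B C p = dual_conn \<A> g X Y Z p"
  unfolding dual_conn_along_def
proof (rule the_equality)
  have pM: "p \<in> M"
    using p by (simp add: sing_def)
  then obtain c where c: "c \<in> \<A>" "p \<in> fst c"
    using in_chart by blast
  have eq: "dual_conn \<A> g X' Y' Z' p = dual_conn \<A> g X Y Z p"
    if U': "p \<in> U'" and X': "extends_on \<A> \<Sigma> U' X' A" and Y': "extends_on \<A> \<Sigma> U' Y' B"
      and Z': "extends_on \<A> \<Sigma> U' Z' C" for U' X' Y' Z'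
  proof -
    let ?U = "U \<inter> U'"
    have U2: "open ?U" "p \<in> ?U" "?U \<subseteq> M"
      using X X' U U' by (auto simp: extends_on_def)
    have v: "vfield_on \<A> ?U X" "vfield_on \<A> ?U Y" "vfield_on \<A> ?U Z"
      "vfield_on \<A> ?U X'" "vfield_on \<A> ?U Y'" "vfield_on \<A> ?U Z'"
      using X Y Z X' Y' Z' unfolding extends_on_def by (auto elim!: vfield_subset)
    have val: "X p = A p" "X' p = A p" "Y p = B p" "Y' p = B p" "Z p = C p" "Z' p = C p"
      using X Y Z X' Y' Z' p U U' by (auto simp: extends_on_def)
    have sm: "smooth_near \<A> p (\<lambda>q. Y q (coord c j))" "smooth_near \<A> p (\<lambda>q. Y' q (coord c j))" for j
      using vfield_smooth_near[OF v(2) U2(1,2) smooth_near_coord[OF c]]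
        vfield_smooth_near[OF v(5) U2(1,2) smooth_near_coord[OF c]] .
    have "gram_form c p (\<lambda>j. A p (\<lambda>q. Y' q (coord c j))) (\<lambda>k. C p (coord c k))
        = gram_form c p (\<lambda>j. A p (\<lambda>q. Y q (coord c j))) (\<lambda>k. C p (coord c k))"
      using well
    proof
      assume C: "C p \<in> radical \<A> g p"
      show ?thesis
        by (simp add: gram_form_radical[OF c C])
    next
      assume A: "A p \<in> tspace_sub \<A> \<Sigma> p"
      have "A p (\<lambda>q. Y' q (coord c j)) = A p (\<lambda>q. Y q (coord c j))" for j
      proof -
        have "A p (\<lambda>q. Y' q (coord c j) - Y q (coord c j)) = 0"
          by (rule tspace_sub_zero[OF A U2(1,2) pM]) (use Y Y' in \<open>auto simp: extends_on_def\<close>)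
        then show ?thesis
          using tspace_diff[OF tspace_sub_in[OF A] sm(2,1)] by simp
      qed
      then show ?thesis
        by simp
    qed
    then show ?thesis
      by (simp add: dual_conn_coord[OF c U2 v(1-3)] dual_conn_coord[OF c U2 v(4-6)] val)
  qed
  then show "\<forall>U' X' Y' Z'. p \<in> U' \<and> extends_on \<A> \<Sigma> U' X' A \<and> extends_on \<A> \<Sigma> U' Y' B \<and> extends_on \<A> \<Sigma> U' Z' C
      \<longrightarrow> dual_conn \<A> g X' Y' Z' p = dual_conn \<A> g X Y Z p"
    by blast
  fix r assume "\<forall>U X Y Z. p \<in> U \<and> extends_on \<A> \<Sigma> U X A \<and> extends_on \<A> \<Sigma> U Y B \<and> extends_on \<A> \<Sigma> U Z C
      \<longrightarrow> dual_conn \<A> g X Y Z p = r"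
  then show "r = dual_conn \<A> g X Y Z p"
    using U X Y Z by blast
qed

lemma extends_on_subset:
  "extends_on \<A> S U X A \<Longrightarrow> open V \<Longrightarrow> V \<subseteq> U \<Longrightarrow> extends_on \<A> S V X A"
  unfolding extends_on_def by (auto elim: vfield_subset)

end

section \<open>Limits at the singular hypersurface\<close>

lemma tendsto_det:
  fixes A :: "'b \<Rightarrow> real ^ 'n ^ 'n"
  assumes "\<And>i j. ((\<lambda>t. A t $ i $ j) \<longlongrightarrow> A0 $ i $ j) F"
  shows "((\<lambda>t. det (A t)) \<longlongrightarrow> det A0) F"
  unfolding det_def by (intro tendsto_sum tendsto_mult tendsto_const tendsto_prod assms)

text \<open>Although \<open>P\<close> blows up where \<open>G\<close> degenerates, \<open>x = t P\<close> solves the full-rank system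
  \<open>G x = t \<alpha>\<close>, \<open>\<rho> \<bullet> x = r \<bullet> \<alpha>\<close> with \<open>\<rho> = G r / t\<close>, hence converges.\<close>

lemma degenerate_limit:
  fixes G :: "real \<Rightarrow> real ^ 'n ^ 'n" and r \<alpha> \<beta> P :: "real \<Rightarrow> real ^ 'n"
  assumes G: "\<And>i j. ((\<lambda>t. G t $ i $ j) \<longlongrightarrow> G0 $ i $ j) (at 0)"
    and sym: "\<forall>\<^sub>F t in at 0. transpose (G t) = G t"
    and r: "(r \<longlongrightarrow> r0) (at 0)" and \<alpha>: "(\<alpha> \<longlongrightarrow> \<alpha>0) (at 0)" and \<beta>: "(\<beta> \<longlongrightarrow> \<beta>0) (at 0)"
    and \<rho>: "((\<lambda>t. (1 / t) *\<^sub>R (G t *v r t)) \<longlongrightarrow> \<rho>0) (at 0)"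
    and \<tau>: "\<forall>\<^sub>F t in at 0. \<tau> t = r t \<bullet> (G t *v r t)" "((\<lambda>t. \<tau> t / t) \<longlongrightarrow> \<kappa>) (at 0)" "\<kappa> \<noteq> 0"
    and ker: "G0 *v r0 = 0" "\<And>x. G0 *v x = 0 \<Longrightarrow> \<exists>l. x = l *\<^sub>R r0"
    and P: "\<forall>\<^sub>F t in at 0. G t *v P t = \<alpha> t"
  shows "((\<lambda>t. \<tau> t * (P t \<bullet> \<beta> t)) \<longlongrightarrow> (r0 \<bullet> \<alpha>0) * (r0 \<bullet> \<beta>0)) (at 0)"
proof -
  define rh where "rh = (\<lambda>t. (1 / t) *\<^sub>R (G t *v r t))"
  have rh: "(rh \<longlongrightarrow> \<rho>0) (at 0)"
    using \<rho> unfolding rh_def .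
  have nz: "\<forall>\<^sub>F t :: real in at 0. t \<noteq> 0"
    by (simp add: eventually_at_filter)
  have "((\<lambda>t. r t \<bullet> rh t) \<longlongrightarrow> r0 \<bullet> \<rho>0) (at 0)"
    by (intro tendsto_inner r rh)
  moreover have "((\<lambda>t. r t \<bullet> rh t) \<longlongrightarrow> \<kappa>) (at 0)"
    by (rule Lim_transform_eventually[OF \<tau>(2)]) (use \<tau>(1) in eventually_elim, simp add: rh_def)
  ultimately have \<kappa>: "r0 \<bullet> \<rho>0 = \<kappa>"
    using tendsto_unique[OF trivial_limit_at] by blast
  \<comment> \<open>The overdetermined system is replaced by its normal equations, with matrix K =
    G^T G + \<rho> \<rho>^T. At t = 0 the kernel of K consists of the x in ker G0 with \<rho>0
    \<bullet> x = 0; these are multiples of r0, and r0 \<bullet> \<rho>0 = \<kappa> is nonzero, so K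
    stays invertible.\<close>
  define K where "K = (\<lambda>(A :: real ^ 'n ^ 'n) (u :: real ^ 'n).
      (\<chi> i j. (\<Sum>l\<in>UNIV. A $ l $ i * A $ l $ j) + u $ i * u $ j) :: real ^ 'n ^ 'n)"
  have K: "K A u *v x = transpose A *v (A *v x) + (u \<bullet> x) *\<^sub>R u" for A u x
  proof -
    have "(\<Sum>j\<in>UNIV. (\<Sum>l\<in>UNIV. A $ l $ i * A $ l $ j) * x $ j)
        = (\<Sum>l\<in>UNIV. A $ l $ i * (\<Sum>j\<in>UNIV. A $ l $ j * x $ j))" for i
      unfolding sum_distrib_left sum_distrib_right by (subst sum.swap) (simp add: mult.assoc)
    moreover have "(\<Sum>j\<in>UNIV. u $ i * u $ j * x $ j) = (u \<bullet> x) * u $ i" for i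
      by (simp add: inner_vec_def sum_distrib_left sum_distrib_right mult_ac)
    ultimately show ?thesis
      by (simp add: vec_eq_iff K_def matrix_vector_mult_def transpose_def distrib_right sum.distrib)
  qed
  have tr: "u \<bullet> (transpose A *v x) = (A *v u) \<bullet> x" for A :: "real ^ 'n ^ 'n" and u x
    by (simp only: dot_lmul_matrix[symmetric] vector_transpose_matrix)
  let ?K0 = "K G0 \<rho>0"
  have "x = 0" if x: "?K0 *v x = 0" for x
  proof -
    have "x \<bullet> (?K0 *v x) = (G0 *v x) \<bullet> (G0 *v x) + (\<rho>0 \<bullet> x) * (\<rho>0 \<bullet> x)"
      unfolding K inner_add_right tr inner_scaleR_right inner_commute[of x \<rho>0] ..
    then have "(G0 *v x) \<bullet> (G0 *v x) + (\<rho>0 \<bullet> x) * (\<rho>0 \<bullet> x) = 0"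
      using x by simp
    then have 0: "G0 *v x = 0" "\<rho>0 \<bullet> x = 0"
      using inner_ge_zero[of "G0 *v x"] zero_le_square[of "\<rho>0 \<bullet> x"]
      by (simp_all add: add_nonneg_eq_0_iff)
    then obtain l where "x = l *\<^sub>R r0"
      using ker(2) by blast
    then show "x = 0"
      using 0(2) \<kappa> \<tau>(3) by (simp add: inner_commute)
  qed
  then have "invertible ?K0"
    unfolding invertible_left_inverse matrix_left_invertible_ker by blast
  then have dK0: "det ?K0 \<noteq> 0"
    by (simp add: invertible_det_nz)
  define Kt where "Kt = (\<lambda>t. K (G t) (rh t))"
  \<comment> \<open>Right-hand side of the normal equations; \<rho> \<bullet> x = r \<bullet>
    \<alpha> holds by symmetry of G, since \<rho> \<bullet> t P = G r \<bullet> P = r \<bullet> G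
    P.\<close>
  define y where "y = (\<lambda>t. transpose (G t) *v (t *\<^sub>R \<alpha> t) + (r t \<bullet> \<alpha> t) *\<^sub>R rh t)"
  \<comment> \<open>In the limit G0 x = 0 makes x a multiple of r0, and \<rho>0 \<bullet> x = r0
    \<bullet> \<alpha>0 with r0 \<bullet> \<rho>0 = \<kappa> fixes the factor.\<close>
  let ?x0 = "((r0 \<bullet> \<alpha>0) / \<kappa>) *\<^sub>R r0"
  let ?y0 = "(r0 \<bullet> \<alpha>0) *\<^sub>R \<rho>0"
  have Kt: "((\<lambda>t. Kt t $ i $ j) \<longlongrightarrow> ?K0 $ i $ j) (at 0)" for i j
    unfolding Kt_def K_def vec_lambda_beta
    by (intro tendsto_add tendsto_sum tendsto_mult G tendsto_vec_nth rh)
  have y: "((\<lambda>t. y t $ i) \<longlongrightarrow> ?y0 $ i) (at 0)" for i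
  proof -
    have "((\<lambda>t. (\<Sum>j\<in>UNIV. G t $ j $ i * (t * \<alpha> t $ j)) + (r t \<bullet> \<alpha> t) * rh t $ i)
        \<longlongrightarrow> (\<Sum>j\<in>UNIV. G0 $ j $ i * (0 * \<alpha>0 $ j)) + (r0 \<bullet> \<alpha>0) * \<rho>0 $ i) (at 0)"
      by (intro tendsto_add tendsto_sum tendsto_mult G tendsto_vec_nth rh tendsto_inner r \<alpha> tendsto_ident_at)
    then show ?thesis
      by (simp add: y_def matrix_vector_mult_def transpose_def)
  qed
  have x: "\<forall>\<^sub>F t in at 0. Kt t *v (t *\<^sub>R P t) = y t"
    using P sym nz
  proof eventually_elim
    case (elim t)
    have "rh t \<bullet> (t *\<^sub>R P t) = (G t *v r t) \<bullet> P t"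
      using elim by (simp add: rh_def)
    also have "\<dots> = r t \<bullet> (transpose (G t) *v P t)"
      by (rule tr[symmetric])
    finally have rP: "rh t \<bullet> (t *\<^sub>R P t) = r t \<bullet> \<alpha> t"
      using elim by simp
    have GP: "G t *v (t *\<^sub>R P t) = t *\<^sub>R \<alpha> t"
      using elim by (simp add: matrix_vector_mult_scaleR)
    show ?case
      unfolding Kt_def K GP rP y_def ..
  qed
  have dK: "((\<lambda>t. det (Kt t)) \<longlongrightarrow> det ?K0) (at 0)"
    by (rule tendsto_det[OF Kt])
  have dKnz: "\<forall>\<^sub>F t in at 0. det (Kt t) \<noteq> 0"
    using tendsto_imp_eventually_ne[OF dK dK0] .
  have "?K0 *v ?x0 = ?y0"
    using \<kappa> \<tau>(3) by (simp add: K matrix_vector_mult_scaleR ker(1) inner_commute)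
  then have x0: "?x0 = (\<chi> k. det (\<chi> i j. if j = k then ?y0 $ i else ?K0 $ i $ j) / det ?K0)"
    using cramer[OF dK0] by blast
  \<comment> \<open>Cramer's rule writes the entries of t P as quotients of determinants, whose
    convergence is entrywise.\<close>
  have "((\<lambda>t. (t *\<^sub>R P t) $ k) \<longlongrightarrow> ?x0 $ k) (at 0)" for k
  proof -
    have "((\<lambda>t. det (\<chi> i j. if j = k then y t $ i else Kt t $ i $ j) / det (Kt t))
        \<longlongrightarrow> det (\<chi> i j. if j = k then ?y0 $ i else ?K0 $ i $ j) / det ?K0) (at 0)"
    proof (intro tendsto_divide dK dK0 tendsto_det)
      show "((\<lambda>t. (\<chi> i j. if j = k then y t $ i else Kt t $ i $ j) $ i $ j)
          \<longlongrightarrow> (\<chi> i j. if j = k then ?y0 $ i else ?K0 $ i $ j) $ i $ j) (at 0)" for i j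
        using y Kt by (cases "j = k") (simp_all only: vec_lambda_beta simp_thms if_True if_False)
    qed
    moreover have "\<forall>\<^sub>F t in at 0. det (\<chi> i j. if j = k then y t $ i else Kt t $ i $ j) / det (Kt t)
        = (t *\<^sub>R P t) $ k"
      using x dKnz
    proof eventually_elim
      case (elim t)
      have "t *\<^sub>R P t = (\<chi> k. det (\<chi> i j. if j = k then y t $ i else Kt t $ i $ j) / det (Kt t))"
        using cramer[OF elim(2)] elim(1) by blast
      then show ?case
        by (simp add: vec_eq_iff)
    qed
    ultimately show ?thesis
      unfolding x0 vec_lambda_beta by (rule Lim_transform_eventually)
  qed
  then have xlim: "((\<lambda>t. t *\<^sub>R P t) \<longlongrightarrow> ?x0) (at 0)"
    by (rule vec_tendstoI)
  have "((\<lambda>t. \<tau> t / t * ((t *\<^sub>R P t) \<bullet> \<beta> t)) \<longlongrightarrow> \<kappa> * (?x0 \<bullet> \<beta>0)) (at 0)"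
    by (intro tendsto_mult tendsto_inner \<tau>(2) xlim \<beta>)
  moreover have "\<forall>\<^sub>F t in at 0. \<tau> t / t * ((t *\<^sub>R P t) \<bullet> \<beta> t) = \<tau> t * (P t \<bullet> \<beta> t)"
    using nz by eventually_elim simp
  ultimately have "((\<lambda>t. \<tau> t * (P t \<bullet> \<beta> t)) \<longlongrightarrow> \<kappa> * (?x0 \<bullet> \<beta>0)) (at 0)"
    by (rule Lim_transform_eventually)
  then show ?thesis
    using \<tau>(3) by simp
qed

section \<open>The main normal, the main radical field and II on \<Sigma>\<close>

locale singular_mfd = metric_mfd \<A> g
  for \<A> :: "('a::t2_space, 'm::finite) chart set" and g :: "'a form2" +
  fixes nabla :: "'a vfield \<Rightarrow> 'a vfield \<Rightarrow> 'a vfield" and N R NN RR :: "'a vfield" and W :: "'a set"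
  assumes transverse: "transverse_singular \<A> g"
    and levi_civita: "levi_civita \<A> g (mcarrier \<A> - sing \<A> g) nabla"
    and main_normal: "main_normal \<A> g N" and main_radical: "main_radical \<A> g N R"
    and sing_W: "sing \<A> g \<subseteq> W"
    and NN: "extends_on \<A> (sing \<A> g) W NN N" and RR: "extends_on \<A> (sing \<A> g) W RR R"
begin

lemma W: "open W" "W \<subseteq> M" and NN_vf: "vfield_on \<A> W NN" and RR_vf: "vfield_on \<A> W RR"
  and NN_eq: "p \<in> \<Sigma> \<Longrightarrow> NN p = N p" and RR_eq: "p \<in> \<Sigma> \<Longrightarrow> RR p = R p"
  using NN RR sing_W by (auto simp: extends_on_def)

lemma sing_M: "p \<in> \<Sigma> \<Longrightarrow> p \<in> M"
  by (simp add: sing_def)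

lemma R_radical: "p \<in> \<Sigma> \<Longrightarrow> R p \<in> radical \<A> g p"
  using main_radical by (simp add: main_radical_def radical_field_def)

lemma R_tangent: "p \<in> \<Sigma> \<Longrightarrow> R p \<in> tspace_sub \<A> \<Sigma> p"
  using main_radical by (simp add: main_radical_def vfield_tangent_def)

lemma R_tspace: "p \<in> \<Sigma> \<Longrightarrow> R p \<in> tspace \<A> p"
  using R_radical by (simp add: radical_def)

lemma N_tspace: "p \<in> \<Sigma> \<Longrightarrow> N p \<in> tspace \<A> p"
  using vfield_in_tspace[OF NN_vf] NN_eq sing_W by fastforce

lemma g_N_N: "p \<in> \<Sigma> \<Longrightarrow> g p (N p) (N p) = 1"
  and g_N_tangent: "p \<in> \<Sigma> \<Longrightarrow> v \<in> tspace_sub \<A> \<Sigma> p \<Longrightarrow> g p (N p) v = 0"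
  using main_normal by (simp_all add: main_normal_def)

lemma g_R: "p \<in> \<Sigma> \<Longrightarrow> v \<in> tspace \<A> p \<Longrightarrow> g p (R p) v = 0"
  using R_radical by (simp add: radical_def)

text \<open>\<open>II\<close> with respect to \<open>R\<close>, as a bilinear form on all of \<open>T\<^sub>pM\<close> in the chart \<open>c\<close>. The term of
  \<open>\<box>\<^sub>X Y(Z)\<close> that differentiates \<open>Y\<close> is \<open>g\<close>-paired with \<open>Z\<close>, hence drops out where \<open>Z\<close> is radical. On \<open>\<Sigma>\<close> the
  invariants of the singular metric are all read off this form: \<open>\<rho> = II(\<cdot>, N)\<close> and \<open>\<H>(\<cdot>, R) = - II(\<cdot>, N)\<close>.\<close>

definition II_form :: "('a, 'm) chart \<Rightarrow> 'a \<Rightarrow> 'a tvec \<Rightarrow> 'a tvec \<Rightarrow> real" where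
  "II_form c p v w = (\<Sum>k\<in>UNIV. R p (coord c k) *
     (\<Sum>i\<in>UNIV. \<Sum>j\<in>UNIV. v (coord c i) * w (coord c j) * christoffel c p i j k))"

definition tau :: "'a \<Rightarrow> real" where
  "tau q = g q (RR q) (RR q)"

lemma tau_smooth: "smooth_fun \<A> W tau"
  unfolding tau_def[abs_def] by (rule g_smooth[OF W RR_vf RR_vf])

lemma tau_sing: "p \<in> \<Sigma> \<Longrightarrow> tau p = 0"
  by (simp add: tau_def RR_eq g_R R_tspace)

context
  fixes c :: "('a, 'm) chart" and p :: 'a
  assumes c: "c \<in> \<A>" "p \<in> fst c" and p: "p \<in> \<Sigma>"
begin

lemma pW: "p \<in> W"
  using p sing_W by blast

lemma II_form_add_left: "II_form c p (\<lambda>f. v f + w f) u = II_form c p v u + II_form c p w u"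
  by (simp add: II_form_def algebra_simps sum.distrib)

lemma II_form_scale_left: "II_form c p (\<lambda>f. a * v f) u = a * II_form c p v u"
  by (simp add: II_form_def mult.assoc mult.left_commute flip: sum_distrib_left)

lemma dgram_sym: "dgram c p i j k = dgram c p i k j"
  unfolding dgram_def
  by (rule tspace_local[OF coord_vec_in_tspace[OF c] chart_open(1)[OF c(1)] c(2) sing_M[OF p]])
    (rule gram_sym[OF c(1)])

lemma II_form_sym: "II_form c p v w = II_form c p w v"
proof -
  have "christoffel c p i j k = christoffel c p j i k" for i j k
    unfolding christoffel_def using dgram_sym[of i j k] dgram_sym[of j k i] dgram_sym[of k i j] by simp
  then have "(\<Sum>i\<in>UNIV. \<Sum>j\<in>UNIV. v (coord c i) * w (coord c j) * christoffel c p i j k)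
      = (\<Sum>i\<in>UNIV. \<Sum>j\<in>UNIV. w (coord c i) * v (coord c j) * christoffel c p i j k)" for k
    by (subst sum.swap) (simp add: mult.commute)
  then show ?thesis
    by (simp add: II_form_def)
qed

lemma II_form_add_right: "II_form c p u (\<lambda>f. v f + w f) = II_form c p u v + II_form c p u w"
  using II_form_add_left II_form_sym by metis

lemma II_form_scale_right: "II_form c p u (\<lambda>f. a * v f) = a * II_form c p u v"
  using II_form_scale_left II_form_sym by metis

lemma dual_conn_II_form:
  assumes U: "open U" "p \<in> U" "U \<subseteq> M"
    and X: "vfield_on \<A> U X" and Y: "vfield_on \<A> U Y" and Z: "vfield_on \<A> U Z" and "Z p = R p"
  shows "dual_conn \<A> g X Y Z p = II_form c p (X p) (Y p)"
  unfolding dual_conn_coord[OF c U X Y Z] \<open>Z p = R p\<close> gram_form_radical[OF c R_radical[OF p]] II_form_def by simp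

lemma II_eq:
  assumes A: "extends_on \<A> \<Sigma> U X A" and B: "extends_on \<A> \<Sigma> U Y B" and "p \<in> U"
  shows "II \<A> g R A B p = II_form c p (A p) (B p)"
proof -
  let ?U = "U \<inter> W"
  have U: "open ?U" "p \<in> ?U" "?U \<subseteq> M"
    using A W \<open>p \<in> U\<close> pW by (auto simp: extends_on_def)
  note e = extends_on_subset[OF A U(1)] extends_on_subset[OF B U(1)] extends_on_subset[OF RR U(1)]
  have "II \<A> g R A B p = dual_conn \<A> g X Y RR p"
    unfolding II_def by (rule dual_conn_along_eq[OF p U(2) e]) (use R_radical[OF p] in auto)
  also have "\<dots> = II_form c p (X p) (Y p)"
    by (rule dual_conn_II_form[OF U]) (use e RR_eq[OF p] in \<open>auto simp: extends_on_def\<close>)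
  finally show ?thesis
    using A B p \<open>p \<in> U\<close> by (simp add: extends_on_def)
qed

text \<open>Since A is tangent and <R,N> = 0 along \<Sigma>, the left side of the metric identity
  A<R,N> = \<box>_A R(N) + \<box>_A N(R) vanishes, and the last term is II(A,N).\<close>

lemma HH_eq:
  assumes A: "extends_on \<A> \<Sigma> U X A" and "p \<in> U" and t: "A p \<in> tspace_sub \<A> \<Sigma> p"
  shows "HH \<A> g N A R p = - II_form c p (A p) (N p)"
proof -
  let ?U = "U \<inter> W"
  have U: "open ?U" "p \<in> ?U" "?U \<subseteq> M"
    using A W \<open>p \<in> U\<close> pW by (auto simp: extends_on_def)
  note e = extends_on_subset[OF A U(1)] extends_on_subset[OF RR U(1)] extends_on_subset[OF NN U(1)]
  have Xp: "X p = A p"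
    using A p \<open>p \<in> U\<close> by (simp add: extends_on_def)
  have v: "vfield_on \<A> ?U X" "vfield_on \<A> ?U RR" "vfield_on \<A> ?U NN"
    using e by (auto simp: extends_on_def)
  have "HH \<A> g N A R p = dual_conn \<A> g X RR NN p"
    unfolding HH_def by (rule dual_conn_along_eq[OF p U(2) e]) (use t in auto)
  also have "\<dots> = X p (\<lambda>q. g q (RR q) (NN q)) - dual_conn \<A> g X NN RR p"
    using dual_conn_metric[OF U v] by simp
  also have "X p (\<lambda>q. g q (RR q) (NN q)) = 0"
    unfolding Xp by (rule tspace_sub_zero[OF t U(1,2) sing_M[OF p]])
      (simp add: RR_eq NN_eq g_R N_tspace)
  also have "dual_conn \<A> g X NN RR p = II_form c p (X p) (NN p)"
    by (rule dual_conn_II_form[OF U v(1,3,2) RR_eq[OF p]])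
  finally show ?thesis
    by (simp add: Xp NN_eq[OF p])
qed

lemma II_form_N_N: "II_form c p (N p) (N p) = 0"
  using II_eq[OF NN NN pW] main_normal main_radical p by (simp add: main_normal_def main_radical_def)

lemma II_form_R_N: "II_form c p (R p) (N p) = 1"
  using HH_eq[OF RR pW R_tangent[OF p]] main_radical p by (simp add: main_radical_def)

text \<open>Derivatives of the components of \<open>RR\<close> are paired with the radical vector R
  p and disappear; only v(g_jk) R^j R^k remains. In twice the Christoffel contraction the other two
  terms cancel after exchanging the two R-indices.\<close>

lemma tau_deriv:
  assumes v: "v \<in> tspace \<A> p"
  shows "v tau = 2 * II_form c p v (R p)"
proof -
  let ?r = "\<lambda>i. R p (coord c i)"
  have S: "(\<Sum>i\<in>UNIV. \<Sum>j\<in>UNIV. \<Sum>k\<in>UNIV. v (coord c i) * ?r j * ?r k * dgram c p i j k)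
      = 2 * II_form c p v (R p)"
  proof -
    let ?D = "\<lambda>F. \<Sum>k\<in>UNIV. \<Sum>i\<in>UNIV. \<Sum>j\<in>UNIV. ?r k * (v (coord c i) * ?r j * F i j k)"
    have 1: "?D (\<lambda>i j k. dgram c p j k i) = ?D (\<lambda>i j k. dgram c p k i j)"
    proof -
      have "?D (\<lambda>i j k. dgram c p j k i) = (\<Sum>j\<in>UNIV. \<Sum>i\<in>UNIV. \<Sum>k\<in>UNIV. ?r k * (v (coord c i) * ?r j * dgram c p j k i))"
        by (subst sum3_rotate, subst sum3_rotate, rule sum.cong, rule refl, rule sum.swap)
      also have "\<dots> = ?D (\<lambda>i j k. dgram c p k i j)"
        by (simp add: dgram_sym mult.commute mult.left_commute)
      finally show ?thesis .
    qed
    have "2 * II_form c p v (R p) = ?D (dgram c p) + ?D (\<lambda>i j k. dgram c p j k i) - ?D (\<lambda>i j k. dgram c p k i j)"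
      unfolding II_form_def christoffel_def sum.distrib[symmetric] sum_subtractf[symmetric] sum_distrib_left
      by (intro sum.cong refl) (simp add: algebra_simps diff_divide_distrib add_divide_distrib)
    also have "\<dots> = ?D (dgram c p)"
      using 1 by simp
    also have "\<dots> = (\<Sum>i\<in>UNIV. \<Sum>j\<in>UNIV. \<Sum>k\<in>UNIV. ?r k * (v (coord c i) * ?r j * dgram c p i j k))"
      by (rule sum3_rotate)
    finally show ?thesis
      by (simp add: mult.commute mult.left_commute)
  qed
  show ?thesis
    unfolding tau_def[abs_def] tspace_g[OF c v W(1) pW RR_vf RR_vf] RR_eq[OF p] S
    by (simp add: gram_form_radical[OF c R_radical[OF p]] gram_form_sym[OF c, of "\<lambda>j. R p (coord c j)"])
qed

lemma N_tau: "N p tau = 2"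
  using tau_deriv[OF N_tspace[OF p]] II_form_R_N by (simp add: II_form_sym[of "N p"])

text \<open>\<tau> vanishes on \<Sigma>, so tangent vectors annihilate it.\<close>

lemma II_form_tangent_R:
  assumes "v \<in> tspace_sub \<A> \<Sigma> p"
  shows "II_form c p v (R p) = 0"
proof -
  have "v tau = 0"
    by (rule tspace_sub_zero[OF assms W(1) pW sing_M[OF p]]) (simp add: tau_sing)
  then show ?thesis
    using tau_deriv[OF tspace_sub_in[OF assms]] by simp
qed

text \<open>Transversality gives the determinant a nonzero differential at p, and its zeros in the
  chart are exactly the points of \<Sigma>, so the division lemma applies to every smooth function
  vanishing on \<Sigma>.\<close>

lemma sing_divide:
  assumes U: "open U" "p \<in> U" and f: "smooth_fun \<A> U f" and zero: "\<And>q. q \<in> U \<inter> \<Sigma> \<Longrightarrow> f q = 0"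
  obtains V h where "open V" "p \<in> V" "V \<subseteq> U \<inter> fst c" "smooth_fun \<A> V h"
    "\<And>q. q \<in> V \<Longrightarrow> f q = gram_det \<A> g c q * h q"
proof -
  let ?U = "U \<inter> fst c"
  have U': "open ?U" "p \<in> ?U"
    using U c chart_open[OF c(1)] by auto
  have d: "frechet_derivative (gram_det \<A> g c \<circ> chart_inv c) (at (snd c p)) \<noteq> (\<lambda>v. 0)"
    using transverse c p by (simp add: transverse_singular_def)
  have 0: "gram_det \<A> g c p = 0"
    using sing_iff[OF c] p by simp
  show thesis
  proof (rule smooth_divide[OF c U' smooth_fun_subset[OF f] smooth_fun_subset[OF gram_det_smooth[OF c(1)]] 0 d])
    show "f q = 0" if "q \<in> ?U \<inter> fst c" "gram_det \<A> g c q = 0" for q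
      using zero[of q] sing_iff[OF c(1), of q] that by auto
    fix V h assume "open V" "p \<in> V" "V \<subseteq> ?U \<inter> fst c" "smooth_fun \<A> V h"
      "\<And>q. q \<in> V \<Longrightarrow> f q = gram_det \<A> g c q * h q"
    then show thesis
      using that by blast
  qed auto
qed

lemma deriv_gram_det_multiple:
  assumes w: "w \<in> tspace \<A> p" and V: "open V" "p \<in> V" "V \<subseteq> fst c" and h: "smooth_fun \<A> V h"
    and f: "\<And>q. q \<in> V \<Longrightarrow> f q = gram_det \<A> g c q * h q"
  shows "w f = h p * w (gram_det \<A> g c)"
proof -
  have "w f = w (\<lambda>q. gram_det \<A> g c q * h q)"
    by (rule tspace_local[OF w V(1,2) sing_M[OF p] f])
  also have "\<dots> = gram_det \<A> g c p * w h + h p * w (gram_det \<A> g c)"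
    by (intro tspace_mult[OF w] smooth_nearI[OF V(1,2) h]
        smooth_nearI[OF chart_open(1)[OF c(1)] c(2) gram_det_smooth[OF c(1)]])
  finally show ?thesis
    using sing_iff[OF c] p by simp
qed

text \<open>A function vanishing on \<Sigma> is the determinant times a smooth h near p, so its
  derivative along w is h(p) times that of the determinant. This replaces a submanifold chart for
  \<Sigma>.\<close>

lemma ker_gram_det:
  assumes w: "w \<in> tspace \<A> p" and 0: "w (gram_det \<A> g c) = 0"
  shows "w \<in> tspace_sub \<A> \<Sigma> p"
proof -
  have "w f = 0" if f: "smooth_near \<A> p f" "\<forall>q\<in>\<Sigma>. f q = 0" for f
  proof -
    obtain U where U: "open U" "p \<in> U" "smooth_fun \<A> U f"
      using f by (auto simp: smooth_near_def)
    obtain V h where V: "open V" "p \<in> V" "V \<subseteq> U \<inter> fst c" "smooth_fun \<A> V h"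
      "\<And>q. q \<in> V \<Longrightarrow> f q = gram_det \<A> g c q * h q"
      by (rule sing_divide[OF U]) (use f(2) in auto)
    show ?thesis
      using deriv_gram_det_multiple[OF w V(1,2) _ V(4,5)] V(3) 0 by simp
  qed
  then show ?thesis
    using w by (auto simp: tspace_sub_def)
qed

text \<open>Otherwise N would be tangent to \<Sigma>, hence orthogonal to itself, against <N,N> =
  1.\<close>

lemma N_gram_det: "N p (gram_det \<A> g c) \<noteq> 0"
  using ker_gram_det[OF N_tspace[OF p]] g_N_tangent[OF p] g_N_N[OF p] by fastforce

text \<open>Subtracting the multiple a N with a = v(det)/N(det) makes v tangent, hence orthogonal to
  N. As v was orthogonal to N already, a <N,N> = 0, so v itself annihilates the determinant.\<close>

lemma orthogonal_N_tangent:
  assumes v: "v \<in> tspace \<A> p" and 0: "g p (N p) v = 0"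
  shows "v \<in> tspace_sub \<A> \<Sigma> p"
proof (rule ker_gram_det[OF v])
  let ?a = "v (gram_det \<A> g c) / N p (gram_det \<A> g c)"
  let ?w = "\<lambda>f. v f - ?a * N p f"
  have w: "?w \<in> tspace \<A> p"
    by (intro tspace_minus tspace_scale v N_tspace[OF p])
  have "?w (gram_det \<A> g c) = 0"
    using N_gram_det by simp
  from g_N_tangent[OF p ker_gram_det[OF w this]] have "g p (N p) v - ?a * g p (N p) (N p) = 0"
    using g_diff_right[OF sing_M[OF p] N_tspace[OF p] v tspace_scale[OF N_tspace[OF p]], of ?a]
      g_scale_right[OF sing_M[OF p] N_tspace[OF p] N_tspace[OF p], of ?a] by simp
  then show "v (gram_det \<A> g c) = 0"
    using 0 g_N_N[OF p] N_gram_det by simp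
qed

end


section \<open>Corank one and approach to \<Sigma> from outside\<close>

context
  fixes c :: "('a, 'm) chart" and p :: 'a
  assumes c: "c \<in> \<A>" "p \<in> fst c" and p: "p \<in> \<Sigma>"
begin

lemma R_nonzero: "\<exists>i. R p (coord c i) \<noteq> 0"
proof (rule ccontr)
  assume "\<not> (\<exists>i. R p (coord c i) \<noteq> 0)"
  then have "II_form c p (R p) (N p) = 0"
    by (simp add: II_form_def)
  then show False
    using II_form_R_N[OF c p] by simp
qed

text \<open>If the radical had two independent vectors, then after a change of frame two rows of the Gram matrix
  would vanish at \<open>p\<close>, and its determinant would have vanishing differential there.\<close>

lemma radical_line:
  assumes v: "v \<in> radical \<A> g p"
  obtains l where "v = (\<lambda>f. l * R p f)"
proof -
  obtain i0 where i0: "R p (coord c i0) \<noteq> 0"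
    using R_nonzero by blast
  \<comment> \<open>Chosen so that u = v - l R has vanishing i0-component. Then R and u have pivots
    at distinct indices i0 and j0, which will make B invertible.\<close>
  define l where "l = v (coord c i0) / R p (coord c i0)"
  define u where "u = (\<lambda>f. v f - l * R p f)"
  have vT: "v \<in> tspace \<A> p"
    using v by (simp add: radical_def)
  have uT: "u \<in> tspace \<A> p"
    unfolding u_def by (intro tspace_minus tspace_scale vT R_tspace[OF p])
  have u0: "u (coord c i0) = 0"
    using i0 by (simp add: u_def l_def)
  have "u = (\<lambda>f. 0)"
  proof (rule ccontr)
    assume "u \<noteq> (\<lambda>f. 0)"
    then obtain j0 where j0: "u (coord c j0) \<noteq> 0"
      using tspace_eq[OF c uT tspace_zero] by auto
    have ij: "i0 \<noteq> j0"
      using u0 j0 by auto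
    have gu: "g p (coord_vec \<A> c k p) u = 0" for k
    proof -
      note e = coord_vec_in_tspace[OF c, of k]
      have "g p (coord_vec \<A> c k p) v = 0" "g p (coord_vec \<A> c k p) (R p) = 0"
        using v R_radical[OF p] e g_sym[OF sing_M[OF p] e vT] g_sym[OF sing_M[OF p] e R_tspace[OF p]]
        by (simp_all add: radical_def)
      then show ?thesis
        unfolding u_def
        by (simp add: g_diff_right[OF sing_M[OF p] e vT tspace_scale[OF R_tspace[OF p]]]
            g_scale_right[OF sing_M[OF p] e R_tspace[OF p]])
    qed
    have gR: "g p (coord_vec \<A> c k p) (R p) = 0" for k
      using g_R[OF p coord_vec_in_tspace[OF c]] g_sym[OF sing_M[OF p] coord_vec_in_tspace[OF c] R_tspace[OF p]]
      by simp
    \<comment> \<open>The identity with rows i0 and j0 replaced by the components of R and u. Its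
      kernel is trivial: the other rows kill the other entries, then row j0 gives x_j0 = 0 because u
      has no i0-component, and row i0 finishes.\<close>
    define B where "B = (\<chi> i j. if i = i0 then R p (coord c j) else if i = j0 then u (coord c j)
        else if i = j then 1 else 0 :: real ^ 'm ^ 'm)"
    have "x = 0" if x: "B *v x = 0" for x
    proof -
      have row: "(\<Sum>j\<in>UNIV. B $ i $ j * x $ j) = 0" for i
        using x by (simp add: vec_eq_iff matrix_vector_mult_def)
      have other: "x $ k = 0" if "k \<noteq> i0" "k \<noteq> j0" for k
        using row[of k] that by (simp add: B_def if_distrib[of "\<lambda>x. x * _"] cong: if_cong)
      have two: "(\<Sum>j\<in>UNIV. a j * x $ j) = a i0 * x $ i0 + a j0 * x $ j0" for a
      proof -
        have "(\<Sum>j\<in>UNIV. a j * x $ j) = (\<Sum>j\<in>{i0, j0}. a j * x $ j)"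
          by (rule sum.mono_neutral_right) (use other in auto)
        then show ?thesis
          using ij by simp
      qed
      have xj: "x $ j0 = 0"
        using row[of j0] two[of "\<lambda>j. u (coord c j)"] ij u0 j0 by (simp add: B_def)
      have xi: "x $ i0 = 0"
        using row[of i0] two[of "\<lambda>j. R p (coord c j)"] i0 xj by (simp add: B_def)
      show "x = 0"
        using other xi xj by (metis vec_eq_iff zero_index)
    qed
    then have "invertible B"
      unfolding invertible_left_inverse matrix_left_invertible_ker by blast
    then have dB: "det B \<noteq> 0"
      by (simp add: invertible_det_nz)
    \<comment> \<open>The matrix B times the Gram matrix, with the constant B frozen at p; its rows
      i0 and j0 vanish at p as R and u are radical there.\<close>
    define E where "E = (\<lambda>i k q. \<Sum>l\<in>UNIV. B $ i $ l * gram c q l k)"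
    have E: "smooth_near \<A> p (E i k)" for i k
      unfolding E_def
      by (intro smooth_near_sum smooth_near_mult smooth_near_const
          smooth_nearI[OF chart_open(1)[OF c(1)] c(2) gram_smooth[OF c(1)]])
    have E0: "E i0 k p = 0" "E j0 k p = 0" for k
    proof -
      have "E i0 k p = (\<Sum>l\<in>UNIV. gram c p k l * R p (coord c l))"
        by (simp add: E_def B_def gram_sym[OF c, of k] mult.commute)
      then show "E i0 k p = 0"
        using g_coord_vec[OF c R_tspace[OF p], of k] gR by simp
      have "E j0 k p = (\<Sum>l\<in>UNIV. gram c p k l * u (coord c l))"
        using ij by (simp add: E_def B_def gram_sym[OF c, of k] mult.commute)
      then show "E j0 k p = 0"
        using g_coord_vec[OF c uT, of k] gu by simp
    qed
    have det_eq: "det B * gram_det \<A> g c q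
        = (\<Sum>\<pi> | \<pi> permutes UNIV. of_int (sign \<pi>) * (\<Prod>i\<in>UNIV. E i (\<pi> i) q))" for q
    proof -
      have "det B * gram_det \<A> g c q = det (B ** (\<chi> i j. gram c q i j))"
        by (simp add: gram_det_eq det_mul)
      then show ?thesis
        by (simp add: det_def matrix_matrix_mult_def E_def)
    qed
    have prod: "smooth_near \<A> p (\<lambda>q. \<Prod>i\<in>I. E i (\<pi> i) q)" for I \<pi>
      by (induction I rule: infinite_finite_induct) (auto intro: smooth_near_const smooth_near_mult E)
    \<comment> \<open>Each summand of the determinant contains one factor from row i0 and one from
      row j0. Both vanish at p, so the product rule leaves nothing.\<close>
    have Nprod: "N p (\<lambda>q. of_int (sign \<pi>) * (\<Prod>i\<in>UNIV. E i (\<pi> i) q)) = 0" for \<pi>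
    proof -
      let ?rest = "\<lambda>q. \<Prod>i\<in>UNIV - {i0} - {j0}. E i (\<pi> i) q"
      have split: "(\<Prod>i\<in>UNIV. E i (\<pi> i) q) = E i0 (\<pi> i0) q * (E j0 (\<pi> j0) q * ?rest q)" for q
        using ij by (simp add: prod.remove[of UNIV i0] prod.remove[of "UNIV - {i0}" j0])
      have "N p (\<lambda>q. E i0 (\<pi> i0) q * (E j0 (\<pi> j0) q * ?rest q)) = 0"
        by (subst tspace_mult[OF N_tspace[OF p] E smooth_near_mult[OF E prod]]) (simp add: E0)
      then show ?thesis
        unfolding split
        by (subst tspace_cmult[OF N_tspace[OF p]]) (auto intro!: smooth_near_mult E prod)
    qed
    have "det B * N p (gram_det \<A> g c) = N p (\<lambda>q. det B * gram_det \<A> g c q)"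
      by (rule tspace_cmult[OF N_tspace[OF p], symmetric])
        (rule smooth_nearI[OF chart_open(1)[OF c(1)] c(2) gram_det_smooth[OF c(1)]])
    also have "\<dots> = (\<Sum>\<pi> | \<pi> permutes UNIV. N p (\<lambda>q. of_int (sign \<pi>) * (\<Prod>i\<in>UNIV. E i (\<pi> i) q)))"
      unfolding det_eq
      by (rule tspace_sum[OF N_tspace[OF p]]) (intro smooth_near_mult smooth_near_const prod)
    also have "\<dots> = 0"
      by (simp only: Nprod sum.neutral_const)
    finally show False
      using dB N_gram_det[OF c p] by simp
  qed
  then have "v = (\<lambda>f. l * R p f)"
    by (auto simp: u_def fun_eq_iff)
  then show thesis
    by (rule that)
qed

text \<open>A straight line in the chart with velocity N p. Along it \<tau> has derivative 2 at t =
  0, so \<tau> is nonzero for small t other than 0 and the curve is off \<Sigma>. The conclusions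
  are phrased without the chart, as rules for limits of smooth functions.\<close>

lemma transversal_curve:
  obtains q :: "real \<Rightarrow> 'a" where "q 0 = p"
    "\<And>U. open U \<Longrightarrow> p \<in> U \<Longrightarrow> \<forall>\<^sub>F t in at 0. q t \<in> U"
    "\<And>f. smooth_near \<A> p f \<Longrightarrow> ((\<lambda>t. f (q t)) has_real_derivative N p f) (at 0)"
    "\<forall>\<^sub>F t in at 0. q t \<notin> \<Sigma>"
proof -
  define e where "e = (\<chi> i. N p (coord c i))"
  define q where "q = (\<lambda>t::real. chart_inv c (snd c p + t *\<^sub>R e))"
  have q0: "q 0 = p"
    using chart_inv_left[OF c] by (simp add: q_def)
  have "isCont (chart_inv c) (snd c p + 0 *\<^sub>R e)"
    using chart_inv_continuous[OF c(1)] chart_open(2)[OF c(1)] c(2)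
    by (simp add: continuous_on_eq_continuous_at)
  moreover have "isCont (\<lambda>t::real. snd c p + t *\<^sub>R e) 0"
    by (auto intro!: continuous_intros)
  ultimately have "isCont q 0"
    unfolding q_def by (rule isCont_o2[rotated])
  then have "(q \<longlongrightarrow> p) (at 0)"
    using q0 by (simp add: isCont_def)
  then have ev: "\<forall>\<^sub>F t in at 0. q t \<in> U" if "open U" "p \<in> U" for U
    using topological_tendstoD that by blast
  have der: "((\<lambda>t. f (q t)) has_real_derivative N p f) (at 0)" if f: "smooth_near \<A> p f" for f
  proof -
    let ?D = "frechet_derivative (f \<circ> chart_inv c) (at (snd c p))"
    have D: "((f \<circ> chart_inv c) has_derivative ?D) (at (snd c p + 0 *\<^sub>R e))"
      using smooth_near_differentiable[OF c f] by simp
    have "((\<lambda>t. snd c p + t *\<^sub>R e) has_derivative (\<lambda>s. s *\<^sub>R e)) (at 0)"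
      by (auto intro!: derivative_eq_intros)
    from has_derivative_compose[OF this D] have "((\<lambda>t. f (q t)) has_derivative (\<lambda>s. ?D (s *\<^sub>R e))) (at 0)"
      by (simp add: q_def o_def)
    moreover have "?D (s *\<^sub>R e) = N p f * s" for s
    proof -
      have "?D (s *\<^sub>R e) = s * ?D e"
        using linear_scale[OF has_derivative_linear[OF D], of s e] by simp
      also have "?D e = coord_comb c p e f"
        by (rule coord_comb_frechet[OF c f, symmetric])
      also have "\<dots> = N p f"
        unfolding coord_comb_def e_def vec_lambda_beta by (rule tspace_decomp[OF c N_tspace[OF p], symmetric])
      finally show ?thesis
        by (simp only: mult.commute)
    qed
    ultimately show ?thesis
      by (simp add: has_field_derivative_def)
  qed
  have "smooth_near \<A> p tau"
    by (rule smooth_nearI[OF W(1) pW[OF c p] tau_smooth])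
  from der[OF this] have "((\<lambda>t. (tau (q t) - tau (q 0)) / (t - 0)) \<longlongrightarrow> 2) (at 0)"
    unfolding has_field_derivative_iff N_tau[OF c p] .
  from tendsto_imp_eventually_ne[OF this, of 0] have "\<forall>\<^sub>F t in at 0. q t \<notin> \<Sigma>"
    by (rule eventually_mono) (auto simp: q0 tau_sing[OF p] dest: tau_sing)
  with q0 ev der show thesis
    by (rule that)
qed

end

text \<open>The transversal curve approaches p through points outside \<Sigma>, and both functions
  are continuous. Values on \<Sigma> are thereby determined by values off \<Sigma>.\<close>

lemma smooth_near_agree:
  assumes p: "p \<in> \<Sigma>" and f: "smooth_near \<A> p f" and h: "smooth_near \<A> p h"
    and U: "open U" "p \<in> U" "\<And>q. q \<in> U - \<Sigma> \<Longrightarrow> f q = h q"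
  shows "f p = h p"
proof -
  obtain c where c: "c \<in> \<A>" "p \<in> fst c"
    using in_chart[OF sing_M[OF p]] by blast
  obtain q where q: "q 0 = p" "\<And>U. open U \<Longrightarrow> p \<in> U \<Longrightarrow> \<forall>\<^sub>F t in at 0. q t \<in> U"
    "\<And>f. smooth_near \<A> p f \<Longrightarrow> ((\<lambda>t. f (q t)) has_real_derivative N p f) (at 0)"
    "\<forall>\<^sub>F t in at 0. q t \<notin> \<Sigma>"
    by (rule transversal_curve[OF c p]) blast
  have lim: "((\<lambda>t. k (q t)) \<longlongrightarrow> k p) (at 0)" if "smooth_near \<A> p k" for k
    using DERIV_isCont[OF q(3)[OF that]] q(1) by (simp add: isCont_def)
  have "\<forall>\<^sub>F t in at 0. f (q t) = h (q t)"
    using q(2)[OF U(1,2)] q(4) by eventually_elim (use U(3) in auto)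
  from Lim_transform_eventually[OF lim[OF f] this] show ?thesis
    using lim[OF h] tendsto_unique[OF trivial_limit_at] by blast
qed

section \<open>The Levi-Civita connection off \<Sigma>\<close>

context
  fixes U assumes U: "open U" "U \<subseteq> M - \<Sigma>"
begin

lemma levi_civita_rules:
  assumes "vfield_on \<A> U X" "vfield_on \<A> U Y" "vfield_on \<A> U Z"
  shows levi_civita_vf: "vfield_on \<A> U (nabla X Y)"
    and levi_civita_torsion: "p \<in> U \<Longrightarrow> nabla X Y p f - nabla Y X p f = lie \<A> X Y p f"
    and nabla_metric:
      "p \<in> U \<Longrightarrow> X p (\<lambda>q. g q (Y q) (Z q)) = g p (nabla X Y p) (Z p) + g p (Y p) (nabla X Z p)"
proof -
  have "open U \<and> U \<subseteq> M - \<Sigma> \<and> vfield_on \<A> U X \<and> vfield_on \<A> U Y \<and> vfield_on \<A> U Z \<and> smooth_fun \<A> U (\<lambda>_. 0)"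
    using assms U smooth_fun_const by simp
  note lc = levi_civita[unfolded levi_civita_def, THEN spec, THEN spec, THEN spec, THEN spec, THEN spec, THEN mp, OF this]
  show "vfield_on \<A> U (nabla X Y)"
    using lc by (rule conjunct1)
  assume p: "p \<in> U"
  note lcp = lc[THEN conjunct2, THEN bspec, OF p]
  show "nabla X Y p f - nabla Y X p f = lie \<A> X Y p f"
    using lcp by simp
  show "X p (\<lambda>q. g q (Y q) (Z q)) = g p (nabla X Y p) (Z p) + g p (Y p) (nabla X Z p)"
    using lcp by simp
qed

lemma nabla_vf: "vfield_on \<A> U X \<Longrightarrow> vfield_on \<A> U Y \<Longrightarrow> vfield_on \<A> U (nabla X Y)"
  by (rule levi_civita_vf)

lemma nabla_torsion:
  assumes "vfield_on \<A> U X" "vfield_on \<A> U Y" "p \<in> U"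
  shows "lie \<A> X Y p = (\<lambda>f. nabla X Y p f - nabla Y X p f)"
  by (rule ext) (rule levi_civita_torsion[OF assms(1,2,2,3), symmetric])

text \<open>Inserting the metric rule and vanishing torsion into the Koszul expression leaves two
  copies of the left side. It trades \<open>nabla\<close>, defined only off \<Sigma>, for an
  expression smooth on all of M.\<close>

lemma koszul:
  assumes X: "vfield_on \<A> U X" and Y: "vfield_on \<A> U Y" and Z: "vfield_on \<A> U Z" and p: "p \<in> U"
  shows "g p (nabla X Y p) (Z p) = dual_conn \<A> g X Y Z p"
proof -
  have pM: "p \<in> M" using U p by blast
  note T = vfield_in_tspace[OF _ p]
  have l: "g p (lie \<A> A B p) (C p) = g p (nabla A B p) (C p) - g p (nabla B A p) (C p)"
    if "vfield_on \<A> U A" "vfield_on \<A> U B" "vfield_on \<A> U C" for A B C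
    unfolding nabla_torsion[OF that(1,2) p]
    by (rule g_diff_left[OF pM]) (intro T nabla_vf that)+
  have s: "g p (A p) (nabla B C p) = g p (nabla B C p) (A p)"
    if "vfield_on \<A> U A" "vfield_on \<A> U B" "vfield_on \<A> U C" for A B C
    by (rule g_sym[OF pM]) (intro T nabla_vf that)+
  show ?thesis
    unfolding dual_conn_def nabla_metric[OF X Y Z p] nabla_metric[OF Y Z X p] nabla_metric[OF Z X Y p]
      l[OF X Y Z] l[OF Y Z X] l[OF Z X Y]
    using s[OF Y X Z] s[OF Z Y X] s[OF X Z Y] by simp
qed

lemma curv_eq:
  assumes A: "vfield_on \<A> U A" and B: "vfield_on \<A> U B" and C: "vfield_on \<A> U C" and D: "vfield_on \<A> U D"
    and p: "p \<in> U"
  shows "g p (curv \<A> nabla A B C p) (D p) = g p (nabla A (nabla B C) p) (D p) - g p (nabla B (nabla A C) p) (D p)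
      - g p (nabla (lie \<A> A B) C p) (D p)"
proof -
  have pM: "p \<in> M" using U p by blast
  note T = vfield_in_tspace[OF _ p]
  have l: "vfield_on \<A> U (lie \<A> A B)"
    using vfield_lie[OF U(1) _ A B] U(2) by auto
  have "curv \<A> nabla A B C p = (\<lambda>f. (nabla A (nabla B C) p f - nabla B (nabla A C) p f) - nabla (lie \<A> A B) C p f)"
    by (rule ext) (simp add: curv_def)
  then show ?thesis
    using g_diff_left[OF pM T[OF D] tspace_minus[OF T[OF nabla_vf[OF A nabla_vf[OF B C]]] T[OF nabla_vf[OF B nabla_vf[OF A C]]]]
        T[OF nabla_vf[OF l C]]]
      g_diff_left[OF pM T[OF D] T[OF nabla_vf[OF A nabla_vf[OF B C]]] T[OF nabla_vf[OF B nabla_vf[OF A C]]]]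
    by simp
qed

text \<open>Use <\<nabla>_A \<nabla>_B C, D> = A<\<nabla>_B C, D> - <\<nabla>_B C, \<nabla>_A D> and
  the Koszul identity. The terms in \<open>dual_conn\<close> are smooth across \<Sigma>, so the
  singular behaviour of the curvature is confined to the last two products.\<close>

lemma curv_dual_conn:
  assumes A: "vfield_on \<A> U A" and B: "vfield_on \<A> U B" and C: "vfield_on \<A> U C" and D: "vfield_on \<A> U D"
    and p: "p \<in> U"
  shows "g p (curv \<A> nabla A B C p) (D p) =
      A p (dual_conn \<A> g B C D) - B p (dual_conn \<A> g A C D) - dual_conn \<A> g (lie \<A> A B) C D p
      - g p (nabla B C p) (nabla A D p) + g p (nabla A C p) (nabla B D p)"
proof -
  have pM: "p \<in> M" using U p by blast
  have l: "vfield_on \<A> U (lie \<A> A B)"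
    using vfield_lie[OF U(1) _ A B] U(2) by auto
  have n: "g p (nabla X (nabla Y C) p) (D p) = X p (dual_conn \<A> g Y C D) - g p (nabla Y C p) (nabla X D p)"
    if X: "vfield_on \<A> U X" and Y: "vfield_on \<A> U Y" for X Y
  proof -
    have "X p (dual_conn \<A> g Y C D) = X p (\<lambda>q. g q (nabla Y C q) (D q))"
      by (rule tspace_local[OF vfield_in_tspace[OF X p] U(1) p pM]) (rule koszul[OF Y C D, symmetric])
    then show ?thesis
      using nabla_metric[OF X nabla_vf[OF Y C] D p] by simp
  qed
  show ?thesis
    unfolding curv_eq[OF A B C D p] n[OF A B] n[OF B A] koszul[OF l C D p] by simp
qed

lemma curv_smooth:
  assumes A: "vfield_on \<A> U A" and B: "vfield_on \<A> U B" and C: "vfield_on \<A> U C" and D: "vfield_on \<A> U D"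
  shows "smooth_fun \<A> U (\<lambda>p. g p (curv \<A> nabla A B C p) (D p))"
proof -
  have UM: "U \<subseteq> M"
    using U(2) by auto
  have *: "smooth_fun \<A> U (\<lambda>p. g p (nabla A (nabla B C) p) (D p) - g p (nabla B (nabla A C) p) (D p)
      - g p (nabla (lie \<A> A B) C p) (D p))"
    by (intro smooth_fun_diff U g_smooth UM nabla_vf vfield_lie A B C D)
  show ?thesis
    by (rule iffD2[OF smooth_fun_cong[OF U(1)] *]) (rule curv_eq[OF A B C D])
qed

end

section \<open>The limit of the singular products\<close>

context
  fixes c :: "('a, 'm) chart" and p :: 'a
  assumes c: "c \<in> \<A>" "p \<in> fst c" and p: "p \<in> \<Sigma>"
begin

text \<open>The numbers X(Y^j) are paired with the radical vector R and vanish. This recognizes the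
  dot products r0 \<bullet> \<alpha>0 and r0 \<bullet> \<beta>0 in the limit as values of
  II.\<close>

lemma sum_dual_conn_coord_vec:
  assumes X: "vfield_on \<A> M X" and Y: "vfield_on \<A> M Y"
  shows "(\<Sum>k\<in>UNIV. R p (coord c k) * dual_conn \<A> g X Y (coord_vec \<A> c k) p) = II_form c p (X p) (Y p)"
proof -
  let ?d = "\<lambda>j. X p (\<lambda>q. Y q (coord c j))"
  let ?E = "\<lambda>k. \<Sum>i\<in>UNIV. \<Sum>j\<in>UNIV. X p (coord c i) * Y p (coord c j) * christoffel c p i j k"
  have "dual_conn \<A> g X Y (coord_vec \<A> c k) p = (\<Sum>j\<in>UNIV. ?d j * gram c p j k) + ?E k" for k
    unfolding dual_conn_coord[OF c chart_open(1)[OF c(1)] c(2) chart_subset[OF c(1)]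
        vfield_subset[OF X chart_subset[OF c(1)]] vfield_subset[OF Y chart_subset[OF c(1)]] vfield_coord_vec[OF c(1)]]
      gram_form_def coord_vec_coord[OF c]
    by (simp add: if_distrib[of "\<lambda>x. x * _"] if_distrib[of "\<lambda>x. _ * x"] cong: if_cong)
  then have "(\<Sum>k\<in>UNIV. R p (coord c k) * dual_conn \<A> g X Y (coord_vec \<A> c k) p)
      = (\<Sum>k\<in>UNIV. \<Sum>j\<in>UNIV. ?d j * R p (coord c k) * gram c p j k) + II_form c p (X p) (Y p)"
    by (simp add: II_form_def distrib_left sum.distrib sum_distrib_left mult.assoc mult.left_commute)
  also have "(\<Sum>k\<in>UNIV. \<Sum>j\<in>UNIV. ?d j * R p (coord c k) * gram c p j k) = gram_form c p ?d (\<lambda>k. R p (coord c k))"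
    unfolding gram_form_def by (rule sum.swap)
  finally show ?thesis
    by (simp add: gram_form_radical[OF c R_radical[OF p]])
qed

text \<open>An instance of \<open>degenerate_limit\<close>: G is the Gram matrix along the curve, r
  the components of \<open>RR\<close>, \<alpha> and \<beta> the values of the two one-forms on the
  coordinate fields, P the components of \<open>nabla X Y\<close>. The Koszul identity gives G P =
  \<alpha> and turns the product of the covariant derivatives into P \<bullet> \<beta>; \<kappa> is
  N \<tau> = 2.\<close>

lemma nabla_nabla_limit:
  assumes X: "vfield_on \<A> M X" and Y: "vfield_on \<A> M Y" and X': "vfield_on \<A> M X'" and Y': "vfield_on \<A> M Y'"
    and q: "q 0 = p" "\<And>U. open U \<Longrightarrow> p \<in> U \<Longrightarrow> \<forall>\<^sub>F t in at 0. q t \<in> U"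
      "\<And>f. smooth_near \<A> p f \<Longrightarrow> ((\<lambda>t. f (q t)) has_real_derivative N p f) (at 0)"
      "\<forall>\<^sub>F t in at 0. q t \<notin> \<Sigma>"
  shows "((\<lambda>t. tau (q t) * g (q t) (nabla X Y (q t)) (nabla X' Y' (q t)))
    \<longlongrightarrow> II_form c p (X p) (Y p) * II_form c p (X' p) (Y' p)) (at 0)"
proof -
  have lim: "((\<lambda>t. f (q t)) \<longlongrightarrow> f p) (at 0)" if "smooth_near \<A> p f" for f
    using DERIV_isCont[OF q(3)[OF that]] q(1) by (simp add: isCont_def)
  have quot: "((\<lambda>t. f (q t) / t) \<longlongrightarrow> N p f) (at 0)" if "smooth_near \<A> p f" "f p = 0" for f
    using q(3)[OF that(1)] q(1) that(2) unfolding has_field_derivative_iff by simp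
  let ?V = "fst c \<inter> W"
  have V: "open ?V" "p \<in> ?V" "?V \<subseteq> M"
    using chart_open[OF c(1)] W c pW[OF c p] by auto
  have qV: "\<forall>\<^sub>F t in at 0. q t \<in> ?V"
    by (rule q(2)[OF V(1,2)])
  have e: "vfield_on \<A> ?V (coord_vec \<A> c k)" for k
    by (rule vfield_subset[OF vfield_coord_vec[OF c(1)]]) auto
  have RV: "vfield_on \<A> ?V RR"
    by (rule vfield_subset[OF RR_vf]) auto
  have XV: "vfield_on \<A> ?V Z" if "vfield_on \<A> M Z" for Z
    using that V(3) by (rule vfield_subset)
  define G where "G = (\<lambda>t. (\<chi> i j. gram c (q t) i j) :: real ^ 'm ^ 'm)"
  define G0 where "G0 = ((\<chi> i j. gram c p i j) :: real ^ 'm ^ 'm)"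
  define r where "r = (\<lambda>t. (\<chi> i. RR (q t) (coord c i)) :: real ^ 'm)"
  define al where "al = (\<lambda>X Y t. (\<chi> k. dual_conn \<A> g X Y (coord_vec \<A> c k) (q t)) :: real ^ 'm)"
  define al0 where "al0 = (\<lambda>X Y. (\<chi> k. dual_conn \<A> g X Y (coord_vec \<A> c k) p) :: real ^ 'm)"
  define P where "P = (\<lambda>X Y t. (\<chi> i. nabla X Y (q t) (coord c i)) :: real ^ 'm)"
  \<comment> \<open>The k-th component of G r. It is smooth and vanishes at p since R is radical, so
    its quotient by t converges to its derivative along N.\<close>
  define F where "F = (\<lambda>k x. g x (coord_vec \<A> c k x) (RR x))"
  have Fs: "smooth_near \<A> p (F k)" for k
    unfolding F_def by (rule smooth_nearI[OF V(1,2) g_smooth[OF V(1,3) e RV]])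
  have F0: "F k p = 0" for k
    using g_sym[OF sing_M[OF p] coord_vec_in_tspace[OF c] R_tspace[OF p]] g_R[OF p coord_vec_in_tspace[OF c]]
    by (simp add: F_def RR_eq[OF p])
  have al_lim: "(al X Y \<longlongrightarrow> al0 X Y) (at 0)" if "vfield_on \<A> M X" "vfield_on \<A> M Y" for X Y
    unfolding al_def al0_def
    by (intro vec_tendstoI) (simp, intro lim smooth_nearI[OF V(1,2)] dual_conn_smooth V XV that e)
  have GR: "(G t *v r t) $ k = F k (q t)" if "q t \<in> ?V" for t k
    using g_coord_vec[OF c(1), of "q t" "RR (q t)" k] that vfield_in_tspace[OF RV, of "q t"]
    by (simp add: G_def r_def F_def matrix_vector_mult_def)
  \<comment> \<open>A kernel vector of the Gram matrix at p is the component tuple of a radical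
    vector, hence a multiple of R.\<close>
  have ker: "\<exists>l. x = l *\<^sub>R (\<chi> i. R p (coord c i))" if "G0 *v x = 0" for x :: "real ^ 'm"
  proof -
    have T: "coord_comb c p x \<in> tspace \<A> p"
      by (rule coord_comb_in_tspace[OF c])
    have "g p (coord_vec \<A> c k p) (coord_comb c p x) = 0" for k
      unfolding g_coord_vec[OF c T] coord_comb_coord[OF c]
      using that by (simp add: G0_def vec_eq_iff matrix_vector_mult_def)
    then have "g p w (coord_comb c p x) = 0" if "w \<in> tspace \<A> p" for w
      using g_expand[OF c that T] by simp
    then have "coord_comb c p x \<in> radical \<A> g p"
      using T g_sym[OF sing_M[OF p] T] by (simp add: radical_def)
    then obtain l where "coord_comb c p x = (\<lambda>f. l * R p f)"
      by (rule radical_line[OF c p])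
    then have "x $ i = l * R p (coord c i)" for i
      using coord_comb_coord[OF c, of x i] by simp
    then show ?thesis
      by (intro exI[of _ l]) (simp add: vec_eq_iff)
  qed
  let ?r0 = "(\<chi> i. R p (coord c i)) :: real ^ 'm"
  have "((\<lambda>t. tau (q t) * (P X Y t \<bullet> al X' Y' t)) \<longlongrightarrow> (?r0 \<bullet> al0 X Y) * (?r0 \<bullet> al0 X' Y')) (at 0)"
  proof (rule degenerate_limit[where G = G and r = r])
    show "((\<lambda>t. G t $ i $ j) \<longlongrightarrow> G0 $ i $ j) (at 0)" for i j
      unfolding G_def G0_def vec_lambda_beta
      by (rule lim[OF smooth_nearI[OF chart_open(1)[OF c(1)] c(2) gram_smooth[OF c(1)]]])
    show "\<forall>\<^sub>F t in at 0. transpose (G t) = G t"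
      using qV by eventually_elim (auto simp: G_def transpose_def vec_eq_iff intro!: gram_sym[OF c(1)])
    have "((\<lambda>t. RR (q t) (coord c i)) \<longlongrightarrow> RR p (coord c i)) (at 0)" for i
      by (rule lim[OF vfield_smooth_near[OF RR_vf W(1) pW[OF c p] smooth_near_coord[OF c]]])
    then show "(r \<longlongrightarrow> ?r0) (at 0)"
      unfolding r_def by (intro vec_tendstoI) (simp add: RR_eq[OF p, symmetric])
    show "(al X Y \<longlongrightarrow> al0 X Y) (at 0)" "(al X' Y' \<longlongrightarrow> al0 X' Y') (at 0)"
      by (intro al_lim X Y X' Y')+
    show "((\<lambda>t. (1 / t) *\<^sub>R (G t *v r t)) \<longlongrightarrow> (\<chi> k. N p (F k))) (at 0)"
    proof (rule vec_tendstoI)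
      fix k
      have "\<forall>\<^sub>F t in at 0. F k (q t) / t = ((1 / t) *\<^sub>R (G t *v r t)) $ k"
        using qV by eventually_elim (simp add: GR)
      from Lim_transform_eventually[OF quot[OF Fs F0] this]
      show "((\<lambda>t. ((1 / t) *\<^sub>R (G t *v r t)) $ k) \<longlongrightarrow> (\<chi> k. N p (F k)) $ k) (at 0)"
        by simp
    qed
    show "\<forall>\<^sub>F t in at 0. tau (q t) = r t \<bullet> (G t *v r t)"
      using qV
    proof eventually_elim
      case (elim t)
      have "RR (q t) \<in> tspace \<A> (q t)"
        using vfield_in_tspace[OF RV elim] .
      then show ?case
        using g_expand[OF c(1), of "q t" "RR (q t)" "RR (q t)"] elim GR[OF elim]
        by (simp add: tau_def inner_vec_def r_def F_def)
    qed
    show "((\<lambda>t. tau (q t) / t) \<longlongrightarrow> 2) (at 0)"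
      using quot[OF smooth_nearI[OF W(1) pW[OF c p] tau_smooth] tau_sing[OF p]] N_tau[OF c p] by simp
    show "G0 *v ?r0 = 0"
      using F0 g_coord_vec[OF c R_tspace[OF p]]
      by (simp add: G0_def vec_eq_iff matrix_vector_mult_def F_def RR_eq[OF p])
    show "\<forall>\<^sub>F t in at 0. G t *v P X Y t = al X Y t"
      using qV q(4)
    proof eventually_elim
      case (elim t)
      let ?U = "?V \<inter> (M - \<Sigma>)"
      have U: "open ?U" "?U \<subseteq> M - \<Sigma>" "q t \<in> ?U"
        using elim V(3) open_Int[OF V(1) open_minus_sing] by auto
      have n: "vfield_on \<A> ?U Z" if "vfield_on \<A> ?V Z" for Z
        by (rule vfield_subset[OF that]) auto
      have nT: "nabla X Y (q t) \<in> tspace \<A> (q t)"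
        by (rule vfield_in_tspace[OF nabla_vf[OF U(1,2)] U(3)]) (intro n XV X Y)+
      have "g (q t) (coord_vec \<A> c k (q t)) (nabla X Y (q t)) = dual_conn \<A> g X Y (coord_vec \<A> c k) (q t)" for k
        using koszul[OF U(1,2) n[OF XV[OF X]] n[OF XV[OF Y]] n[OF e] U(3)]
          g_sym[OF _ coord_vec_in_tspace[OF c(1)] nT, of k] U V(3) by auto
      then show ?case
        using g_coord_vec[OF c(1) _ nT] elim
        by (simp add: vec_eq_iff G_def P_def al_def matrix_vector_mult_def)
    qed
  qed (use ker in auto)
  moreover have "\<forall>\<^sub>F t in at 0. tau (q t) * (P X Y t \<bullet> al X' Y' t)
      = tau (q t) * g (q t) (nabla X Y (q t)) (nabla X' Y' (q t))"
    using qV q(4)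
  proof eventually_elim
    case (elim t)
    let ?U = "?V \<inter> (M - \<Sigma>)"
    have U: "open ?U" "?U \<subseteq> M - \<Sigma>" "q t \<in> ?U"
      using elim V(3) open_Int[OF V(1) open_minus_sing] by auto
    have n: "vfield_on \<A> ?U Z" if "vfield_on \<A> ?V Z" for Z
      by (rule vfield_subset[OF that]) auto
    have nT: "nabla X Y (q t) \<in> tspace \<A> (q t)"
      by (rule vfield_in_tspace[OF nabla_vf[OF U(1,2)] U(3)]) (intro n XV X Y)+
    have nT': "nabla X' Y' (q t) \<in> tspace \<A> (q t)"
      by (rule vfield_in_tspace[OF nabla_vf[OF U(1,2)] U(3)]) (intro n XV X' Y')+
    have "g (q t) (coord_vec \<A> c k (q t)) (nabla X' Y' (q t)) = dual_conn \<A> g X' Y' (coord_vec \<A> c k) (q t)" for k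
      using koszul[OF U(1,2) n[OF XV[OF X']] n[OF XV[OF Y']] n[OF e] U(3)]
        g_sym[OF _ coord_vec_in_tspace[OF c(1)] nT', of k] U V(3) by auto
    then have "P X Y t \<bullet> al X' Y' t = g (q t) (nabla X Y (q t)) (nabla X' Y' (q t))"
      using g_expand[OF c(1) _ nT nT'] elim by (simp add: inner_vec_def P_def al_def)
    then show ?case
      by simp
  qed
  ultimately have "((\<lambda>t. tau (q t) * g (q t) (nabla X Y (q t)) (nabla X' Y' (q t)))
      \<longlongrightarrow> (?r0 \<bullet> al0 X Y) * (?r0 \<bullet> al0 X' Y')) (at 0)"
    by (rule Lim_transform_eventually)
  moreover have "?r0 \<bullet> al0 X Y = II_form c p (X p) (Y p)" "?r0 \<bullet> al0 X' Y' = II_form c p (X' p) (Y' p)"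
    using sum_dual_conn_coord_vec[OF X Y] sum_dual_conn_coord_vec[OF X' Y']
    by (simp_all add: inner_vec_def al0_def)
  ultimately show ?thesis
    by simp
qed

end


section \<open>The tensor \<Upsilon> on \<Sigma>\<close>

lemma upsilon_off_sing:
  assumes ups: "is_upsilon \<A> g nabla W RR T"
    and A: "vfield_on \<A> M A" and B: "vfield_on \<A> M B" and C: "vfield_on \<A> M C" and D: "vfield_on \<A> M D"
    and q: "q \<in> W - \<Sigma>"
  shows "T q (A q) (B q) (C q) (D q) = tau q * g q (curv \<A> nabla A B C q) (D q)"
proof -
  have o: "open (W - \<Sigma>)"
    using open_Int[OF W(1) open_minus_sing] W(2) by (simp add: Int_Diff[symmetric] Int_absorb2)
  have v: "vfield_on \<A> (W - \<Sigma>) X" if "vfield_on \<A> M X" for X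
    by (rule vfield_subset[OF that]) (use W in auto)
  note u = ups[unfolded is_upsilon_def, THEN conjunct2, THEN spec, THEN spec, THEN spec, THEN spec, THEN spec,
      THEN mp, of "W - \<Sigma>" A B C D]
  have "\<forall>p\<in>W - \<Sigma>. T p (A p) (B p) (C p) (D p) = g p (RR p) (RR p) * g p (curv \<A> nabla A B C p) (D p)"
    by (rule u) (intro conjI o order_refl v A B C D)
  then show ?thesis
    using q by (simp add: tau_def)
qed

lemma upsilon_smooth:
  assumes ups: "is_upsilon \<A> g nabla W RR T"
    and "vfield_on \<A> M A" and "vfield_on \<A> M B" and "vfield_on \<A> M C" and "vfield_on \<A> M D"
  shows "smooth_fun \<A> W (\<lambda>p. T p (A p) (B p) (C p) (D p))"
proof -
  note u = ups[unfolded is_upsilon_def smooth_form4_on_def, THEN conjunct1, THEN conjunct2, THEN spec, THEN spec,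
      THEN spec, THEN spec, THEN spec, THEN mp, of W A B C D]
  show ?thesis
    by (rule u) (intro conjI W order_refl vfield_subset[OF _ W(2)] assms)
qed

text \<open>Multiply the curvature formula by \<tau> and move along the transversal curve: the part
  smooth across \<Sigma> tends to 0 with \<tau>, the two singular products tend to products of II,
  and T is continuous at p.\<close>

lemma upsilon_sing:
  assumes c: "c \<in> \<A>" "p \<in> fst c" and p: "p \<in> \<Sigma>" and ups: "is_upsilon \<A> g nabla W RR T"
    and A: "vfield_on \<A> M A" and B: "vfield_on \<A> M B" and C: "vfield_on \<A> M C" and D: "vfield_on \<A> M D"
  shows "T p (A p) (B p) (C p) (D p)
    = II_form c p (A p) (C p) * II_form c p (B p) (D p) - II_form c p (A p) (D p) * II_form c p (B p) (C p)"
proof -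
  obtain q where q: "q 0 = p" "\<And>U. open U \<Longrightarrow> p \<in> U \<Longrightarrow> \<forall>\<^sub>F t in at 0. q t \<in> U"
    "\<And>f. smooth_near \<A> p f \<Longrightarrow> ((\<lambda>t. f (q t)) has_real_derivative N p f) (at 0)"
    "\<forall>\<^sub>F t in at 0. q t \<notin> \<Sigma>"
    by (rule transversal_curve[OF c p]) blast
  have lim: "((\<lambda>t. f (q t)) \<longlongrightarrow> f p) (at 0)" if "smooth_near \<A> p f" for f
    using DERIV_isCont[OF q(3)[OF that]] q(1) by (simp add: isCont_def)
  have M: "open M"
    using chart_open(1) by (auto simp: mcarrier_def)
  \<comment> \<open>The part of the curvature that extends smoothly across \<Sigma>; it is defined
    on all of M because it contains no \<open>nabla\<close>.\<close>
  define \<Phi> where "\<Phi> = (\<lambda>x. A x (dual_conn \<A> g B C D) - B x (dual_conn \<A> g A C D) - dual_conn \<A> g (lie \<A> A B) C D x)"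
  have "smooth_fun \<A> M \<Phi>"
    unfolding \<Phi>_def
    by (intro smooth_fun_diff M dual_conn_smooth vfield_lie order_refl A B C D
        vfield_smooth[OF A M order_refl dual_conn_smooth] vfield_smooth[OF B M order_refl dual_conn_smooth])
  from smooth_nearI[OF M sing_M[OF p] this] have \<Phi>: "((\<lambda>t. \<Phi> (q t)) \<longlongrightarrow> \<Phi> p) (at 0)"
    by (rule lim)
  have \<tau>: "((\<lambda>t. tau (q t)) \<longlongrightarrow> 0) (at 0)"
    using lim[OF smooth_nearI[OF W(1) pW[OF c p] tau_smooth]] tau_sing[OF p] by simp
  let ?T = "\<lambda>x. T x (A x) (B x) (C x) (D x)"
  let ?n = "\<lambda>X Y X' Y' t. tau (q t) * g (q t) (nabla X Y (q t)) (nabla X' Y' (q t))"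
  have "((\<lambda>t. tau (q t) * \<Phi> (q t) - ?n B C A D t + ?n A C B D t)
      \<longlongrightarrow> 0 * \<Phi> p - II_form c p (B p) (C p) * II_form c p (A p) (D p) + II_form c p (A p) (C p) * II_form c p (B p) (D p)) (at 0)"
    by (intro tendsto_add tendsto_diff tendsto_mult \<tau> \<Phi> nabla_nabla_limit[OF c p _ _ _ _ q] A B C D)
  moreover have "\<forall>\<^sub>F t in at 0. tau (q t) * \<Phi> (q t) - ?n B C A D t + ?n A C B D t = ?T (q t)"
    using q(2)[OF W(1) pW[OF c p]] q(4)
  proof eventually_elim
    case (elim t)
    have v: "vfield_on \<A> (M - \<Sigma>) X" if "vfield_on \<A> M X" for X
      by (rule vfield_subset[OF that]) auto
    have "q t \<in> M - \<Sigma>"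
      using elim W(2) by auto
    note curv = curv_dual_conn[OF open_minus_sing order_refl v[OF A] v[OF B] v[OF C] v[OF D] this]
    have "q t \<in> W - \<Sigma>"
      using elim by blast
    show ?case
      unfolding upsilon_off_sing[OF ups A B C D \<open>q t \<in> W - \<Sigma>\<close>] curv \<Phi>_def by (simp add: algebra_simps)
  qed
  ultimately have "((\<lambda>t. ?T (q t)) \<longlongrightarrow> 0 * \<Phi> p - II_form c p (B p) (C p) * II_form c p (A p) (D p)
      + II_form c p (A p) (C p) * II_form c p (B p) (D p)) (at 0)"
    by (rule Lim_transform_eventually)
  moreover have "((\<lambda>t. ?T (q t)) \<longlongrightarrow> ?T p) (at 0)"
    by (rule lim[OF smooth_nearI[OF W(1) pW[OF c p] upsilon_smooth[OF ups A B C D]]])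
  ultimately have "?T p = 0 * \<Phi> p - II_form c p (B p) (C p) * II_form c p (A p) (D p)
      + II_form c p (A p) (C p) * II_form c p (B p) (D p)"
    using tendsto_unique[OF trivial_limit_at] by blast
  then show ?thesis
    by (simp add: mult.commute)
qed

section \<open>Smooth extension of the curvature across \<Sigma>\<close>

text \<open>Local extensions glue: on overlaps they agree off \<Sigma>, and by continuity also on
  it.\<close>

lemma extends_smoothlyI:
  assumes F: "smooth_fun \<A> (M - \<Sigma>) F"
    and ext: "\<And>p. p \<in> \<Sigma> \<Longrightarrow> \<exists>V G. open V \<and> p \<in> V \<and> smooth_fun \<A> V G \<and> (\<forall>q\<in>V - \<Sigma>. G q = F q)"
  shows "extends_smoothly \<A> g F"
proof -
  obtain V G where V: "\<And>p. p \<in> \<Sigma> \<Longrightarrow> open (V p)" "\<And>p. p \<in> \<Sigma> \<Longrightarrow> p \<in> V p"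
    and G: "\<And>p. p \<in> \<Sigma> \<Longrightarrow> smooth_fun \<A> (V p) (G p)"
      "\<And>p q. p \<in> \<Sigma> \<Longrightarrow> q \<in> V p - \<Sigma> \<Longrightarrow> G p q = F q"
    using ext by metis
  \<comment> \<open>At a point q of \<Sigma> the extension chosen for q itself is used; by
    continuity the choice does not affect the value.\<close>
  define H where "H = (\<lambda>q. if q \<in> \<Sigma> then G q q else F q)"
  have HG: "H q = G p q" if "p \<in> \<Sigma>" "q \<in> V p" for p q
  proof (cases "q \<in> \<Sigma>")
    case True
    have "G q q = G p q"
      by (rule smooth_near_agree[OF True smooth_nearI[OF V(1) V(2) G(1)] smooth_nearI[OF V(1) _ G(1)], where U = "V p \<inter> V q"])
        (use that True V G(2) in auto)
    then show ?thesis
      using True by (simp add: H_def)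
  qed (use that G(2) in \<open>simp add: H_def\<close>)
  have "smooth_fun \<A> M H"
  proof (rule smooth_fun_local)
    fix p assume "p \<in> M"
    show "\<exists>U. open U \<and> p \<in> U \<and> smooth_fun \<A> U H"
    proof (cases "p \<in> \<Sigma>")
      case True
      have "smooth_fun \<A> (V p) H"
        by (rule iffD2[OF smooth_fun_cong[OF V(1)[OF True]] G(1)[OF True]]) (rule HG[OF True])
      then show ?thesis
        using V[OF True] by blast
    next
      case False
      have "smooth_fun \<A> (M - \<Sigma>) H"
        by (rule iffD2[OF smooth_fun_cong[OF open_minus_sing] F]) (simp add: H_def)
      then show ?thesis
        using False \<open>p \<in> M\<close> open_minus_sing by blast
    qed
  qed
  then show ?thesis
    unfolding extends_smoothly_def by (intro exI[of _ H]) (simp add: H_def)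
qed

text \<open>If G extends the curvature function, then T = \<tau> G off \<Sigma>, hence on \<Sigma>,
  where \<tau> = 0. Conversely T and \<tau> are both divided by the Gram determinant, and the
  quotient of the two cofactors is the extension.\<close>

lemma extends_smoothly_curv_iff:
  assumes ups: "is_upsilon \<A> g nabla W RR T"
    and A: "vfield_on \<A> M A" and B: "vfield_on \<A> M B" and C: "vfield_on \<A> M C" and D: "vfield_on \<A> M D"
  shows "extends_smoothly \<A> g (\<lambda>p. g p (curv \<A> nabla A B C p) (D p)) \<longleftrightarrow>
    (\<forall>p\<in>\<Sigma>. T p (A p) (B p) (C p) (D p) = 0)"
proof
  let ?F = "\<lambda>p. g p (curv \<A> nabla A B C p) (D p)"
  let ?T = "\<lambda>p. T p (A p) (B p) (C p) (D p)"
  note Ts = upsilon_smooth[OF ups A B C D]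
  note TF = upsilon_off_sing[OF ups A B C D]
  {
    assume "extends_smoothly \<A> g ?F"
    then obtain G where G: "smooth_fun \<A> M G" "\<And>p. p \<in> M - \<Sigma> \<Longrightarrow> G p = ?F p"
      unfolding extends_smoothly_def by blast
    show "\<forall>p\<in>\<Sigma>. ?T p = 0"
    proof
      fix p assume p: "p \<in> \<Sigma>"
      have pW: "p \<in> W"
        using p sing_W by blast
      have "?T p = tau p * G p"
      proof (rule smooth_near_agree[OF p _ _ W(1) pW])
        show "smooth_near \<A> p ?T"
          by (rule smooth_nearI[OF W(1) pW Ts])
        show "smooth_near \<A> p (\<lambda>q. tau q * G q)"
          by (intro smooth_nearI[OF W(1) pW] smooth_fun_mult W tau_smooth smooth_fun_subset[OF G(1) W(2)])
        show "?T q = tau q * G q" if "q \<in> W - \<Sigma>" for q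
          using TF[OF that] G(2)[of q] that W(2) by auto
      qed
      then show "?T p = 0"
        by (simp add: tau_sing[OF p])
    qed
  next
    assume zero: "\<forall>p\<in>\<Sigma>. ?T p = 0"
    have v: "vfield_on \<A> (M - \<Sigma>) X" if "vfield_on \<A> M X" for X
      by (rule vfield_subset[OF that]) auto
    show "extends_smoothly \<A> g ?F"
    proof (rule extends_smoothlyI)
      show "smooth_fun \<A> (M - \<Sigma>) ?F"
        by (rule curv_smooth[OF open_minus_sing order_refl]) (intro v A B C D)+
      fix p assume p: "p \<in> \<Sigma>"
      have pW: "p \<in> W"
        using p sing_W by blast
      obtain c where c: "c \<in> \<A>" "p \<in> fst c"
        using in_chart[OF sing_M[OF p]] by blast
      obtain V1 h where V1: "open V1" "p \<in> V1" "V1 \<subseteq> W \<inter> fst c" "smooth_fun \<A> V1 h"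
        and h: "\<And>q. q \<in> V1 \<Longrightarrow> ?T q = gram_det \<A> g c q * h q"
        by (rule sing_divide[OF c p W(1) pW Ts]) (use zero in auto)
      \<comment> \<open>The cofactor of \<tau> is nonzero at p, since N \<tau> = 2 equals k(p) times
        the derivative of the determinant along N. So \<tau> and the determinant differ by a unit
        near p.\<close>
      obtain V2 k where V2: "open V2" "p \<in> V2" "V2 \<subseteq> W \<inter> fst c" "smooth_fun \<A> V2 k"
        and k: "\<And>q. q \<in> V2 \<Longrightarrow> tau q = gram_det \<A> g c q * k q"
        by (rule sing_divide[OF c p W(1) pW tau_smooth]) (use tau_sing in auto)
      have "N p tau = k p * N p (gram_det \<A> g c)"
        by (rule deriv_gram_det_multiple[OF c p N_tspace[OF p] V2(1,2) _ V2(4) k]) (use V2(3) in auto)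
      then have kp: "k p \<noteq> 0"
        using N_tau[OF c p] by auto
      let ?V = "V1 \<inter> (V2 \<inter> k -` (- {0}))"
      have "continuous_on V2 k"
        by (intro continuous_at_imp_continuous_on ballI smooth_fun_isCont[OF V2(1) _ _ V2(4)])
          (use V2(3) W(2) in auto)
      then have "open (V2 \<inter> k -` (- {0}))"
        by (rule continuous_open_preimage[OF _ V2(1)]) auto
      then have V: "open ?V"
        using V1(1) by blast
      have "smooth_fun \<A> ?V (\<lambda>q. h q * inverse (k q))"
        by (intro smooth_fun_mult smooth_fun_inverse V smooth_fun_subset[OF V1(4)] smooth_fun_subset[OF V2(4)]) auto
      moreover have "h q * inverse (k q) = ?F q" if q: "q \<in> ?V - \<Sigma>" for q
      proof -
        have "gram_det \<A> g c q * h q = (gram_det \<A> g c q * k q) * ?F q"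
          using TF[of q] h[of q] k[of q] q V1(3) by auto
        moreover have "gram_det \<A> g c q \<noteq> 0"
          using sing_iff[OF c(1), of q] q V1(3) by auto
        ultimately show ?thesis
          using q by (simp add: field_simps)
      qed
      ultimately show "\<exists>V G. open V \<and> p \<in> V \<and> smooth_fun \<A> V G \<and> (\<forall>q\<in>V - \<Sigma>. G q = ?F q)"
        using V V1(2) V2(2) kp by (intro exI[of _ ?V] exI[of _ "\<lambda>q. h q * inverse (k q)"]) auto
    qed
  }
qed

section \<open>Decomposition along N, R and the screen\<close>

text \<open>A - \<nu>(A) N is orthogonal to N, hence tangent, so H with R becomes -II with N; the
  part \<nu>(A) N contributes nothing because II(N,N) = 0.\<close>

lemma rho_eq:
  assumes c: "c \<in> \<A>" "p \<in> fst c" and p: "p \<in> \<Sigma>" and A: "vfield_on \<A> M A"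
  shows "rho \<A> g N R A p = II_form c p (A p) (N p)"
proof -
  \<comment> \<open>A smooth extension to W of the field along \<Sigma> that occurs in
    \<open>rho\<close>, with N replaced by \<open>NN\<close>.\<close>
  let ?X = "vf_add A (vf_scale (\<lambda>q. (- 1) * g q (A q) (NN q)) NN)"
  let ?Y = "vf_add A (vf_scale (\<lambda>q. - nu g N A q) N)"
  note AW = vfield_subset[OF A W(2)]
  have X: "vfield_on \<A> W ?X"
    by (intro vfield_add vfield_scale AW NN_vf smooth_fun_mult smooth_fun_const W g_smooth)
  have e: "extends_on \<A> \<Sigma> W ?X ?Y"
    unfolding extends_on_def using W X by (auto simp: vf_add_def vf_scale_def nu_def NN_eq)
  have Ap: "A p \<in> tspace \<A> p"
    by (rule vfield_in_tspace[OF A sing_M[OF p]])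
  have Yp: "?Y p = (\<lambda>f. A p f + (- nu g N A p) * N p f)"
    by (simp add: vf_add_def vf_scale_def)
  have "g p (N p) (?Y p) = g p (N p) (A p) + (- nu g N A p) * g p (N p) (N p)"
    unfolding Yp
    by (simp only: g_add_right[OF sing_M[OF p] N_tspace[OF p] Ap tspace_scale[OF N_tspace[OF p]]]
        g_scale_right[OF sing_M[OF p] N_tspace[OF p] N_tspace[OF p]])
  also have "\<dots> = 0"
    using g_sym[OF sing_M[OF p] Ap N_tspace[OF p]] g_N_N[OF p] by (simp add: nu_def)
  finally have Y0: "g p (N p) (?Y p) = 0" .
  have "?Y p \<in> tspace \<A> p"
    unfolding Yp by (intro tspace_plus tspace_scale Ap N_tspace[OF p])
  from orthogonal_N_tangent[OF c p this Y0] have "?Y p \<in> tspace_sub \<A> \<Sigma> p" .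
  from HH_eq[OF c p e pW[OF c p] this] have "rho \<A> g N R A p = II_form c p (?Y p) (N p)"
    by (simp add: rho_def)
  also have "\<dots> = II_form c p (A p) (N p) + (- nu g N A p) * II_form c p (N p) (N p)"
    unfolding Yp by (simp only: II_form_add_left[OF c p] II_form_scale_left[OF c p])
  finally show ?thesis
    by (simp add: II_form_N_N[OF c p])
qed

lemma nu_rho_det_eq:
  "nu_rho_det \<A> g N R A B p = nu g N A p * rho \<A> g N R B p - nu g N B p * rho \<A> g N R A p"
  by (simp add: nu_rho_det_def det_2 vector_2)

text \<open>Subtracting \<nu>(A) N + \<rho>(A) R from A leaves a screen section, and likewise for C,
  so flatness kills II of the two remainders. The rest follows from II(N,N) = II(R,R) = 0, II(N,R) =
  1 and the II-orthogonality of the screen to N and R.\<close>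

lemma II_flat_form:
  assumes flat: "II_flat \<A> g N R" and c: "c \<in> \<A>" "p \<in> fst c" and p: "p \<in> \<Sigma>"
    and A: "vfield_on \<A> M A" and C: "vfield_on \<A> M C"
  shows "II_form c p (A p) (C p) = nu g N A p * rho \<A> g N R C p + rho \<A> g N R A p * nu g N C p"
proof -
  \<comment> \<open>The screen component, extended to W: the coefficients are written through
    \<open>NN\<close> and \<open>RR\<close> so that they are smooth on W, and they restrict to
    -\<nu>(A) and -\<rho>(A) on \<Sigma>.\<close>
  define scr where "scr = (\<lambda>A. vf_add A (vf_add (vf_scale (\<lambda>q. (- 1) * g q (A q) (NN q)) NN)
      (vf_scale (\<lambda>q. (- 1) * dual_conn \<A> g A NN RR q) RR)))"
  have scr_vf: "vfield_on \<A> W (scr A)" if A: "vfield_on \<A> M A" for A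
    unfolding scr_def
    by (intro vfield_add vfield_scale vfield_subset[OF A W(2)] NN_vf RR_vf smooth_fun_mult smooth_fun_const W
        g_smooth dual_conn_smooth)
  have scr_ext: "extends_on \<A> \<Sigma> W (scr A) (scr A)" if "vfield_on \<A> M A" for A
    unfolding extends_on_def using W scr_vf[OF that] by auto
  have scr_eq: "scr A q = (\<lambda>f. A q f + ((- nu g N A q) * N q f + (- II_form d q (A q) (N q)) * R q f))"
    if "vfield_on \<A> M A" and d: "d \<in> \<A>" "q \<in> fst d" and q: "q \<in> \<Sigma>" for A d q
  proof -
    have "dual_conn \<A> g A NN RR q = II_form d q (A q) (NN q)"
      by (rule dual_conn_II_form[OF d q W(1) pW[OF d q] W(2) vfield_subset[OF that(1) W(2)] NN_vf RR_vf RR_eq[OF q]])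
    then show ?thesis
      by (simp add: scr_def vf_add_def vf_scale_def nu_def NN_eq[OF q] RR_eq[OF q])
  qed
  have scr_tan: "scr A q \<in> tspace_sub \<A> \<Sigma> q" and scr_N: "II_form d q (scr A q) (N q) = 0"
    if A: "vfield_on \<A> M A" and d: "d \<in> \<A>" "q \<in> fst d" and q: "q \<in> \<Sigma>" for A d q
  proof -
    note qM = sing_M[OF q] and NT = N_tspace[OF q] and RT = R_tspace[OF q]
    have AT: "A q \<in> tspace \<A> q"
      by (rule vfield_in_tspace[OF A qM])
    have "g q (N q) (scr A q) = g q (N q) (A q) + (- nu g N A q) * g q (N q) (N q)
        + (- II_form d q (A q) (N q)) * g q (N q) (R q)"
      unfolding scr_eq[OF A d q]
      by (simp only: g_add_right[OF qM NT AT tspace_plus[OF tspace_scale[OF NT] tspace_scale[OF RT]]]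
          g_add_right[OF qM NT tspace_scale[OF NT] tspace_scale[OF RT]] g_scale_right[OF qM NT] NT RT)
    also have "\<dots> = 0"
      using g_sym[OF qM AT NT] g_sym[OF qM NT RT] g_N_N[OF q] g_R[OF q NT] by (simp add: nu_def)
    finally show "scr A q \<in> tspace_sub \<A> \<Sigma> q"
      by (intro orthogonal_N_tangent[OF d q] vfield_in_tspace[OF scr_vf[OF A] pW[OF d q]])
    have "II_form d q (scr A q) (N q) = II_form d q (A q) (N q) + (- nu g N A q) * II_form d q (N q) (N q)
        + (- II_form d q (A q) (N q)) * II_form d q (R q) (N q)"
      unfolding scr_eq[OF A d q] by (simp only: II_form_add_left[OF d q] II_form_scale_left[OF d q])
    then show "II_form d q (scr A q) (N q) = 0"
      by (simp add: II_form_N_N[OF d q] II_form_R_N[OF d q])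
  qed
  have scr_section: "screen_section \<A> g N R (scr A)" if A: "vfield_on \<A> M A" for A
    unfolding screen_section_def vfield_tangent_def vfield_along_def
  proof (intro conjI ballI)
    fix q assume q: "q \<in> \<Sigma>"
    obtain d where d: "d \<in> \<A>" "q \<in> fst d"
      using in_chart[OF sing_M[OF q]] by blast
    show "\<exists>U X. q \<in> U \<and> extends_on \<A> \<Sigma> U X (scr A)"
      using scr_ext[OF A] pW[OF d q] by blast
    show "scr A q \<in> tspace_sub \<A> \<Sigma> q"
      by (rule scr_tan[OF A d q])
    show "HH \<A> g N (scr A) R q = 0"
      using HH_eq[OF d q scr_ext[OF A] pW[OF d q] scr_tan[OF A d q]] scr_N[OF A d q] by simp
  qed
  have "II \<A> g R (scr A) (scr C) p = 0"
    using flat scr_section[OF A] scr_section[OF C] p unfolding II_flat_def by blast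
  then have 0: "II_form c p (scr A p) (scr C p) = 0"
    using II_eq[OF c p scr_ext[OF A] scr_ext[OF C] pW[OF c p]] by simp
  note bil = II_form_add_left[OF c p] II_form_scale_left[OF c p] II_form_add_right[OF c p] II_form_scale_right[OF c p]
  have R0: "II_form c p (scr A p) (R p) = 0"
    by (rule II_form_tangent_R[OF c p scr_tan[OF A c p]])
  have "II_form c p (scr A p) (scr C p) = II_form c p (scr A p) (C p) + ((- nu g N C p) * II_form c p (scr A p) (N p)
      + (- II_form c p (C p) (N p)) * II_form c p (scr A p) (R p))"
    unfolding scr_eq[OF C c p] by (simp only: bil)
  then have "II_form c p (scr A p) (C p) = 0"
    using 0 R0 scr_N[OF A c p] by simp
  moreover have "II_form c p (scr A p) (C p) = II_form c p (A p) (C p) + ((- nu g N A p) * II_form c p (N p) (C p)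
      + (- II_form c p (A p) (N p)) * II_form c p (R p) (C p))"
    unfolding scr_eq[OF A c p] by (simp only: bil)
  \<comment> \<open>Only the N-component of C is seen by R: the screen part and R itself are tangent
    to \<Sigma>, hence II-orthogonal to R.\<close>
  moreover have "II_form c p (R p) (C p) = nu g N C p"
  proof -
    have "II_form c p (scr C p) (R p) = II_form c p (C p) (R p) + ((- nu g N C p) * II_form c p (N p) (R p)
        + (- II_form c p (C p) (N p)) * II_form c p (R p) (R p))"
      unfolding scr_eq[OF C c p] by (simp only: bil)
    moreover have "II_form c p (scr C p) (R p) = 0" "II_form c p (R p) (R p) = 0"
      using II_form_tangent_R[OF c p] scr_tan[OF C c p] R_tangent[OF p] by auto
    ultimately show ?thesis
      using II_form_R_N[OF c p] II_form_sym[OF c p, of "R p" "C p"] II_form_sym[OF c p, of "R p" "N p"] by simp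
  qed
  ultimately show ?thesis
    using rho_eq[OF c p A] rho_eq[OF c p C] II_form_sym[OF c p, of "N p" "C p"] by (simp add: mult.commute)
qed

text \<open>In II(A,C) II(B,D) - II(A,D) II(B,C) the products with \<nu>\<nu> or \<rho>\<rho> from
  the pair A, B cancel, and the mixed ones factor. The identity yields both (2) => (1) and (2) =>
  (3).\<close>

lemma II_flat_upsilon:
  assumes flat: "II_flat \<A> g N R" and ups: "is_upsilon \<A> g nabla W RR T" and p: "p \<in> \<Sigma>"
    and A: "vfield_on \<A> M A" and B: "vfield_on \<A> M B" and C: "vfield_on \<A> M C" and D: "vfield_on \<A> M D"
  shows "T p (A p) (B p) (C p) (D p) = - (nu_rho_det \<A> g N R A B p * nu_rho_det \<A> g N R C D p)"
proof -
  obtain c where c: "c \<in> \<A>" "p \<in> fst c"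
    using in_chart[OF sing_M[OF p]] by blast
  show ?thesis
    unfolding upsilon_sing[OF c p ups A B C D] nu_rho_det_eq
      II_flat_form[OF flat c p A C] II_flat_form[OF flat c p B D] II_flat_form[OF flat c p A D] II_flat_form[OF flat c p B C]
    by (simp add: algebra_simps)
qed

text \<open>With A = N, B = V, C = R, D = X at p, the value is II(N,R) II(V,X) - II(N,X) II(V,R),
  and V tangent gives II(V,R) = 0. The hypothesis must be met by global fields at every point of
  \<Sigma>: B has \<nu> and \<rho> zero throughout, so the first determinant vanishes whatever A, C
  and D are away from p.\<close>

lemma II_flat_if_upsilon:
  assumes ups: "is_upsilon \<A> g nabla W RR T"
    and one: "\<And>A B C D. vfield_on \<A> M A \<Longrightarrow> vfield_on \<A> M B \<Longrightarrow> vfield_on \<A> M C \<Longrightarrow> vfield_on \<A> M D \<Longrightarrow>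
      (\<And>p. p \<in> \<Sigma> \<Longrightarrow> nu_rho_det \<A> g N R A B p * nu_rho_det \<A> g N R C D p = 0) \<Longrightarrow>
      (\<And>p. p \<in> \<Sigma> \<Longrightarrow> T p (A p) (B p) (C p) (D p) = 0)"
  shows "II_flat \<A> g N R"
  unfolding II_flat_def
proof (intro allI impI ballI, elim conjE)
  fix V X p assume V: "screen_section \<A> g N R V" and X: "screen_section \<A> g N R X" and p: "p \<in> \<Sigma>"
  obtain c where c: "c \<in> \<A>" "p \<in> fst c"
    using in_chart[OF sing_M[OF p]] by blast
  have local_ext: "\<exists>U Y. p \<in> U \<and> extends_on \<A> \<Sigma> U Y Z" if "screen_section \<A> g N R Z" for Z
    using that[unfolded screen_section_def vfield_tangent_def vfield_along_def, THEN conjunct1, THEN conjunct1]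
      p by (rule bspec)
  obtain U V' where U: "p \<in> U" "extends_on \<A> \<Sigma> U V' V"
    using local_ext[OF V] by blast
  obtain U' X' where U': "p \<in> U'" "extends_on \<A> \<Sigma> U' X' X"
    using local_ext[OF X] by blast
  have U_vf: "open U" "U \<subseteq> M" "vfield_on \<A> U V'" and U'_vf: "open U'" "U' \<subseteq> M" "vfield_on \<A> U' X'"
    and V'_eq: "\<And>q. q \<in> U \<Longrightarrow> q \<in> \<Sigma> \<Longrightarrow> V' q = V q" and X'p: "X' p = X p"
    using U U' p by (auto simp: extends_on_def)
  have V_tan: "V q \<in> tspace_sub \<A> \<Sigma> q" and V_HH: "HH \<A> g N V R q = 0" if "q \<in> \<Sigma>" for q
    using V that by (auto simp: screen_section_def vfield_tangent_def)
  obtain A where A: "vfield_on \<A> M A" "A p = NN p"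
    by (rule vfield_bump[OF W(1) pW[OF c p] W(2) NN_vf]) blast
  obtain C where C: "vfield_on \<A> M C" "C p = RR p"
    by (rule vfield_bump[OF W(1) pW[OF c p] W(2) RR_vf]) blast
  obtain D where D: "vfield_on \<A> M D" "D p = X' p"
    by (rule vfield_bump[OF U'_vf(1) U'(1) U'_vf(2,3)]) blast
  \<comment> \<open>Here the values away from p matter too: on \<Sigma>, B is a multiple of V inside
    U and zero outside, so it inherits \<nu> = \<rho> = 0 from the screen.\<close>
  obtain B \<phi> where B: "vfield_on \<A> M B" "B p = V' p" and
    B_eq: "\<And>q. q \<in> U \<Longrightarrow> B q = (\<lambda>f. \<phi> q * V' q f)" "\<And>q. q \<notin> U \<Longrightarrow> B q = (\<lambda>f. 0)"
    by (rule vfield_bump[OF U_vf(1) U(1) U_vf(2,3)]) blast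
  have "nu g N B q = 0 \<and> rho \<A> g N R B q = 0" if q: "q \<in> \<Sigma>" for q
  proof -
    obtain d where d: "d \<in> \<A>" "q \<in> fst d"
      using in_chart[OF sing_M[OF q]] by blast
    note qM = sing_M[OF q] and NT = N_tspace[OF q]
    show ?thesis
    proof (cases "q \<in> U")
      case True
      note VT = tspace_sub_in[OF V_tan[OF q]]
      have Bq: "B q = (\<lambda>f. \<phi> q * V q f)"
        using B_eq(1)[OF True] V'_eq[OF True q] by simp
      have "g q (V q) (N q) = 0"
        using g_sym[OF qM VT NT] g_N_tangent[OF q V_tan[OF q]] by simp
      moreover have "II_form d q (V q) (N q) = 0"
        using HH_eq[OF d q U(2) True V_tan[OF q]] V_HH[OF q] by simp
      ultimately show ?thesis
        by (simp add: rho_eq[OF d q B(1)] nu_def Bq II_form_scale_left[OF d q] g_scale_left[OF qM NT VT])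
    next
      case False
      then show ?thesis
        by (simp add: rho_eq[OF d q B(1)] nu_def B_eq(2) g_zero_left[OF qM NT] II_form_def)
    qed
  qed
  then have "nu_rho_det \<A> g N R A B q * nu_rho_det \<A> g N R C D q = 0" if "q \<in> \<Sigma>" for q
    using that by (simp add: nu_rho_det_eq)
  then have "T p (A p) (B p) (C p) (D p) = 0"
    using one[OF A(1) B(1) C(1) D(1)] p by blast
  then have "II_form c p (A p) (C p) * II_form c p (B p) (D p) - II_form c p (A p) (D p) * II_form c p (B p) (C p) = 0"
    using upsilon_sing[OF c p ups A(1) B(1) C(1) D(1)] by simp
  then have "II_form c p (N p) (R p) * II_form c p (V p) (X p) - II_form c p (N p) (X p) * II_form c p (V p) (R p) = 0"
    unfolding A(2) B(2) C(2) D(2) NN_eq[OF p] RR_eq[OF p] X'p V'_eq[OF U(1) p] .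
  then have "II_form c p (V p) (X p) = 0"
    using II_form_tangent_R[OF c p V_tan[OF p]] II_form_R_N[OF c p] II_form_sym[OF c p, of "R p" "N p"] by simp
  moreover have "II \<A> g R V X p = II_form c p (V p) (X p)"
  proof (rule II_eq[OF c p])
    show "extends_on \<A> \<Sigma> (U \<inter> U') V' V" "extends_on \<A> \<Sigma> (U \<inter> U') X' X"
      using extends_on_subset[OF U(2) _ Int_lower1] extends_on_subset[OF U'(2) _ Int_lower2] U_vf(1) U'_vf(1)
      by blast+
  qed (use U U' in auto)
  ultimately show "II \<A> g R V X p = 0"
    by simp
qed

end

theorem theorem10:
  fixes \<A> :: "('a::{t2_space, second_countable_topology}, 'm::finite) chart set"
    and g :: "'a form2"
    and nabla :: "'a vfield \<Rightarrow> 'a vfield \<Rightarrow> 'a vfield"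
    and N R NN RR :: "'a vfield"
    and W :: "'a set"
    and \<Upsilon> :: "'a form4"
  assumes "smooth_structure \<A>" and "connected (mcarrier \<A>)" and "CARD('m) > 2"
    and "transverse_singular \<A> g" and "riemann_lorentz \<A> g" and "tangent_radical \<A> g"
    and "levi_civita \<A> g (mcarrier \<A> - sing \<A> g) nabla"
    and "main_normal \<A> g N" and "main_radical \<A> g N R"
    and "sing \<A> g \<subseteq> W"
    and "geodesic_extension \<A> g nabla W N NN"
    and "canonical_extension \<A> g W NN R RR"
    and "is_upsilon \<A> g nabla W RR \<Upsilon>"
  shows
    "(\<forall>A B C D. vfield_on \<A> (mcarrier \<A>) A \<and> vfield_on \<A> (mcarrier \<A>) B \<and>
                vfield_on \<A> (mcarrier \<A>) C \<and> vfield_on \<A> (mcarrier \<A>) D \<longrightarrow>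
        (extends_smoothly \<A> g (\<lambda>p. g p (curv \<A> nabla A B C p) (D p)) \<longleftrightarrow>
         (\<forall>p \<in> sing \<A> g. \<Upsilon> p (A p) (B p) (C p) (D p) = 0)))
     \<and>
     ((\<forall>A B C D. vfield_on \<A> (mcarrier \<A>) A \<and> vfield_on \<A> (mcarrier \<A>) B \<and>
                 vfield_on \<A> (mcarrier \<A>) C \<and> vfield_on \<A> (mcarrier \<A>) D \<longrightarrow>
         (\<forall>p \<in> sing \<A> g. nu_rho_det \<A> g N R A B p * nu_rho_det \<A> g N R C D p = 0) \<longrightarrow>
         (\<forall>p \<in> sing \<A> g. \<Upsilon> p (A p) (B p) (C p) (D p) = 0))
      \<longleftrightarrow> II_flat \<A> g N R)
     \<and>
     (II_flat \<A> g N R \<longrightarrow>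
       (\<forall>A B C D. vfield_on \<A> (mcarrier \<A>) A \<and> vfield_on \<A> (mcarrier \<A>) B \<and>
                  vfield_on \<A> (mcarrier \<A>) C \<and> vfield_on \<A> (mcarrier \<A>) D \<longrightarrow>
         (\<forall>p \<in> sing \<A> g. \<Upsilon> p (A p) (B p) (C p) (D p) = 0) \<longrightarrow>
         (\<forall>p \<in> sing \<A> g. nu_rho_det \<A> g N R A B p * nu_rho_det \<A> g N R C D p = 0)))"
proof -
  interpret singular_mfd \<A> g nabla N R NN RR W
    by unfold_locales
      (use assms in \<open>auto simp: transverse_singular_def geodesic_extension_def canonical_extension_def\<close>)
  note ups = \<open>is_upsilon \<A> g nabla W RR \<Upsilon>\<close>
  show ?thesis
  proof (intro conjI allI impI iffI ballI; (elim conjE)?)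
    fix A B C D p
    assume v: "vfield_on \<A> M A" "vfield_on \<A> M B" "vfield_on \<A> M C" "vfield_on \<A> M D" and p: "p \<in> \<Sigma>"
    show "\<Upsilon> p (A p) (B p) (C p) (D p) = 0"
      if "extends_smoothly \<A> g (\<lambda>p. g p (curv \<A> nabla A B C p) (D p))"
      using extends_smoothly_curv_iff[OF ups v] that p by blast
    show "\<Upsilon> p (A p) (B p) (C p) (D p) = 0"
      if "II_flat \<A> g N R" "\<forall>p\<in>\<Sigma>. nu_rho_det \<A> g N R A B p * nu_rho_det \<A> g N R C D p = 0"
      using II_flat_upsilon[OF that(1) ups p v] that(2) p by simp
    show "nu_rho_det \<A> g N R A B p * nu_rho_det \<A> g N R C D p = 0"
      if "II_flat \<A> g N R" "\<forall>p\<in>\<Sigma>. \<Upsilon> p (A p) (B p) (C p) (D p) = 0"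
      using II_flat_upsilon[OF that(1) ups p v] that(2) p by simp
  next
    fix A B C D
    assume "vfield_on \<A> M A" "vfield_on \<A> M B" "vfield_on \<A> M C" "vfield_on \<A> M D"
      "\<forall>p\<in>\<Sigma>. \<Upsilon> p (A p) (B p) (C p) (D p) = 0"
    then show "extends_smoothly \<A> g (\<lambda>p. g p (curv \<A> nabla A B C p) (D p))"
      using extends_smoothly_curv_iff[OF ups] by blast
  next
    assume *: "\<forall>A B C D. vfield_on \<A> M A \<and> vfield_on \<A> M B \<and> vfield_on \<A> M C \<and> vfield_on \<A> M D \<longrightarrow>
         (\<forall>p \<in> \<Sigma>. nu_rho_det \<A> g N R A B p * nu_rho_det \<A> g N R C D p = 0) \<longrightarrow>
         (\<forall>p \<in> \<Sigma>. \<Upsilon> p (A p) (B p) (C p) (D p) = 0)"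
    show "II_flat \<A> g N R"
    proof (rule II_flat_if_upsilon[OF ups])
      fix A B C D p
      assume v: "vfield_on \<A> M A" "vfield_on \<A> M B" "vfield_on \<A> M C" "vfield_on \<A> M D"
        and "\<And>p. p \<in> \<Sigma> \<Longrightarrow> nu_rho_det \<A> g N R A B p * nu_rho_det \<A> g N R C D p = 0" and "p \<in> \<Sigma>"
      then show "\<Upsilon> p (A p) (B p) (C p) (D p) = 0"
        using *[THEN spec, THEN spec, THEN spec, THEN spec, of A B C D] by blast
    qed
  qed
qed

end
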